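(* Let $a>0$, $\sigma\in(0,1)$, $\theta>0$, let $H$ be a (non-atomic) probability measure on $\mathbb{X}$, and let $P\sim \mathrm{NGGP}(a,\sigma,\theta,H)$ with $X_1,\dots,X_n\mid P$ i.i.d. from $P$. Let the data $\mathbf{X}=(X_1,\dots,X_n)$ actually be i.i.d. from a discrete probability measure $P_0$ on $\mathbb{X}$. Let $f:\mathbb{X}\to\mathbb{R}$ be measurable with $P_0f^2<\infty$ and $Hf^2<\infty$, and let $0<\alpha<\beta<1$. Let $L_{n,\alpha}f$ denote the $\alpha$-quantile of the posterior distribution of $Pf$ given $\mathbf{X}$. Then, as $n\to\infty$, the probability under $P_0^\infty$ that $$P_0f\in\Big(L_{n,\alpha}f-\tfrac{\sigma n(\pi)}{n}(Hf-\tilde{\mathbb{P}}_nf),\;L_{n,\beta}f-\tfrac{\sigma n(\pi)}{n}(Hf-\tilde{\mathbb{P}}_nf)\Big)$$ converges to $\beta-\alpha$, where $\tilde{\mathbb{P}}_n=\frac1{n(\pi)}\sum_{j=1}^{n(\pi)}\delta_{Y_j}$ and $Y_1,\dots,Y_{n(\pi)}$ are the distinct values among $X_1,\dots,X_n$.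
   Context: $\mathbb{X}$ is a complete separable metric space with its Borel $\sigma$-algebra; $\mu f=\int f\,d\mu$; $P_0^\infty$ is the infinite product measure of $P_0$. NGGP: $\mathrm{NGGP}(a,\sigma,\theta,H)$ is the law of the random probability measure $\tilde\mu/\tilde\mu(\mathbb{X})$, where $\tilde\mu(A)=\int_0^\infty\int_A s\,\tilde N(ds,dx)$ and $\tilde N$ is a Poisson random measure on $\mathbb{R}^+\times\mathbb{X}$ with intensity $\nu(ds,dx)=\frac{a}{\Gamma(1-\sigma)}s^{-1-\sigma}e^{-\theta s}\,ds\,H(dx)$. Posterior: the law of $P$ given $\mathbf{X}$ is understood via the following explicit version (a function of the data). With $Y_1,\dots,Y_{n(\pi)}$ the distinct values of $\mathbf X$ and multiplicities $n_1,\dots,n_{n(\pi)}$, let $U_n$ have density proportional to $\frac{u^{n-1}}{(u+\theta)^{n-n(\pi)\sigma}}e^{-\frac a\sigma(u+\theta)^\sigma}$, $u>0$. Given $U_n=u$, let $\tilde\mu_{(u)}$ be a completely random measure with Lévy intensity $\frac{a}{\Gamma(1-\sigma)}s^{-1-\sigma}e^{-(\theta+u)s}\,ds\,H(dx)$ and, independently, $J_1,\dots,J_{n(\pi)}$ independent, $J_j\sim\mathrm{Gamma}(n_j-\sigma,\text{rate }u+\theta)$. The posterior law of $P$ is the law of $\big(\tilde\mu_{(U_n)}+\sum_jJ_j\delta_{Y_j}\big)/\big(\tilde\mu_{(U_n)}(\mathbb{X})+\sum_jJ_j\big)$.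
   Formalization: The function f is additionally assumed to have positive variance under P_0; without this the claim fails, since for constant f both quantiles of Pf coincide, the open interval is empty and its probability is 0 instead of β−α. *)

theory Defs
  imports "HOL-Probability.Probability"
begin

text \<open>A Poisson random measure with intensity \<open>\<nu>\<close>, realised on the probability space \<open>M\<close>.\<close>

definition poisson_random_measure ::
  "'w measure \<Rightarrow> ('w \<Rightarrow> 'e measure) \<Rightarrow> 'e measure \<Rightarrow> bool" where
  "poisson_random_measure M N \<nu> \<longleftrightarrow>
     prob_space M \<and>
     (\<forall>\<omega>\<in>space M. sets (N \<omega>) = sets \<nu>) \<and>
     (\<forall>A\<in>sets \<nu>. (\<lambda>\<omega>. emeasure (N \<omega>) A) \<in> borel_measurable M) \<and>
     (\<forall>A\<in>sets \<nu>. emeasure \<nu> A < \<infinity> \<longrightarrow>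
        (\<forall>k::nat. measure M {\<omega> \<in> space M. emeasure (N \<omega>) A = of_nat k} =
           measure \<nu> A ^ k / fact k * exp (- measure \<nu> A))) \<and>
     (\<forall>A\<in>sets \<nu>. emeasure \<nu> A = \<infinity> \<longrightarrow> (AE \<omega> in M. emeasure (N \<omega>) A = \<infinity>)) \<and>
     (\<forall>A::nat \<Rightarrow> 'e set. range A \<subseteq> sets \<nu> \<longrightarrow> disjoint_family A \<longrightarrow>
        prob_space.indep_vars M (\<lambda>_. borel) (\<lambda>i \<omega>. emeasure (N \<omega>) (A i)) UNIV)"

text \<open>The intensity lives on \<open>\<real> \<times> 'a\<close> but charges positive jump sizes only.\<close>

definition nggp_intensity ::
  "real \<Rightarrow> real \<Rightarrow> real \<Rightarrow> 'a measure \<Rightarrow> (real \<times> 'a) measure" where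
  "nggp_intensity a \<sigma> \<tau> H =
     density lborel (\<lambda>s. ennreal (if 0 < s
       then a / Gamma (1 - \<sigma>) * s powr (- 1 - \<sigma>) * exp (- \<tau> * s) else 0)) \<Otimes>\<^sub>M H"

text \<open>The measure \<open>A \<mapsto> \<integral> s * 1\<^sub>A(x) N(ds, dx)\<close>.\<close>

definition jump_measure ::
  "(real \<times> 'a) measure \<Rightarrow> 'a::topological_space measure" where
  "jump_measure N = distr (density N (\<lambda>p. ennreal (fst p))) borel snd"

definition add_atoms :: "'a measure \<Rightarrow> 'a set \<Rightarrow> ('a \<Rightarrow> real) \<Rightarrow> 'a measure" where
  "add_atoms \<mu> D J = measure_of (space \<mu>) (sets \<mu>)
     (\<lambda>A. emeasure \<mu> A + (\<Sum>y\<in>D. ennreal (J y) * indicator A y))"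

text \<open>The value for total mass \<open>0\<close> or \<open>\<infinity>\<close> is a dummy: below this happens with
  probability \<open>0\<close>, but some probability measure has to be returned.\<close>

definition normalize_measure :: "'a measure \<Rightarrow> 'a::topological_space measure" where
  "normalize_measure \<mu> =
     (if emeasure \<mu> (space \<mu>) = 0 \<or> emeasure \<mu> (space \<mu>) = \<infinity> then return borel undefined
      else scale_measure (1 / emeasure \<mu> (space \<mu>)) \<mu>)"

definition gamma_law :: "real \<Rightarrow> real \<Rightarrow> real measure" where
  "gamma_law shape rate = density lborel (\<lambda>t. ennreal (if 0 < t
     then rate powr shape / Gamma shape * t powr (shape - 1) * exp (- rate * t) else 0))"

text \<open>A sample of size \<open>n\<close> is given by the first \<open>n\<close> terms of a sequence \<open>x\<close>.\<close>

definition distinct_values :: "nat \<Rightarrow> (nat \<Rightarrow> 'a) \<Rightarrow> 'a set" where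
  "distinct_values n x = x ` {..<n}"

definition multiplicity_in :: "nat \<Rightarrow> (nat \<Rightarrow> 'a) \<Rightarrow> 'a \<Rightarrow> nat" where
  "multiplicity_in n x y = card {i. i < n \<and> x i = y}"

definition distinct_mean :: "nat \<Rightarrow> (nat \<Rightarrow> 'a) \<Rightarrow> ('a \<Rightarrow> real) \<Rightarrow> real" where
  "distinct_mean n x f =
     (\<Sum>y\<in>distinct_values n x. f y) / real (card (distinct_values n x))"

text \<open>The law of the latent variable \<open>U\<^sub>n\<close>, for a sample with \<open>k\<close> distinct values; a measure
  on the space \<open>(0, \<infinity>)\<close>.\<close>

definition latent_law :: "real \<Rightarrow> real \<Rightarrow> real \<Rightarrow> nat \<Rightarrow> nat \<Rightarrow> real measure" where
  "latent_law a \<sigma> \<theta> n k = normalize_measure (density (restrict_space lborel {0<..})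
     (\<lambda>u. ennreal (u ^ (n - 1) / (u + \<theta>) powr (real n - real k * \<sigma>)
        * exp (- (a / \<sigma>) * (u + \<theta>) powr \<sigma>))))"

text \<open>The posterior law of \<open>P\<close> for a sample of size \<open>n \<ge> 1\<close>, as a measure on the space of
  probability measures. For \<open>u > 0\<close>, \<open>N u\<close> is meant to be a Poisson random measure on \<open>M\<close> with
  intensity \<^term>\<open>nggp_intensity a \<sigma> (\<theta> + u) H\<close>; only the marginal law of each \<open>N u\<close> matters.
  The atom weights \<open>J\<close> are indexed by the distinct values themselves.\<close>

definition nggp_posterior ::
  "'w measure \<Rightarrow> (real \<Rightarrow> 'w \<Rightarrow> (real \<times> 'a) measure) \<Rightarrow> real \<Rightarrow> real \<Rightarrow> real \<Rightarrow> nat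
     \<Rightarrow> (nat \<Rightarrow> 'a) \<Rightarrow> 'a::topological_space measure measure" where
  "nggp_posterior M N a \<sigma> \<theta> n x =
     bind (latent_law a \<sigma> \<theta> n (card (distinct_values n x))) (\<lambda>u.
       distr
         (M \<Otimes>\<^sub>M (\<Pi>\<^sub>M y\<in>distinct_values n x.
            gamma_law (real (multiplicity_in n x y) - \<sigma>) (u + \<theta>)))
         (prob_algebra borel)
         (\<lambda>(\<omega>, J). normalize_measure
            (add_atoms (jump_measure (N u \<omega>)) (distinct_values n x) J)))"

definition quantile :: "real measure \<Rightarrow> real \<Rightarrow> real" where
  "quantile Q p = Inf {t. p \<le> cdf Q t}"

text \<open>The \<open>p\<close>-quantile of the law of \<open>P f\<close> when \<open>P\<close> has law \<open>Q\<close>.\<close>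

definition mean_quantile ::
  "'a measure measure \<Rightarrow> ('a \<Rightarrow> real) \<Rightarrow> real \<Rightarrow> real" where
  "mean_quantile Q f p = quantile (distr Q borel (\<lambda>P. \<integral>y. f y \<partial>P)) p"

end

theory Submission
  imports Defs
begin

text \<open>Given \<open>U\<^sub>n = u\<close>, put \<open>V = u + \<theta>\<close>. The event \<open>P f \<le> x\<close> says that
  \<open>V \<integral> (f - x) d\<mu> + \<Sum> (V J\<^sub>y) (f y - x) \<le> 0\<close>, and the variables \<open>V J\<^sub>y\<close> are independent with law
  Gamma\<open>(n\<^sub>y - \<sigma>, 1)\<close>, whatever \<open>u\<close> is; their centred sum is asymptotically normal by Levy
  continuity. By Campbell's formulas the first term has mean \<open>a V\<^sup>\<sigma> H (f - x)\<close> and variance of order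
  \<open>V\<^sup>\<sigma>\<close>, and integration by parts in the density of \<open>U\<^sub>n\<close> shows that \<open>a V\<^sup>\<sigma> - \<sigma> k\<close> has second
  moment \<open>o(n)\<close>, where \<open>k\<close> is the number of distinct values. So Chebyshev's inequality replaces the first
  term by \<open>\<sigma> k H (f - x)\<close>, which produces the correction in the theorem. A sample from a discrete \<open>P\<^sub>0\<close>
  has \<open>k = o(n)\<close>, and likewise for the sum of \<open>f\<^sup>2\<close> over the distinct values, in probability. The
  corrected quantile of order \<open>p\<close> is therefore the sample mean of \<open>f\<close> plus
  \<open>s \<Phi>\<^sup>-\<^sup>1(p) / \<surd>n + o(1 / \<surd>n)\<close>, with \<open>s\<^sup>2\<close> the variance of \<open>f\<close> under \<open>P\<^sub>0\<close>, and the central limit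
  theorem for the sample mean gives the coverage.\<close>

subsection \<open>The gamma law\<close>

text \<open>The coefficients of \<open>x\<close> in \<sigma> k H (f - x) + \<Sum> (n_y - \<sigma>)
  (f y - x) add up to -n; this exact balance fixes the form of the correction. The second moment of
  a V^\<sigma> - \<sigma> k brings in the mean of V^\<sigma> / u, which is controlled through a
  cut-off \<open>K\<close> that is enlarged only after \<open>n\<close> has gone to infinity.

  Two obstacles shape the rest. The random measures \<open>N u\<close> are given separately for each
  \<open>u\<close>, with no joint measurability in \<open>u\<close>, so the argument runs through
  their laws; these form a kernel because the intensity determines all joint laws of counts. And the
  quantile must be a measurable function of the sample although the atoms sit at random places, so
  sums over random sets are recast as sums over sample positions.

  The normal limit is proved for arbitrary deterministic arrays of samples along which four averages
  converge. An argument by contradiction turns it into a bound that is uniform over all samples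
  outside an event of small probability, so convergence in probability of the four averages
  suffices. Positivity of the variance \<open>s2\<close> keeps the limit nondegenerate on the scale
  of \<surd>n.\<close>

lemma sets_gamma_law [simp, measurable_cong]: "sets (gamma_law p r) = sets borel"
  by (simp add: gamma_law_def)

lemma space_gamma_law [simp]: "space (gamma_law p r) = UNIV"
  by (simp add: gamma_law_def)

lemma nn_integral_gamma_kernel:
  fixes p r :: real
  assumes "0 < p" "0 < r"
  shows "(\<integral>\<^sup>+t. ennreal (if 0 < t then t powr (p - 1) * exp (- r * t) else 0) \<partial>lborel)
    = ennreal (Gamma p / r powr p)"
proof -
  have "(\<integral>\<^sup>+t. ennreal (indicator {0..} t * t powr (p - 1) / exp t) \<partial>lborel)
      = ennreal r * (\<integral>\<^sup>+t. ennreal (indicator {0..} (0 + r * t) * (0 + r * t) powr (p - 1) / exp (0 + r * t)) \<partial>lborel)"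
    using assms by (subst nn_integral_real_affine[where c = r and t = 0]) auto
  also have "\<dots> = ennreal r * (\<integral>\<^sup>+t. ennreal (r powr (p - 1)) * ennreal (if 0 < t then t powr (p - 1) * exp (- r * t) else 0) \<partial>lborel)"
    using assms
    by (intro arg_cong2[where f = "(*)"] refl nn_integral_cong)
       (auto simp: indicator_def powr_mult exp_minus field_simps ennreal_mult'[symmetric] zero_le_mult_iff)
  also have "\<dots> = ennreal r * ennreal (r powr (p - 1)) * (\<integral>\<^sup>+t. ennreal (if 0 < t then t powr (p - 1) * exp (- r * t) else 0) \<partial>lborel)"
    by (subst nn_integral_cmult) (auto simp: mult.assoc)
  also have "ennreal r * ennreal (r powr (p - 1)) = ennreal (r powr p)"
    using assms by (simp add: ennreal_mult'[symmetric] powr_mult_base)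
  finally have *: "ennreal (Gamma p) = ennreal (r powr p) * (\<integral>\<^sup>+t. ennreal (if 0 < t then t powr (p - 1) * exp (- r * t) else 0) \<partial>lborel)"
    using Gamma_conv_nn_integral_real[OF assms(1)] by simp
  have "ennreal (Gamma p / r powr p) = ennreal (1 / r powr p) * ennreal (Gamma p)"
    using assms by (simp add: ennreal_mult'[symmetric])
  also have "\<dots> = (\<integral>\<^sup>+t. ennreal (if 0 < t then t powr (p - 1) * exp (- r * t) else 0) \<partial>lborel)"
    unfolding * mult.assoc[symmetric] using assms by (simp add: ennreal_mult'[symmetric])
  finally show ?thesis ..
qed

lemma nn_integral_gamma_law:
  assumes "0 < p" "0 < r" and [measurable]: "g \<in> borel_measurable borel"
  shows "(\<integral>\<^sup>+t. g t \<partial>gamma_law p r) = ennreal (r powr p / Gamma p) *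
    (\<integral>\<^sup>+t. ennreal (if 0 < t then t powr (p - 1) * exp (- r * t) else 0) * g t \<partial>lborel)"
proof -
  have "(\<integral>\<^sup>+t. g t \<partial>gamma_law p r) = (\<integral>\<^sup>+t. ennreal (r powr p / Gamma p) *
      (ennreal (if 0 < t then t powr (p - 1) * exp (- r * t) else 0) * g t) \<partial>lborel)"
    unfolding gamma_law_def using assms Gamma_real_pos[of p]
    by (subst nn_integral_density)
       (auto intro!: nn_integral_cong simp: mult.assoc[symmetric] ennreal_mult'[symmetric])
  also have "\<dots> = ennreal (r powr p / Gamma p) *
    (\<integral>\<^sup>+t. ennreal (if 0 < t then t powr (p - 1) * exp (- r * t) else 0) * g t \<partial>lborel)"
    by (subst nn_integral_cmult) auto
  finally show ?thesis .
qed

text \<open>Multiplying the density by t^k raises the shape from \<open>p\<close> to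
  \<open>p + k\<close>, and the quotient of the two Gamma values is the rising factorial. The
  absolute value, harmless on a law carried by the positive half-line, yields integrability of the
  powers and the norms that dominate the exponential series.\<close>

lemma nn_integral_power_gamma_law:
  assumes "0 < p"
  shows "(\<integral>\<^sup>+t. ennreal (\<bar>t\<bar> ^ k) \<partial>gamma_law p 1) = ennreal (pochhammer p k)"
proof -
  have "(\<integral>\<^sup>+t. ennreal (\<bar>t\<bar> ^ k) \<partial>gamma_law p 1) = ennreal (1 / Gamma p) *
    (\<integral>\<^sup>+t. ennreal (if 0 < t then t powr (p - 1) * exp (- 1 * t) else 0) * ennreal (\<bar>t\<bar> ^ k) \<partial>lborel)"
    using assms by (subst nn_integral_gamma_law) auto
  also have "(\<integral>\<^sup>+t. ennreal (if 0 < t then t powr (p - 1) * exp (- 1 * t) else 0) * ennreal (\<bar>t\<bar> ^ k) \<partial>lborel)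
    = (\<integral>\<^sup>+t. ennreal (if 0 < t then t powr ((p + real k) - 1) * exp (- 1 * t) else 0) \<partial>lborel)"
    by (intro nn_integral_cong)
       (auto simp: ennreal_mult'[symmetric] powr_realpow[symmetric] powr_add[symmetric] algebra_simps)
  also have "\<dots> = ennreal (Gamma (p + real k))"
    using assms by (subst nn_integral_gamma_kernel) auto
  also have "ennreal (1 / Gamma p) * ennreal (Gamma (p + real k)) = ennreal (pochhammer p k)"
    using assms Gamma_real_pos[of p] Gamma_real_pos[of "p + real k"]
    by (subst pochhammer_Gamma) (auto simp: ennreal_mult'[symmetric] elim!: nonpos_Ints_cases)
  finally show ?thesis .
qed

lemma prob_space_gamma_law:
  assumes "0 < p" "0 < r"
  shows "prob_space (gamma_law p r)"
proof
  have "emeasure (gamma_law p r) (space (gamma_law p r)) = (\<integral>\<^sup>+t. 1 \<partial>gamma_law p r)"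
    by simp
  also have "\<dots> = 1"
    using assms Gamma_real_pos[OF assms(1)] nn_integral_gamma_kernel[OF assms]
    by (subst nn_integral_gamma_law) (auto simp: ennreal_mult'[symmetric] less_imp_neq[symmetric])
  finally show "emeasure (gamma_law p r) (space (gamma_law p r)) = 1" .
qed

lemma AE_gamma_law_pos: "AE t in gamma_law p r. 0 < t"
  unfolding gamma_law_def by (subst AE_density) (auto split: if_splits)

text \<open>This removes the latent variable from the atom weights: a weight with rate
  \<open>u + \<theta>\<close>, multiplied by \<open>u + \<theta>\<close>, has a law in which
  \<open>u\<close> no longer occurs.\<close>

lemma distr_gamma_law_scale:
  assumes "0 < p" "0 < r"
  shows "distr (gamma_law p r) borel ((*) r) = gamma_law p 1"
proof (rule measure_eqI)
  fix A assume "A \<in> sets (distr (gamma_law p r) borel ((*) r))"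
  then have [measurable]: "A \<in> sets borel" by simp
  have "emeasure (distr (gamma_law p r) borel ((*) r)) A = (\<integral>\<^sup>+t. indicator A (r * t) \<partial>gamma_law p r)"
    using nn_integral_distr[of "(*) r" "gamma_law p r" borel "indicator A"] by simp
  also have "\<dots> = ennreal (r powr p / Gamma p) *
    (\<integral>\<^sup>+t. ennreal (if 0 < t then t powr (p - 1) * exp (- r * t) else 0) * indicator A (r * t) \<partial>lborel)"
    using assms by (subst nn_integral_gamma_law) auto
  also have "\<dots> = ennreal (1 / Gamma p) * (ennreal (r powr p) *
    (\<integral>\<^sup>+t. ennreal (if 0 < t then t powr (p - 1) * exp (- r * t) else 0) * indicator A (r * t) \<partial>lborel))"
    using assms Gamma_real_pos[of p] by (simp add: mult.assoc[symmetric] ennreal_mult'[symmetric])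
  also have "ennreal (r powr p) *
    (\<integral>\<^sup>+t. ennreal (if 0 < t then t powr (p - 1) * exp (- r * t) else 0) * indicator A (r * t) \<partial>lborel)
    = ennreal r * (\<integral>\<^sup>+t. ennreal (r powr (p - 1)) * (ennreal (if 0 < t then t powr (p - 1) * exp (- r * t) else 0) * indicator A (r * t)) \<partial>lborel)"
    using assms by (subst nn_integral_cmult) (auto simp: mult.assoc[symmetric] ennreal_mult'[symmetric] powr_mult_base)
  also have "\<dots> = ennreal r * (\<integral>\<^sup>+t. (ennreal (if 0 < 0 + r * t then (0 + r * t) powr (p - 1) * exp (- (0 + r * t)) else 0) * indicator A (0 + r * t)) \<partial>lborel)"
  proof -
    have "ennreal (r powr (p - 1)) * ennreal (if 0 < t then t powr (p - 1) * exp (- r * t) else 0)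
      = ennreal (if 0 < 0 + r * t then (0 + r * t) powr (p - 1) * exp (- (0 + r * t)) else 0)" for t
      using assms by (auto simp: powr_mult ennreal_mult'[symmetric] zero_less_mult_iff)
    then show ?thesis by (simp only: mult.assoc[symmetric] add_0)
  qed
  also have "\<dots> = (\<integral>\<^sup>+t. ennreal (if 0 < t then t powr (p - 1) * exp (- t) else 0) * indicator A t \<partial>lborel)"
    using assms by (subst nn_integral_real_affine[where c = r and t = 0]) auto
  also have "ennreal (1 / Gamma p) * \<dots> = (\<integral>\<^sup>+t. indicator A t \<partial>gamma_law p 1)"
    using assms by (subst nn_integral_gamma_law) (auto cong: if_cong)
  also have "\<dots> = emeasure (gamma_law p 1) A" by simp
  finally show "emeasure (distr (gamma_law p r) borel ((*) r)) A = emeasure (gamma_law p 1) A" .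
qed simp

section \<open>Characteristic functions and normal limits of gamma sums\<close>

text \<open>Expanding the exponential and integrating termwise turns the moments into the binomial
  series of (1 - \<i> \<xi>)^(-p). That series has radius of convergence 1, hence the restriction on
  \<xi>; in the limit theorem the arguments tend to 0, so this range is enough.\<close>

lemma char_gamma_law:
  fixes p \<xi> :: real
  assumes "0 < p" "\<bar>\<xi>\<bar> < 1"
  shows "char (gamma_law p 1) \<xi> = (1 - \<i> * \<xi>) powr (- of_real p)"
proof -
  interpret prob_space "gamma_law p 1" using assms by (intro prob_space_gamma_law) auto
  define f where "f k x = (\<i> * of_real (\<xi> * x)) ^ k / fact k" for k and x :: real
  have norm_f: "norm (f k x) = \<bar>\<xi>\<bar> ^ k / fact k * \<bar>x\<bar> ^ k" for k x
    by (simp add: f_def norm_mult norm_divide norm_power power_mult_distrib)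
  have pint: "has_bochner_integral (gamma_law p 1) (\<lambda>x. \<bar>x\<bar> ^ k) (pochhammer p k)" for k
    using assms by (intro has_bochner_integral_nn_integral)
      (auto simp: nn_integral_power_gamma_law intro!: less_imp_le pochhammer_pos)
  have pint': "has_bochner_integral (gamma_law p 1) (\<lambda>x. x ^ k) (pochhammer p k)" for k
    using AE_gamma_law_pos[of p 1]
    by (intro has_bochner_integralI_AE[OF pint]) (auto elim: eventually_mono)
  have fint: "has_bochner_integral (gamma_law p 1) (f k) (of_real (pochhammer p k) * (\<i> * \<xi>) ^ k / fact k)" for k
  proof -
    have "has_bochner_integral (gamma_law p 1) (\<lambda>x. of_real (x ^ k) * ((\<i> * of_real \<xi>) ^ k / fact k))
        (of_real (pochhammer p k) * ((\<i> * \<xi>) ^ k / fact k))"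
      by (intro has_bochner_integral_mult_left has_bochner_integral_of_real pint')
    then show ?thesis by (simp add: f_def[abs_def] power_mult_distrib mult_ac)
  qed
  \<comment> \<open>The sign (-1)^n in the binomial coefficient of a negative exponent cancels the
    one in (-z)^n.\<close>
  have binom: "(\<lambda>n. of_real (pochhammer p n) * z ^ n / fact n) sums ((1 - z) powr (- of_real p))"
    if "norm z < 1" for z :: complex
  proof -
    have "((- of_real p) gchoose n) * (- z) ^ n = of_real (pochhammer p n) * z ^ n / fact n" for n
      unfolding power_minus[of z] by (simp add: gbinomial_pochhammer pochhammer_of_real)
    then show ?thesis
      using gen_binomial_complex[of "-z" "- of_real p"] that by simp
  qed
  have summ: "summable (\<lambda>k. \<integral>x. norm (f k x) \<partial>gamma_law p 1)"
  proof -
    have "(\<integral>x. norm (f k x) \<partial>gamma_law p 1) = \<bar>\<xi>\<bar> ^ k / fact k * pochhammer p k" for k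
      using has_bochner_integral_integral_eq[OF pint[of k]] by (simp add: norm_f)
    moreover have "summable (\<lambda>n. Re (of_real (pochhammer p n) * of_real \<bar>\<xi>\<bar> ^ n / fact n))"
      using binom[of "of_real \<bar>\<xi>\<bar>"] assms by (intro summable_Re sums_summable) auto
    moreover have "Re (of_real (pochhammer p n) * of_real \<bar>\<xi>\<bar> ^ n / fact n) = \<bar>\<xi>\<bar> ^ n / fact n * pochhammer p n" for n
    proof -
      have "of_real (pochhammer p n) * of_real \<bar>\<xi>\<bar> ^ n / fact n = complex_of_real (\<bar>\<xi>\<bar> ^ n / fact n * pochhammer p n)"
        by simp
      then show ?thesis by (simp only: Re_complex_of_real)
    qed
    ultimately show ?thesis by simp
  qed
  have "char (gamma_law p 1) \<xi> = (\<integral>x. (\<Sum>k. f k x) \<partial>gamma_law p 1)"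
    unfolding char_def
    by (intro Bochner_Integration.integral_cong refl)
       (simp add: f_def exp_def scaleR_conv_of_real divide_inverse mult_ac)
  moreover have "(\<lambda>k. \<integral>x. f k x \<partial>gamma_law p 1) sums (\<integral>x. (\<Sum>k. f k x) \<partial>gamma_law p 1)"
  proof (rule sums_integral)
    show "integrable (gamma_law p 1) (f k)" for k using fint[of k] by (simp add: has_bochner_integral_iff)
    show "AE x in gamma_law p 1. summable (\<lambda>i. norm (f i x))"
    proof (rule AE_I2)
      fix x
      show "summable (\<lambda>i. norm (f i x))"
        using summable_exp[of "\<bar>\<xi>\<bar> * \<bar>x\<bar>"] by (simp add: norm_f power_mult_distrib field_simps)
    qed
  qed (rule summ)
  moreover have "(\<lambda>k. \<integral>x. f k x \<partial>gamma_law p 1) sums ((1 - \<i> * \<xi>) powr (- of_real p))"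
    using binom[of "\<i> * \<xi>"] assms has_bochner_integral_integral_eq[OF fint] by (simp add: norm_mult)
  ultimately show ?thesis using sums_unique2 by metis
qed

text \<open>From order three on the series is dominated by a geometric one; the constant 2 bounds
  \<open>1 / (1 - norm z)\<close>.\<close>

lemma Ln_approx_quadratic:
  fixes z :: complex
  assumes "norm z \<le> 1 / 2"
  shows "norm (Ln (1 + z) - (z - z\<^sup>2 / 2)) \<le> 2 * norm z ^ 3"
proof -
  have "(\<lambda>n. (- 1) ^ Suc n / of_nat n * z ^ n) sums Ln (1 + z)"
    using Ln_series assms by simp
  \<comment> \<open>The term of index 0 is 0 because division by 0 gives 0, so splitting off three
    terms removes exactly \<open>z - z\<^sup>2 / 2\<close>.\<close>
  from sums_split_initial_segment[OF this, of 3]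
  have s: "(\<lambda>i. (- 1) ^ Suc (i + 3) / of_nat (i + 3) * z ^ (i + 3)) sums (Ln (1 + z) - (z - z\<^sup>2 / 2))"
    by (simp add: eval_nat_numeral)
  have g: "(\<lambda>i. norm z ^ 3 * norm z ^ i) sums (norm z ^ 3 * (1 / (1 - norm z)))"
    using assms by (intro sums_mult geometric_sums) auto
  have "norm (Ln (1 + z) - (z - z\<^sup>2 / 2)) \<le> norm z ^ 3 * (1 / (1 - norm z))"
  proof -
    have "norm (\<Sum>i. (- 1) ^ Suc (i + 3) / of_nat (i + 3) * z ^ (i + 3)) \<le> (\<Sum>i. norm z ^ 3 * norm z ^ i)"
    proof (rule norm_suminf_le)
      fix i
      have "norm ((- 1) ^ Suc (i + 3) / of_nat (i + 3) * z ^ (i + 3)) = norm z ^ (i + 3) / real (i + 3)"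
        by (simp add: norm_mult norm_divide norm_power del: of_nat_add)
      also have "\<dots> \<le> norm z ^ (i + 3) / 1"
        by (intro divide_left_mono) auto
      finally show "norm ((- 1) ^ Suc (i + 3) / of_nat (i + 3) * z ^ (i + 3)) \<le> norm z ^ 3 * norm z ^ i"
        by (simp add: power_add mult.commute)
    qed (use g in \<open>auto simp: sums_iff\<close>)
    then show ?thesis using s g by (simp add: sums_iff)
  qed
  also have "\<dots> \<le> norm z ^ 3 * 2"
    using assms by (intro mult_left_mono) (auto simp: field_simps)
  finally show ?thesis by simp
qed

text \<open>Independence factorises the characteristic function. Each factor is kept as the
  exponential of a logarithm, so that the product becomes a sum to which the expansion of
  \<open>Ln\<close> applies; the centring by \<open>p y\<close> contributes the linear term that
  cancels the first order of the logarithm.\<close>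

lemma char_gamma_sum:
  fixes p v :: "'b \<Rightarrow> real"
  assumes "finite D" "\<And>y. y \<in> D \<Longrightarrow> 0 < p y" "\<And>y. y \<in> D \<Longrightarrow> \<bar>t * v y\<bar> < 1"
  shows "char (distr (\<Pi>\<^sub>M y\<in>D. gamma_law (p y) 1) borel (\<lambda>G. \<Sum>y\<in>D. (G y - p y) * v y)) t
    = exp (- (\<Sum>y\<in>D. of_real (p y) * (Ln (1 - \<i> * of_real (t * v y)) + \<i> * of_real (t * v y))))"
proof -
  \<comment> \<open>Outside \<open>D\<close> any probability law will do: the product locale asks
    for a \<sigma>-finite measure at every index.\<close>
  define P where "P y = (if y \<in> D then gamma_law (p y) 1 else gamma_law 1 1)" for y
  have P: "prob_space (P y)" for y
    using assms by (auto simp: P_def intro!: prob_space_gamma_law)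
  interpret product_sigma_finite P
    using P by (simp add: product_sigma_finite_def prob_space_imp_sigma_finite)
  have setsP: "sets (P y) = sets borel" for y by (simp add: P_def)
  note [measurable_cong] = setsP
  have eq: "(\<Pi>\<^sub>M y\<in>D. gamma_law (p y) 1) = Pi\<^sub>M D P"
    by (intro PiM_cong) (auto simp: P_def)
  have "char (distr (Pi\<^sub>M D P) borel (\<lambda>G. \<Sum>y\<in>D. (G y - p y) * v y)) t
    = (\<integral>G. (\<Prod>y\<in>D. iexp (t * ((G y - p y) * v y))) \<partial>Pi\<^sub>M D P)"
  proof -
    have "iexp (t * (\<Sum>y\<in>D. (G y - p y) * v y)) = (\<Prod>y\<in>D. iexp (t * ((G y - p y) * v y)))" for G
      unfolding exp_sum[OF assms(1), symmetric] by (simp add: sum_distrib_left)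
    then show ?thesis unfolding char_def by (subst integral_distr) auto
  qed
  also have "\<dots> = (\<Prod>y\<in>D. \<integral>x. iexp (t * ((x - p y) * v y)) \<partial>P y)"
  proof (rule product_integral_prod)
    fix y assume "y \<in> D"
    interpret prob_space "P y" by (rule P)
    show "integrable (P y) (\<lambda>x. iexp (t * ((x - p y) * v y)))"
      by (intro integrable_iexp) auto
  qed fact
  also have "\<dots> = (\<Prod>y\<in>D. exp (- (of_real (p y) * (Ln (1 - \<i> * of_real (t * v y)) + \<i> * of_real (t * v y)))))"
  proof (intro prod.cong refl)
    fix y assume y: "y \<in> D"
    have "(\<integral>x. iexp (t * ((x - p y) * v y)) \<partial>P y) = (\<integral>x. iexp (- (t * v y * p y)) * iexp (t * v y * x) \<partial>P y)"
      by (intro Bochner_Integration.integral_cong refl) (simp add: exp_add[symmetric] algebra_simps)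
    also have "\<dots> = iexp (- (t * v y * p y)) * char (gamma_law (p y) 1) (t * v y)"
      using y by (simp add: char_def P_def)
    also have "\<dots> = exp (- \<i> * (t * v y * p y)) * exp (- of_real (p y) * Ln (1 - \<i> * of_real (t * v y)))"
    proof -
      have "1 - \<i> * of_real (t * v y) \<noteq> 0" by (simp add: complex_eq_iff)
      then show ?thesis using assms y by (subst char_gamma_law) (auto simp: powr_def)
    qed
    also have "\<dots> = exp (- (of_real (p y) * (Ln (1 - \<i> * of_real (t * v y)) + \<i> * of_real (t * v y))))"
      by (simp add: exp_add[symmetric] algebra_simps)
    finally show "(\<integral>x. iexp (t * ((x - p y) * v y)) \<partial>P y) = \<dots>" .
  qed
  also have "\<dots> = exp (- (\<Sum>y\<in>D. of_real (p y) * (Ln (1 - \<i> * of_real (t * v y)) + \<i> * of_real (t * v y))))"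
    using assms(1) by (simp add: exp_sum[symmetric] sum_negf)
  finally show ?thesis by (simp add: eq)
qed

text \<open>Gamma(p, 1) has variance \<open>p\<close>, so the third hypothesis normalises the
  variance of the sum. After centring, the logarithm of the characteristic function is -t^2 / 2
  times this variance, with an error of at most 2 |t|^3 times the variance times the largest weight.
  The number of summands and the sizes of the shapes do not enter, so uniformly small weights give
  the normal limit.\<close>

lemma gamma_array_weak_conv:
  fixes p v :: "nat \<Rightarrow> 'b \<Rightarrow> real"
  assumes fin: "\<And>n. finite (D n)" and pos: "\<And>n y. y \<in> D n \<Longrightarrow> 0 < p n y"
    and var: "(\<lambda>n. \<Sum>y\<in>D n. p n y * (v n y)\<^sup>2) \<longlonglongrightarrow> 1"
    and b: "b \<longlonglongrightarrow> 0" "\<And>n y. y \<in> D n \<Longrightarrow> \<bar>v n y\<bar> \<le> b n"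
  shows "weak_conv_m (\<lambda>n. distr (\<Pi>\<^sub>M y\<in>D n. gamma_law (p n y) 1) borel
    (\<lambda>G. \<Sum>y\<in>D n. (G y - p n y) * v n y)) std_normal_distribution"
proof (rule levy_continuity)
  fix n
  interpret prob_space "\<Pi>\<^sub>M y\<in>D n. gamma_law (p n y) 1"
    using pos by (intro prob_space_PiM prob_space_gamma_law) auto
  show "real_distribution (distr (\<Pi>\<^sub>M y\<in>D n. gamma_law (p n y) 1) borel
    (\<lambda>G. \<Sum>y\<in>D n. (G y - p n y) * v n y))"
    by (intro real_distribution_distr) measurable
next
  fix t :: real
  define T where "T n = (\<Sum>y\<in>D n. of_real (p n y) * (Ln (1 - \<i> * of_real (t * v n y)) + \<i> * of_real (t * v n y)))" for n
  define W where "W n = (\<Sum>y\<in>D n. p n y * (v n y)\<^sup>2)" for n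
  have W0: "W n \<ge> 0" for n using pos by (auto simp: W_def less_imp_le intro!: sum_nonneg)
  have tb: "(\<lambda>n. \<bar>t\<bar> * \<bar>b n\<bar>) \<longlonglongrightarrow> 0" by (intro tendsto_mult_right_zero tendsto_rabs_zero b(1))
  then have ev: "\<forall>\<^sub>F n in sequentially. \<bar>t\<bar> * \<bar>b n\<bar> < 1 / 2"
    by (rule order_tendstoD) auto
  have bound: "norm (T n - of_real (t\<^sup>2 / 2 * W n)) \<le> 2 * \<bar>t\<bar> ^ 3 * \<bar>b n\<bar> * W n" if "\<bar>t\<bar> * \<bar>b n\<bar> < 1 / 2" for n
  proof -
    have "norm (T n - of_real (t\<^sup>2 / 2 * W n)) \<le> (\<Sum>y\<in>D n. 2 * \<bar>t\<bar> ^ 3 * \<bar>b n\<bar> * (p n y * (v n y)\<^sup>2))"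
      unfolding T_def W_def sum_distrib_left of_real_sum sum_subtractf[symmetric]
    proof (rule sum_norm_le)
      fix y assume y: "y \<in> D n"
      define z where "z = - \<i> * of_real (t * v n y)"
      have nz: "norm z = \<bar>t\<bar> * \<bar>v n y\<bar>" by (simp add: z_def norm_mult abs_mult)
      have vb: "\<bar>v n y\<bar> \<le> \<bar>b n\<bar>" using b(2)[OF y] by linarith
      then have "norm z \<le> \<bar>t\<bar> * \<bar>b n\<bar>" unfolding nz by (intro mult_left_mono) auto
      then have "norm z \<le> 1 / 2" using that by linarith
      note L = Ln_approx_quadratic[OF this]
      have z2: "z\<^sup>2 = - of_real (t\<^sup>2 * (v n y)\<^sup>2)"
        by (simp add: z_def power_mult_distrib)
      have "of_real (p n y) * (Ln (1 - \<i> * of_real (t * v n y)) + \<i> * of_real (t * v n y)) - of_real (t\<^sup>2 / 2 * (p n y * (v n y)\<^sup>2))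
          = of_real (p n y) * (Ln (1 + z) - (z - z\<^sup>2 / 2))"
        unfolding z2 by (simp add: z_def algebra_simps)
      then have "norm (of_real (p n y) * (Ln (1 - \<i> * of_real (t * v n y)) + \<i> * of_real (t * v n y)) - of_real (t\<^sup>2 / 2 * (p n y * (v n y)\<^sup>2)))
          = p n y * norm (Ln (1 + z) - (z - z\<^sup>2 / 2))"
        using pos[OF y] by (simp add: norm_mult)
      also have "\<dots> \<le> p n y * (2 * norm z ^ 3)"
        using pos[OF y] L by (intro mult_left_mono) auto
      also have "\<dots> = 2 * \<bar>t\<bar> ^ 3 * \<bar>v n y\<bar> * (p n y * (v n y)\<^sup>2)"
        unfolding nz by (simp add: power_mult_distrib eval_nat_numeral mult_ac)
      also have "\<dots> \<le> 2 * \<bar>t\<bar> ^ 3 * \<bar>b n\<bar> * (p n y * (v n y)\<^sup>2)"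
        using pos[OF y] vb by (intro mult_right_mono mult_left_mono) auto
      finally show "norm (of_real (p n y) * (Ln (1 - \<i> * of_real (t * v n y)) + \<i> * of_real (t * v n y)) - of_real (t\<^sup>2 / 2 * (p n y * (v n y)\<^sup>2)))
        \<le> 2 * \<bar>t\<bar> ^ 3 * \<bar>b n\<bar> * (p n y * (v n y)\<^sup>2)" .
    qed
    then show ?thesis by (simp add: sum_distrib_left W_def)
  qed
  have Wlim: "W \<longlonglongrightarrow> 1" using var by (simp add: W_def[abs_def])
  have "(\<lambda>n. T n - of_real (t\<^sup>2 / 2 * W n)) \<longlonglongrightarrow> 0"
  proof (rule Lim_null_comparison)
    show "\<forall>\<^sub>F n in sequentially. norm (T n - of_real (t\<^sup>2 / 2 * W n)) \<le> 2 * \<bar>t\<bar> ^ 3 * \<bar>b n\<bar> * W n"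
      using ev by eventually_elim (rule bound)
    show "(\<lambda>n. 2 * \<bar>t\<bar> ^ 3 * \<bar>b n\<bar> * W n) \<longlonglongrightarrow> 0"
      using tendsto_mult[OF tendsto_mult_right_zero[OF tendsto_rabs_zero[OF b(1)], of "2 * \<bar>t\<bar> ^ 3"] Wlim] by simp
  qed
  moreover have "(\<lambda>n. of_real (t\<^sup>2 / 2 * W n)) \<longlonglongrightarrow> complex_of_real (t\<^sup>2 / 2 * 1)"
    by (intro tendsto_of_real tendsto_mult_left Wlim)
  ultimately have "T \<longlonglongrightarrow> of_real (t\<^sup>2 / 2)"
    using tendsto_add by fastforce
  then have lim: "(\<lambda>n. exp (- T n)) \<longlonglongrightarrow> exp (- complex_of_real (t\<^sup>2 / 2))"
    by (intro tendsto_intros)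
  have eqv: "\<forall>\<^sub>F n in sequentially. exp (- T n) = char (distr (\<Pi>\<^sub>M y\<in>D n. gamma_law (p n y) 1) borel
    (\<lambda>G. \<Sum>y\<in>D n. (G y - p n y) * v n y)) t"
    using ev
  proof eventually_elim
    case (elim n)
    have "\<bar>t * v n y\<bar> < 1" if "y \<in> D n" for y
    proof -
      have "\<bar>t\<bar> * \<bar>v n y\<bar> \<le> \<bar>t\<bar> * \<bar>b n\<bar>" using b(2)[OF that] by (intro mult_left_mono) auto
      then show ?thesis using elim by (simp add: abs_mult)
    qed
    then show ?case unfolding T_def by (subst char_gamma_sum) (use fin pos in auto)
  qed
  have "char std_normal_distribution t = exp (- complex_of_real (t\<^sup>2 / 2))"
    by (simp add: char_std_normal_distribution exp_of_real[symmetric])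
  then show "(\<lambda>n. char (distr (\<Pi>\<^sub>M y\<in>D n. gamma_law (p n y) 1) borel
    (\<lambda>G. \<Sum>y\<in>D n. (G y - p n y) * v n y)) t) \<longlonglongrightarrow> char std_normal_distribution t"
    using Lim_transform_eventually[OF lim eqv] by simp
next
  show "real_distribution std_normal_distribution" by (rule real_dist_normal_dist)
qed

subsection \<open>The latent variable\<close>

text \<open>The unnormalised density of the latent variable is the case m = n - 1, b = k \<sigma> -
  n. Both exponents are left free so that multiplication by powers of \<open>u\<close> and of
  \<open>u + \<theta>\<close>, and differentiation, lead back to linear combinations of such
  functions.\<close>

definition latent_kernel :: "real \<Rightarrow> real \<Rightarrow> real \<Rightarrow> nat \<Rightarrow> real \<Rightarrow> real \<Rightarrow> real" where
  "latent_kernel a \<sigma> \<theta> m b u = u ^ m * (u + \<theta>) powr b * exp (- (a / \<sigma>) * (u + \<theta>) powr \<sigma>)"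

locale latent =
  fixes a \<sigma> \<theta> :: real
  assumes a: "0 < a" and \<sigma>: "0 < \<sigma>" "\<sigma> < 1" and \<theta>: "0 < \<theta>"
begin

abbreviation "q \<equiv> latent_kernel a \<sigma> \<theta>"
abbreviation "R \<equiv> restrict_space lborel {0::real<..}"

definition I :: "nat \<Rightarrow> real \<Rightarrow> real" where "I m b = (\<integral>u. q m b u \<partial>R)"

lemma q_measurable [measurable]: "q m b \<in> borel_measurable borel"
  unfolding latent_kernel_def by measurable

lemma q_measurable_R [measurable]: "q m b \<in> borel_measurable R"
  by (rule measurable_restrict_space1) simp

lemma q_pos: "0 < u \<Longrightarrow> 0 < q m b u"
  using \<theta> by (simp add: latent_kernel_def)

text \<open>A single term of the exponential series gives exp (-X) \<le> N! / X^N. With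
  \<open>N\<close> so large that the remaining exponent \<open>e\<close> of
  \<open>u + \<theta>\<close> is at most 0, that power is largest at u = 0, where \<theta> > 0 keeps
  it finite.\<close>

lemma q_bound:
  obtains C where "0 < C" "\<And>u. 0 < u \<Longrightarrow> q m b u \<le> C * (1 / (u + \<theta>)\<^sup>2)"
proof -
  define c where "c = a / \<sigma>"
  have c: "0 < c" using a \<sigma> by (simp add: c_def)
  obtain N :: nat where N: "(real m + b + 2) / \<sigma> < real N" using reals_Archimedean2 by blast
  define e where "e = real m + b + 2 - real N * \<sigma>"
  have e: "e \<le> 0" using N \<sigma> by (simp add: e_def field_simps)
  define C where "C = fact N / c ^ N * \<theta> powr e"
  show thesis
  proof (rule that)
    show "0 < C" using c \<theta> by (simp add: C_def)
    fix u :: real assume u: "0 < u"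
    define V where "V = u + \<theta>"
    have V: "0 < V" "\<theta> \<le> V" "u \<le> V" using u \<theta> by (auto simp: V_def)
    have x: "0 < c * V powr \<sigma>" using c V by simp
    have "exp (- (c * V powr \<sigma>)) \<le> fact N / (c * V powr \<sigma>) ^ N"
    proof -
      define X where "X = c * V powr \<sigma>"
      have X: "0 < X" using x by (simp add: X_def)
      then have "X ^ N / fact N \<le> exp X"
        unfolding exp_def using sum_le_suminf[OF summable_exp_generic, of "{N}" X]
        by (auto simp: divide_inverse mult.commute)
      then have "exp (- X) \<le> fact N / X ^ N" using X by (simp add: exp_minus field_simps)
      then show ?thesis by (simp add: X_def)
    qed
    then have "q m b u \<le> V ^ m * V powr b * (fact N / (c * V powr \<sigma>) ^ N)"
      unfolding latent_kernel_def V_def[symmetric] c_def[symmetric] using V u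
      by (intro mult_mono power_mono) auto
    also have "\<dots> = fact N / c ^ N * (V powr e / V powr 2)"
    proof -
      have p: "V ^ m = V powr real m" "(V powr \<sigma>) ^ N = V powr (real N * \<sigma>)"
        using V by (simp_all add: powr_realpow powr_power mult.commute)
      have "V powr e / V powr 2 = V powr real m * V powr b / V powr (real N * \<sigma>)"
        using V by (simp add: e_def powr_add powr_diff)
      then show ?thesis unfolding power_mult_distrib p by simp
    qed
    also have "\<dots> \<le> fact N / c ^ N * (\<theta> powr e / V powr 2)"
      using powr_mono2'[OF e \<theta> V(2)] c by (intro mult_left_mono divide_right_mono) simp_all
    also have "\<dots> = C * (1 / (u + \<theta>)\<^sup>2)"
      using V by (simp add: C_def V_def)
    finally show "q m b u \<le> C * (1 / (u + \<theta>)\<^sup>2)" .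
  qed
qed

lemma integrable_q: "integrable R (q m b)"
proof -
  obtain C where C: "0 < C" "\<And>u. 0 < u \<Longrightarrow> q m b u \<le> C * (1 / (u + \<theta>)\<^sup>2)" by (rule q_bound[of m b]) auto
  have "(\<integral>\<^sup>+u. ennreal (1 / (u + \<theta>)\<^sup>2) * indicator {0..} u \<partial>lborel) = ennreal (0 - (- (1 / (0 + \<theta>))))"
  proof (rule nn_integral_FTC_atLeast)
    fix x :: real assume "0 \<le> x"
    then show "((\<lambda>u. - (1 / (u + \<theta>))) has_real_derivative 1 / (x + \<theta>)\<^sup>2) (at x)"
      using \<theta> by (auto intro!: derivative_eq_intros simp: power2_eq_square field_simps)
  next
    have "((\<lambda>u. inverse (\<theta> + u)) \<longlongrightarrow> 0) at_top"
      by (intro tendsto_inverse_0_at_top filterlim_tendsto_add_at_top[OF tendsto_const] filterlim_ident)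
    then show "((\<lambda>u. - (1 / (u + \<theta>))) \<longlongrightarrow> 0) at_top"
      using tendsto_minus by (fastforce simp: inverse_eq_divide add.commute)
  qed auto
  then have "(\<integral>\<^sup>+u. ennreal (1 / (u + \<theta>)\<^sup>2) * indicator {0..} u \<partial>lborel) < \<infinity>" by simp
  then have "integrable lborel (\<lambda>u. indicator {0..} u * (1 / (u + \<theta>)\<^sup>2))"
  proof (intro integrableI_bounded)
    assume *: "(\<integral>\<^sup>+u. ennreal (1 / (u + \<theta>)\<^sup>2) * indicator {0..} u \<partial>lborel) < \<infinity>"
    have "ennreal (norm (indicator {0..} u * (1 / (u + \<theta>)\<^sup>2))) = ennreal (1 / (u + \<theta>)\<^sup>2) * indicator {0..} u" for u :: real
      by (simp add: indicator_def)
    then show "(\<integral>\<^sup>+u. ennreal (norm (indicator {0..} u * (1 / (u + \<theta>)\<^sup>2))) \<partial>lborel) < \<infinity>"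
      using * by (simp only:)
  qed measurable
  then have "integrable lborel (\<lambda>u. C * (indicator {0..} u * (1 / (u + \<theta>)\<^sup>2)))"
    by (rule integrable_mult_right)
  then have "integrable lborel (\<lambda>u. indicator {0<..} u * q m b u)"
  proof (rule Bochner_Integration.integrable_bound)
    show "AE u in lborel. norm (indicator {0<..} u * q m b u) \<le> norm (C * (indicator {0..} u * (1 / (u + \<theta>)\<^sup>2)))"
    proof (rule AE_I2)
      fix u
      show "norm (indicator {0<..} u * q m b u) \<le> norm (C * (indicator {0..} u * (1 / (u + \<theta>)\<^sup>2)))"
        using C q_pos[of u m b] C(2)[of u] by (auto simp: indicator_def abs_mult)
    qed
  qed auto
  then show ?thesis by (subst integrable_restrict_space) (auto simp: set_integrable_def)
qed

text \<open>The derivative of \<open>q m b\<close> integrates to 0 over the half-line: the boundary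
  term at 0 vanishes because of \<open>1 \<le> m\<close>, the one at infinity by the exponential
  factor. The normalisation a / \<sigma> in the exponent is what leaves the plain coefficient
  \<open>a\<close> on the right.\<close>

lemma I_recurrence:
  assumes "1 \<le> m"
  shows "real m * I (m - 1) b + b * I m (b - 1) = a * I m (b + \<sigma> - 1)"
proof -
  define f where "f u = real m * q (m - 1) b u + b * q m (b - 1) u - a * q m (b + \<sigma> - 1) u" for u
  have int: "integrable R f" unfolding f_def
    by (intro Bochner_Integration.integrable_diff Bochner_Integration.integrable_add integrable_mult_right integrable_q)
  have der: "(q m b has_real_derivative f u) (at u)" if "0 < u" for u
  proof -
    have V: "0 < u + \<theta>" using that \<theta> by simp
    show ?thesis unfolding latent_kernel_def f_def
      by (rule derivative_eq_intros refl V | simp)+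
        (use V \<sigma> in \<open>simp add: powr_diff powr_add field_simps\<close>)
  qed
  have lim0: "((q m b) \<longlongrightarrow> 0) (at_right 0)"
  proof -
    have "((\<lambda>u. u ^ m * (u + \<theta>) powr b * exp (- (a / \<sigma>) * (u + \<theta>) powr \<sigma>)) \<longlongrightarrow>
       0 ^ m * (0 + \<theta>) powr b * exp (- (a / \<sigma>) * (0 + \<theta>) powr \<sigma>)) (at_right 0)"
      using \<theta> by (intro tendsto_intros) auto
    moreover have "(0::real) ^ m = 0" using assms by (cases m) auto
    ultimately show ?thesis by (simp add: latent_kernel_def[abs_def])
  qed
  have liminf: "((q m b) \<longlongrightarrow> 0) at_top"
  proof -
    obtain C where C: "0 < C" "\<And>u. 0 < u \<Longrightarrow> q m b u \<le> C * (1 / (u + \<theta>)\<^sup>2)" by (rule q_bound[of m b]) auto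
    show ?thesis
    proof (rule Lim_null_comparison)
      show "\<forall>\<^sub>F u in at_top. norm (q m b u) \<le> C * (inverse (\<theta> + u) * inverse (\<theta> + u))"
        using eventually_gt_at_top[of 0]
      proof eventually_elim
        case (elim u)
        then show ?case using C(2)[of u] q_pos[of u m b] by (simp add: power2_eq_square field_simps)
      qed
      have "((\<lambda>u. inverse (\<theta> + u)) \<longlongrightarrow> 0) at_top"
        by (intro tendsto_inverse_0_at_top filterlim_tendsto_add_at_top[OF tendsto_const] filterlim_ident)
      from tendsto_mult_left[OF tendsto_mult[OF this this], of C]
      show "((\<lambda>u. C * (inverse (\<theta> + u) * inverse (\<theta> + u))) \<longlongrightarrow> 0) at_top" by simp
    qed
  qed
  have ei: "einterval 0 \<infinity> = {0<..}" by (auto simp: einterval_def)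
  have "(LBINT u=0..\<infinity>. f u) = 0 - 0"
  proof (rule interval_integral_FTC_integrable)
    fix u assume "0 < ereal u" "ereal u < \<infinity>"
    then have u: "0 < u" by simp
    show "(q m b has_vector_derivative f u) (at u)"
      using der[OF u] by (simp add: has_real_derivative_iff_has_vector_derivative)
    show "isCont f u" unfolding f_def latent_kernel_def using u \<theta> by (intro continuous_intros) auto
  next
    show "set_integrable lborel (einterval 0 \<infinity>) f"
      using int unfolding ei by (subst (asm) integrable_restrict_space) (auto simp: set_integrable_def)
    show "((q m b \<circ> real_of_ereal) \<longlongrightarrow> 0) (at_right 0)"
      using lim0 by (simp add: zero_ereal_def ereal_tendsto_simps1)
    show "((q m b \<circ> real_of_ereal) \<longlongrightarrow> 0) (at_left \<infinity>)"
      using liminf by (simp add: ereal_tendsto_simps1)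
  qed simp
  then have "(\<integral>u. f u \<partial>R) = 0"
    by (simp add: interval_lebesgue_integral_def ei integral_restrict_space set_lebesgue_integral_def)
  moreover have "(\<integral>u. f u \<partial>R) = real m * I (m - 1) b + b * I m (b - 1) - a * I m (b + \<sigma> - 1)"
    unfolding f_def I_def by (simp add: integrable_q)
  ultimately show ?thesis by simp
qed

lemma space_R: "space R = {0<..}" by simp

text \<open>The recurrence mixes two powers of \<open>u\<close>; writing one factor V as u +
  \<theta> brings all integrals back to the same power.\<close>

lemma I_split: "I m (b + 1) = I (Suc m) b + \<theta> * I m b"
proof -
  have "I m (b + 1) = (\<integral>u. q (Suc m) b u + \<theta> * q m b u \<partial>R)"
    unfolding I_def
  proof (intro Bochner_Integration.integral_cong refl)
    fix u assume "u \<in> space R"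
    then have "0 < u + \<theta>" using \<theta> by (simp add: space_R)
    then show "q m (b + 1) u = q (Suc m) b u + \<theta> * q m b u"
      by (simp add: latent_kernel_def powr_add algebra_simps)
  qed
  then show ?thesis by (simp add: I_def integrable_q)
qed

lemma I_pos: "0 < I m b"
proof -
  have "I m b \<ge> 0" unfolding I_def
    by (intro integral_nonneg_AE AE_I2) (auto intro: less_imp_le q_pos)
  moreover have "I m b \<noteq> 0"
  proof
    assume "I m b = 0"
    then have "AE u in R. q m b u = 0"
      unfolding I_def by (subst (asm) integral_nonneg_eq_0_iff_AE)
        (auto simp: integrable_q intro!: AE_I2 less_imp_le q_pos)
    then have "AE u in lborel. 0 < u \<longrightarrow> q m b u = 0"
      by (subst (asm) AE_restrict_space_iff) auto
    then have "AE u in lborel. u \<notin> {1..2::real}"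
    proof eventually_elim
      case (elim u)
      then show ?case using q_pos[of u m b] by auto
    qed
    then have "{1..2::real} \<in> null_sets lborel"
      by (subst AE_iff_null_sets) auto
    then show False by (simp add: null_sets_def)
  qed
  ultimately show ?thesis by simp
qed

lemma latent_law_density:
  "latent_law a \<sigma> \<theta> n k = scale_measure (1 / ennreal (I (n - 1) (real k * \<sigma> - real n)))
     (density R (\<lambda>u. ennreal (q (n - 1) (real k * \<sigma> - real n) u)))"
proof -
  let ?q = "q (n - 1) (real k * \<sigma> - real n)"
  have "density R (\<lambda>u. ennreal (u ^ (n - 1) / (u + \<theta>) powr (real n - real k * \<sigma>)
        * exp (- (a / \<sigma>) * (u + \<theta>) powr \<sigma>))) = density R (\<lambda>u. ennreal (?q u))"
    unfolding latent_kernel_def minus_diff_eq[of "real n" "real k * \<sigma>", symmetric] powr_minus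
    by (simp add: divide_inverse)
  moreover have "emeasure (density R (\<lambda>u. ennreal (?q u))) (space (density R (\<lambda>u. ennreal (?q u))))
     = ennreal (I (n - 1) (real k * \<sigma> - real n))"
  proof -
    have "emeasure (density R (\<lambda>u. ennreal (?q u))) (space (density R (\<lambda>u. ennreal (?q u))))
      = (\<integral>\<^sup>+u. ennreal (?q u) \<partial>R)"
    proof -
      have "emeasure (density R (\<lambda>u. ennreal (?q u))) (space R) = (\<integral>\<^sup>+u. ennreal (?q u) * indicator (space R) u \<partial>R)"
        by (rule emeasure_density[OF _ sets.top]) measurable
      also have "\<dots> = (\<integral>\<^sup>+u. ennreal (?q u) \<partial>R)" by (rule nn_integral_cong) simp
      finally show ?thesis by (simp only: space_density)
    qed
    also have "\<dots> = ennreal (I (n - 1) (real k * \<sigma> - real n))"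
      unfolding I_def by (intro nn_integral_eq_integral integrable_q AE_I2) (auto intro: less_imp_le q_pos)
    finally show ?thesis .
  qed
  ultimately show ?thesis
    using I_pos[of "n - 1" "real k * \<sigma> - real n"] by (simp add: latent_law_def normalize_measure_def)
qed

lemma sets_latent_law: "sets (latent_law a \<sigma> \<theta> n k) = sets R"
  by (simp add: latent_law_density)

lemma space_latent_law: "space (latent_law a \<sigma> \<theta> n k) = {0<..}"
  using sets_eq_imp_space_eq[OF sets_latent_law] by simp

lemma nn_integral_latent_law:
  assumes "integrable R (\<lambda>u. q (n - 1) (real k * \<sigma> - real n) u * \<phi> u)" "\<And>u. 0 < u \<Longrightarrow> 0 \<le> \<phi> u"
    and [measurable]: "\<phi> \<in> borel_measurable R"
  shows "(\<integral>\<^sup>+u. ennreal (\<phi> u) \<partial>latent_law a \<sigma> \<theta> n k)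
    = ennreal ((\<integral>u. q (n - 1) (real k * \<sigma> - real n) u * \<phi> u \<partial>R) / I (n - 1) (real k * \<sigma> - real n))"
proof -
  let ?q = "q (n - 1) (real k * \<sigma> - real n)" and ?I = "I (n - 1) (real k * \<sigma> - real n)"
  have "(\<integral>\<^sup>+u. ennreal (\<phi> u) \<partial>latent_law a \<sigma> \<theta> n k) = 1 / ennreal ?I * (\<integral>\<^sup>+u. ennreal (?q u) * ennreal (\<phi> u) \<partial>R)"
  proof -
    have "(\<integral>\<^sup>+u. ennreal (\<phi> u) \<partial>latent_law a \<sigma> \<theta> n k) = 1 / ennreal ?I * (\<integral>\<^sup>+u. ennreal (\<phi> u) \<partial>density R (\<lambda>u. ennreal (?q u)))"
      unfolding latent_law_density by (rule nn_integral_scale_measure) measurable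
    also have "(\<integral>\<^sup>+u. ennreal (\<phi> u) \<partial>density R (\<lambda>u. ennreal (?q u))) = (\<integral>\<^sup>+u. ennreal (?q u) * ennreal (\<phi> u) \<partial>R)"
      by (rule nn_integral_density) measurable
    finally show ?thesis .
  qed
  also have "(\<integral>\<^sup>+u. ennreal (?q u) * ennreal (\<phi> u) \<partial>R) = (\<integral>\<^sup>+u. ennreal (?q u * \<phi> u) \<partial>R)"
    using assms(2) by (intro nn_integral_cong) (simp add: ennreal_mult' q_pos less_imp_le)
  also have "\<dots> = ennreal (\<integral>u. ?q u * \<phi> u \<partial>R)"
    using assms(2) by (intro nn_integral_eq_integral assms(1) AE_I2) (auto simp: space_R q_pos less_imp_le)
  also have "1 / ennreal ?I * ennreal (\<integral>u. ?q u * \<phi> u \<partial>R) = ennreal ((\<integral>u. ?q u * \<phi> u \<partial>R) / ?I)"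
    using I_pos[of "n - 1" "real k * \<sigma> - real n"]
      divide_ennreal[of 1 "I (n - 1) (real k * \<sigma> - real n)"]
    by (simp add: ennreal_mult'[symmetric])
  finally show ?thesis .
qed

lemma prob_space_latent_law: "prob_space (latent_law a \<sigma> \<theta> n k)"
proof
  have "emeasure (latent_law a \<sigma> \<theta> n k) (space (latent_law a \<sigma> \<theta> n k))
     = (\<integral>\<^sup>+u. ennreal 1 \<partial>latent_law a \<sigma> \<theta> n k)" by simp
  also have "\<dots> = ennreal (I (n - 1) (real k * \<sigma> - real n) / I (n - 1) (real k * \<sigma> - real n))"
    by (subst nn_integral_latent_law) (auto simp: integrable_q I_def)
  finally show "emeasure (latent_law a \<sigma> \<theta> n k) (space (latent_law a \<sigma> \<theta> n k)) = 1"
    using I_pos[of "n - 1" "real k * \<sigma> - real n"] by simp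
qed

section \<open>Moment bounds for the latent variable\<close>

text \<open>A bound for the mean of a V^\<sigma>. The terms after the first come from the cut-off
  \<open>M\<close> in the next proof: \<open>sqrt n\<close> balances the right-hand side n \<theta>
  of the moment identity, and \<open>2 * \<theta>\<close> keeps M - \<theta> comparable to
  \<open>M\<close>. What matters later is that the bound is o(n) as soon as k is.\<close>

definition latent_bound :: "nat \<Rightarrow> nat \<Rightarrow> real" where
  "latent_bound n k = 4 * (1 + real k * \<sigma>) + 2 * \<theta> * sqrt n + 2 * a * (sqrt n powr \<sigma>) + 2 * a * (2 * \<theta>) powr \<sigma>"

text \<open>The exponent \<sigma> - 1 is negative, so (x + y)^(\<sigma> - 1) is at most x^(\<sigma>
  - 1) and at most y^(\<sigma> - 1); multiply by \<open>x\<close> and by \<open>y\<close>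
  respectively.\<close>

lemma powr_add_le:
  assumes "0 \<le> x" "0 \<le> y"
  shows "(x + y) powr \<sigma> \<le> x powr \<sigma> + y powr \<sigma>"
proof (cases "x = 0 \<or> y = 0")
  case False
  then have xy: "0 < x" "0 < y" using assms by auto
  have "(x + y) powr \<sigma> = x * (x + y) powr (\<sigma> - 1) + y * (x + y) powr (\<sigma> - 1)"
    using powr_mult_base[of "x + y" "\<sigma> - 1"] xy by (simp add: distrib_right)
  also have "\<dots> \<le> x * x powr (\<sigma> - 1) + y * y powr (\<sigma> - 1)"
    using xy \<sigma> by (intro add_mono mult_left_mono powr_mono2') auto
  also have "\<dots> = x powr \<sigma> + y powr \<sigma>" using xy by (simp add: powr_mult_base)
  finally show ?thesis .
qed auto

text \<open>Integrating by parts against \<open>u (u + \<theta>)\<close> makes the expectation of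
  \<open>(a V\<^sup>\<sigma> - (1 + k \<sigma>)) u\<close>, with \<open>V = u + \<theta>\<close>, equal to \<open>n \<theta>\<close>; monotonicity of
  \<open>V\<^sup>\<sigma>\<close> around a cut-off then bounds its mean.\<close>

lemma latent_first_moment:
  fixes n k :: nat
  assumes "1 \<le> n"
  defines "b \<equiv> real k * \<sigma> - real n"
  shows "a * I (n - 1) (b + \<sigma>) \<le> latent_bound n k * I (n - 1) b"
proof -
  define \<kappa> where "\<kappa> = 1 + real k * \<sigma>"
  have \<kappa>: "1 \<le> \<kappa>" using \<sigma> by (simp add: \<kappa>_def)
  \<comment> \<open>Each summand has one task: the first makes \<open>a * M powr \<sigma>\<close> at
    least \<open>\<kappa>\<close>, the second keeps \<open>real n / M\<close> at most
    \<open>sqrt n\<close>, and the third gives M - \<theta> \<ge> M / 2.\<close>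
  define M where "M = (\<kappa> / a) powr (1 / \<sigma>) + sqrt n + 2 * \<theta>"
  have n: "1 \<le> sqrt n" using assms by simp
  have M: "sqrt n \<le> M" "2 * \<theta> \<le> M" "(\<kappa> / a) powr (1 / \<sigma>) \<le> M" "0 < M" using \<theta> n by (auto simp: M_def intro: add_nonneg_pos)
  have pk: "((\<kappa> / a) powr (1 / \<sigma>)) powr \<sigma> = \<kappa> / a"
    using \<kappa> a \<sigma> by (simp add: powr_powr)
  have "\<kappa> / a \<le> M powr \<sigma>"
    using powr_mono2[of \<sigma> "(\<kappa> / a) powr (1 / \<sigma>)" M] M \<sigma> pk by simp
  then have aM: "\<kappa> \<le> a * M powr \<sigma>" using a by (simp add: field_simps)
  have aM': "a * M powr \<sigma> \<le> \<kappa> + a * (sqrt n powr \<sigma>) + a * (2 * \<theta>) powr \<sigma>"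
  proof -
    have "M powr \<sigma> \<le> ((\<kappa> / a) powr (1 / \<sigma>)) powr \<sigma> + sqrt n powr \<sigma> + (2 * \<theta>) powr \<sigma>"
      unfolding M_def using powr_add_le[of "(\<kappa> / a) powr (1 / \<sigma>) + sqrt n" "2 * \<theta>"]
        powr_add_le[of "(\<kappa> / a) powr (1 / \<sigma>)" "sqrt n"] \<theta> by simp
    then have "a * M powr \<sigma> \<le> a * (\<kappa> / a + sqrt n powr \<sigma> + (2 * \<theta>) powr \<sigma>)"
      unfolding pk using a by (intro mult_left_mono) auto
    then show ?thesis using a by (simp add: distrib_left)
  qed
  define I0 I1 J0 J1 where "I0 = I (n - 1) b" and "I1 = I (n - 1) (b + 1)"
    and "J0 = I (n - 1) (b + \<sigma>)" and "J1 = I (n - 1) (b + \<sigma> + 1)"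
  have I0: "0 < I0" by (simp add: I0_def I_pos)
  have rec: "real n * I1 + (b + 1) * I n b = a * I n (b + \<sigma>)"
    using I_recurrence[of n "b + 1"] assms(1) by (simp add: I1_def add_ac)
  have s1: "I1 = I n b + \<theta> * I0" and s2: "J1 = I n (b + \<sigma>) + \<theta> * J0"
    using I_split[of "n - 1" b] I_split[of "n - 1" "b + \<sigma>"] assms(1) by (simp_all add: I1_def I0_def J1_def J0_def)
  have "a * (J1 - \<theta> * J0) = real n * I1 + (b + 1) * (I1 - \<theta> * I0)"
    using rec s1 s2 by simp
  \<comment> \<open>Since b + 1 = \<kappa> - n, the two multiples of \<open>I1\<close> combine to
    \<open>\<kappa> * I1\<close>.\<close>
  then have A: "a * J1 - \<kappa> * I1 = \<theta> * (a * J0 - \<kappa> * I0) + real n * \<theta> * I0"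
    by (simp add: \<kappa>_def b_def algebra_simps)
  \<comment> \<open>Apart from the kernel, the integrand is (a V^\<sigma> - \<kappa>) (V - M) + (a
    M^\<sigma> - \<kappa>) M, which equals a (V^\<sigma> - M^\<sigma>) (V - M) + (a M^\<sigma> -
    \<kappa>) V. The first term is nonnegative by monotonicity, the second by the choice of
    \<open>M\<close>.\<close>
  have ge: "0 \<le> (a * J1 - \<kappa> * I1) - M * (a * J0 - \<kappa> * I0) + (a * M powr \<sigma> - \<kappa>) * M * I0"
  proof -
    have "0 \<le> (\<integral>u. (a * q (n - 1) (b + \<sigma> + 1) u - \<kappa> * q (n - 1) (b + 1) u)
        - M * (a * q (n - 1) (b + \<sigma>) u - \<kappa> * q (n - 1) b u) + (a * M powr \<sigma> - \<kappa>) * M * q (n - 1) b u \<partial>R)"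
    proof (intro integral_nonneg_AE AE_I2)
      fix u assume "u \<in> space R"
      then have u: "0 < u" by (simp add: space_R)
      define V where "V = u + \<theta>"
      have V: "0 < V" using u \<theta> by (simp add: V_def)
      have e: "q (n - 1) (b + s) u = V powr s * q (n - 1) b u" for s
        by (simp add: latent_kernel_def V_def powr_add)
      have e1: "q (n - 1) (b + \<sigma> + 1) u = V powr \<sigma> * V * q (n - 1) b u" "q (n - 1) (b + 1) u = V * q (n - 1) b u"
        using e[of "\<sigma> + 1"] e[of 1] V by (simp_all add: powr_add add.assoc)
      have "0 \<le> a * ((V powr \<sigma> - M powr \<sigma>) * (V - M)) + (a * M powr \<sigma> - \<kappa>) * V"
      proof (rule add_nonneg_nonneg)
        have "0 \<le> (V powr \<sigma> - M powr \<sigma>) * (V - M)"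
          using V M \<sigma> powr_mono2[of \<sigma> V M] powr_mono2[of \<sigma> M V]
          by (cases "V \<le> M") (auto intro: mult_nonpos_nonpos)
        then show "0 \<le> a * ((V powr \<sigma> - M powr \<sigma>) * (V - M))" using a by simp
        show "0 \<le> (a * M powr \<sigma> - \<kappa>) * V" using aM V by simp
      qed
      then have "0 \<le> (a * ((V powr \<sigma> - M powr \<sigma>) * (V - M)) + (a * M powr \<sigma> - \<kappa>) * V) * q (n - 1) b u"
        using q_pos[OF u] by (simp add: less_imp_le)
      then show "0 \<le> (a * q (n - 1) (b + \<sigma> + 1) u - \<kappa> * q (n - 1) (b + 1) u)
        - M * (a * q (n - 1) (b + \<sigma>) u - \<kappa> * q (n - 1) b u) + (a * M powr \<sigma> - \<kappa>) * M * q (n - 1) b u"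
        unfolding e1 e[of \<sigma>] by (simp add: algebra_simps)
    qed
    then show ?thesis by (simp add: I0_def I1_def J0_def J1_def I_def integrable_q)
  qed
  define d where "d = a * J0 - \<kappa> * I0"
  have "(M - \<theta>) * d \<le> (real n * \<theta> + (a * M powr \<sigma> - \<kappa>) * M) * I0"
    using ge unfolding A by (simp add: d_def algebra_simps)
  then have "d \<le> (real n * \<theta> + (a * M powr \<sigma> - \<kappa>) * M) * I0 / (M - \<theta>)"
    using M \<theta> by (simp add: field_simps)
  also have "\<dots> \<le> (real n * \<theta> + (a * M powr \<sigma> - \<kappa>) * M) * I0 / (M / 2)"
    using M \<theta> I0 aM by (intro divide_left_mono) auto
  also have "\<dots> = (2 * \<theta> * (real n / M) + 2 * (a * M powr \<sigma> - \<kappa>)) * I0"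
    using M by (simp add: field_simps)
  also have "\<dots> \<le> (2 * \<theta> * sqrt n + 2 * (a * M powr \<sigma> - \<kappa>)) * I0"
  proof -
    have "real n / M \<le> real n / sqrt n" 
      by (rule divide_left_mono[OF M(1) _ mult_pos_pos[OF M(4)]]) (use n in linarith)+
    then have "real n / M \<le> sqrt n" by (simp add: real_div_sqrt)
    then show ?thesis using I0 \<theta> by (intro mult_right_mono add_mono mult_left_mono) auto
  qed
  finally have "a * J0 \<le> (\<kappa> + 2 * \<theta> * sqrt n + 2 * (a * M powr \<sigma> - \<kappa>)) * I0"
    by (simp add: d_def algebra_simps)
  also have "\<dots> \<le> latent_bound n k * I0"
  proof (rule mult_right_mono)
    show "\<kappa> + 2 * \<theta> * sqrt n + 2 * (a * M powr \<sigma> - \<kappa>) \<le> latent_bound n k"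
      using aM' \<kappa> unfolding latent_bound_def \<kappa>_def by argo
  qed (use I0 in simp)
  finally show ?thesis by (simp add: J0_def I0_def)
qed

text \<open>Applying \<open>I_recurrence\<close> twice with \<open>m = n - 1\<close> gives exact
  identities: by \<open>e1\<close> the mean of a V^\<sigma> - k \<sigma> is (n - 1) \<theta> times
  the mean of 1 / u, and by \<open>e2\<close> the second moment of V^\<sigma> reduces to its mean
  and the mean of V^\<sigma> / u. The latter is split at \<open>K\<close>: V^\<sigma> is at most (2
  K)^\<sigma> for u \<le> K, and at most 2 K^(\<sigma> - 1) u beyond. The term of order n thus
  carries the factor K^(\<sigma> - 1), which a large \<open>K\<close> makes small, and the rest is a
  multiple of \<open>latent_bound\<close>.\<close>

lemma latent_second_moment:
  fixes n k :: nat
  assumes "3 \<le> n" "\<theta> \<le> K"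
  defines "b \<equiv> real k * \<sigma> - real n"
  shows "a\<^sup>2 * I (n - 1) (b + 2 * \<sigma>) - 2 * (real k * \<sigma>) * (a * I (n - 1) (b + \<sigma>)) + (real k * \<sigma>)\<^sup>2 * I (n - 1) b
    \<le> ((\<sigma> + 2 * a * (2 * K) powr \<sigma>) * latent_bound n k + 2 * a * \<theta> * real n * K powr (\<sigma> - 1)) * I (n - 1) b"
proof -
  define I0 J0 J2 where "I0 = I (n - 1) b" and "J0 = I (n - 1) (b + \<sigma>)" and "J2 = I (n - 1) (b + 2 * \<sigma>)"
  define E where "E = latent_bound n k"
  have K: "0 < K" using assms \<theta> by simp
  have I0: "0 < I0" by (simp add: I0_def I_pos)
  have fm: "a * J0 \<le> E * I0" using latent_first_moment[of n k] assms(1) by (simp add: J0_def I0_def E_def b_def)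
  have n2: "Suc (n - 2) = n - 1" "n - 1 - 1 = n - 2" using assms(1) by auto
  have r1: "real (n - 1) * I (n - 2) (b + 1) + (b + 1) * I0 = a * J0"
    using I_recurrence[of "n - 1" "b + 1"] assms(1) unfolding n2 by (simp add: I0_def J0_def add_ac)
  have s1: "I (n - 2) (b + 1) = I0 + \<theta> * I (n - 2) b"
    using I_split[of "n - 2" b] unfolding n2 by (simp add: I0_def)
  have r2: "real (n - 1) * I (n - 2) (b + \<sigma> + 1) + (b + \<sigma> + 1) * J0 = a * J2"
    using I_recurrence[of "n - 1" "b + \<sigma> + 1"] assms(1) unfolding n2 by (simp add: J2_def J0_def add_ac)
  have s2: "I (n - 2) (b + \<sigma> + 1) = J0 + \<theta> * I (n - 2) (b + \<sigma>)"
    using I_split[of "n - 2" "b + \<sigma>"] unfolding n2 by (simp add: J0_def)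
  have n1: "real (n - 1) = real n - 1" using assms(1) by (simp add: of_nat_diff)
  have e1: "a * J0 - real k * \<sigma> * I0 = (real n - 1) * \<theta> * I (n - 2) b"
    using r1 unfolding s1 n1 by (simp add: b_def algebra_simps)
  have e2: "a * J2 = (real k * \<sigma> + \<sigma>) * J0 + (real n - 1) * \<theta> * I (n - 2) (b + \<sigma>)"
    using r2 unfolding s2 n1 by (simp add: b_def algebra_simps)
  have split: "I (n - 2) (b + \<sigma>) \<le> 2 * K powr (\<sigma> - 1) * I0 + (2 * K) powr \<sigma> * I (n - 2) b"
  proof -
    have "(\<integral>u. q (n - 2) (b + \<sigma>) u \<partial>R) \<le> (\<integral>u. 2 * K powr (\<sigma> - 1) * q (n - 1) b u + (2 * K) powr \<sigma> * q (n - 2) b u \<partial>R)"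
    proof (intro integral_mono Bochner_Integration.integrable_add integrable_mult_right integrable_q)
      fix u assume "u \<in> space R"
      then have u: "0 < u" by (simp add: space_R)
      have e: "q (n - 1) b u = u * q (n - 2) b u" "q (n - 2) (b + \<sigma>) u = (u + \<theta>) powr \<sigma> * q (n - 2) b u"
        unfolding n2(1)[symmetric] by (simp_all add: latent_kernel_def powr_add)
      have "(u + \<theta>) powr \<sigma> \<le> 2 * K powr (\<sigma> - 1) * u + (2 * K) powr \<sigma>"
      proof (cases "u \<le> K")
        case True
        then have "(u + \<theta>) powr \<sigma> \<le> (2 * K) powr \<sigma>" using assms u \<theta> \<sigma> by (intro powr_mono2) auto
        then show ?thesis using u by (smt (verit, best) powr_ge_zero mult_nonneg_nonneg)
      next
        case False
        have "(u + \<theta>) powr \<sigma> = (u + \<theta>) powr (\<sigma> - 1) * (u + \<theta>)"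
          using u \<theta> by (simp add: powr_mult_base mult.commute)
        also have "\<dots> \<le> K powr (\<sigma> - 1) * (2 * u)"
          using False u \<theta> K \<sigma> assms by (intro mult_mono powr_mono2') auto
        finally show ?thesis by (simp add: add_increasing2)
      qed
      then have "(u + \<theta>) powr \<sigma> * q (n - 2) b u \<le> (2 * K powr (\<sigma> - 1) * u + (2 * K) powr \<sigma>) * q (n - 2) b u"
        using q_pos[OF u] by (intro mult_right_mono) (auto simp: less_imp_le)
      then show "q (n - 2) (b + \<sigma>) u \<le> 2 * K powr (\<sigma> - 1) * q (n - 1) b u + (2 * K) powr \<sigma> * q (n - 2) b u"
        unfolding e by (simp add: algebra_simps)
    qed
    then show ?thesis by (simp add: I0_def I_def integrable_q)
  qed
  define F where "F = I (n - 2) b"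
  have F0: "0 \<le> F" using I_pos by (simp add: F_def less_imp_le)
  have F: "(real n - 1) * \<theta> * F \<le> E * I0"
  proof -
    have "0 \<le> real k * \<sigma> * I0" using \<sigma> I0 by simp
    then show ?thesis using e1 fm by (simp add: F_def)
  qed
  have "a\<^sup>2 * J2 - 2 * (real k * \<sigma>) * (a * J0) + (real k * \<sigma>)\<^sup>2 * I0
    = \<sigma> * (a * J0) - real k * \<sigma> * (a * J0 - real k * \<sigma> * I0) + a * ((real n - 1) * \<theta> * I (n - 2) (b + \<sigma>))"
  proof -
    have "a\<^sup>2 * J2 = a * ((real k * \<sigma> + \<sigma>) * J0 + (real n - 1) * \<theta> * I (n - 2) (b + \<sigma>))"
      unfolding e2[symmetric] by (simp add: power2_eq_square)
    then show ?thesis by (simp add: algebra_simps power2_eq_square)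
  qed
  \<comment> \<open>By \<open>e1\<close> the mean of a V^\<sigma> is at least k \<sigma>, so the
    middle term has a favourable sign and is dropped.\<close>
  also have "\<dots> \<le> \<sigma> * (E * I0) - 0 + a * ((real n - 1) * \<theta> * (2 * K powr (\<sigma> - 1) * I0 + (2 * K) powr \<sigma> * F))"
  proof (intro add_mono diff_mono mult_left_mono)
    show "0 \<le> real k * \<sigma> * (a * J0 - real k * \<sigma> * I0)"
      unfolding e1 using \<sigma> \<theta> F0 assms(1) by (intro mult_nonneg_nonneg) (auto simp: F_def)
  qed (use fm split a \<sigma> \<theta> assms(1) in \<open>auto simp: F_def\<close>)
  also have "\<dots> = \<sigma> * (E * I0) + 2 * a * \<theta> * (real n - 1) * K powr (\<sigma> - 1) * I0 + a * (2 * K) powr \<sigma> * ((real n - 1) * \<theta> * F)"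
    by (simp add: algebra_simps)
  also have "\<dots> \<le> \<sigma> * (E * I0) + 2 * a * \<theta> * real n * K powr (\<sigma> - 1) * I0 + a * (2 * K) powr \<sigma> * (E * I0)"
    using F a \<theta> I0 by (intro add_mono mult_left_mono mult_right_mono order_refl) auto
  also have "\<dots> \<le> ((\<sigma> + 2 * a * (2 * K) powr \<sigma>) * E + 2 * a * \<theta> * real n * K powr (\<sigma> - 1)) * I0"
  proof -
    have "0 \<le> E * I0"     proof -
      have "0 \<le> (real n - 1) * \<theta> * F" using F0 \<theta> assms(1) by (intro mult_nonneg_nonneg) auto
      then show ?thesis using F by linarith
    qed
    then have "0 \<le> a * (2 * K) powr \<sigma> * (E * I0)" using a by simp
    then show ?thesis by (simp add: algebra_simps)
  qed
  finally show ?thesis by (simp add: I0_def J0_def J2_def E_def)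
qed

lemma latent_law_mean:
  assumes "3 \<le> n"
  shows "(\<integral>\<^sup>+u. ennreal (a * (u + \<theta>) powr \<sigma>) \<partial>latent_law a \<sigma> \<theta> n k) \<le> ennreal (latent_bound n k)"
proof -
  let ?b = "real k * \<sigma> - real n"
  have e: "q (n - 1) ?b u * (a * (u + \<theta>) powr \<sigma>) = a * q (n - 1) (?b + \<sigma>) u" for u
    by (simp add: latent_kernel_def powr_add)
  have "(\<integral>\<^sup>+u. ennreal (a * (u + \<theta>) powr \<sigma>) \<partial>latent_law a \<sigma> \<theta> n k)
     = ennreal ((\<integral>u. q (n - 1) ?b u * (a * (u + \<theta>) powr \<sigma>) \<partial>R) / I (n - 1) ?b)"
  proof (rule nn_integral_latent_law)
    show "integrable R (\<lambda>u. q (n - 1) ?b u * (a * (u + \<theta>) powr \<sigma>))"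
      unfolding e by (intro integrable_mult_right integrable_q)
  qed (use a in \<open>auto intro!: measurable_restrict_space1\<close>)
  also have "\<dots> \<le> ennreal (latent_bound n k)"
  proof (rule ennreal_leI)
    have "(\<integral>u. q (n - 1) ?b u * (a * (u + \<theta>) powr \<sigma>) \<partial>R) = a * I (n - 1) (?b + \<sigma>)"
      unfolding e I_def by simp
    then show "(\<integral>u. q (n - 1) ?b u * (a * (u + \<theta>) powr \<sigma>) \<partial>R) / I (n - 1) ?b \<le> latent_bound n k"
      using latent_first_moment[of n k] assms I_pos[of "n - 1" ?b] by (simp add: divide_le_eq)
  qed
  finally show ?thesis .
qed

lemma latent_law_variance:
  assumes "3 \<le> n" "\<theta> \<le> K"
  shows "(\<integral>\<^sup>+u. ennreal ((a * (u + \<theta>) powr \<sigma> - \<sigma> * real k)\<^sup>2) \<partial>latent_law a \<sigma> \<theta> n k)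
    \<le> ennreal ((\<sigma> + 2 * a * (2 * K) powr \<sigma>) * latent_bound n k + 2 * a * \<theta> * real n * K powr (\<sigma> - 1))"
proof -
  let ?b = "real k * \<sigma> - real n"
  have e: "q (n - 1) ?b u * (a * (u + \<theta>) powr \<sigma> - \<sigma> * real k)\<^sup>2 = a\<^sup>2 * q (n - 1) (?b + 2 * \<sigma>) u
     - 2 * (real k * \<sigma>) * (a * q (n - 1) (?b + \<sigma>) u) + (real k * \<sigma>)\<^sup>2 * q (n - 1) ?b u" for u
  proof -
    have p: "(u + \<theta>) powr (2 * \<sigma>) = ((u + \<theta>) powr \<sigma>)\<^sup>2"
      by (simp only: mult_2 powr_add power2_eq_square)
    have "q (n - 1) (?b + 2 * \<sigma>) u = ((u + \<theta>) powr \<sigma>)\<^sup>2 * q (n - 1) ?b u"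
      "q (n - 1) (?b + \<sigma>) u = (u + \<theta>) powr \<sigma> * q (n - 1) ?b u"
      by (simp_all add: latent_kernel_def powr_add p)
    then show ?thesis by (simp only:) (simp add: power2_eq_square algebra_simps)
  qed
  have "(\<integral>\<^sup>+u. ennreal ((a * (u + \<theta>) powr \<sigma> - \<sigma> * real k)\<^sup>2) \<partial>latent_law a \<sigma> \<theta> n k)
     = ennreal ((\<integral>u. q (n - 1) ?b u * (a * (u + \<theta>) powr \<sigma> - \<sigma> * real k)\<^sup>2 \<partial>R) / I (n - 1) ?b)"
  proof (rule nn_integral_latent_law)
    show "integrable R (\<lambda>u. q (n - 1) ?b u * (a * (u + \<theta>) powr \<sigma> - \<sigma> * real k)\<^sup>2)"
      unfolding e by (intro Bochner_Integration.integrable_diff Bochner_Integration.integrable_add integrable_mult_right integrable_q)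
  qed (auto intro!: measurable_restrict_space1)
  also have "\<dots> \<le> ennreal ((\<sigma> + 2 * a * (2 * K) powr \<sigma>) * latent_bound n k + 2 * a * \<theta> * real n * K powr (\<sigma> - 1))"
  proof (intro ennreal_leI)
    have "(\<integral>u. q (n - 1) ?b u * (a * (u + \<theta>) powr \<sigma> - \<sigma> * real k)\<^sup>2 \<partial>R)
      = a\<^sup>2 * I (n - 1) (?b + 2 * \<sigma>) - 2 * (real k * \<sigma>) * (a * I (n - 1) (?b + \<sigma>)) + (real k * \<sigma>)\<^sup>2 * I (n - 1) ?b"
      unfolding e by (simp add: I_def integrable_q)
    then show "(\<integral>u. q (n - 1) ?b u * (a * (u + \<theta>) powr \<sigma> - \<sigma> * real k)\<^sup>2 \<partial>R) / I (n - 1) ?b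
      \<le> (\<sigma> + 2 * a * (2 * K) powr \<sigma>) * latent_bound n k + 2 * a * \<theta> * real n * K powr (\<sigma> - 1)"
      using latent_second_moment[OF assms, of k] I_pos[of "n - 1" ?b] by (simp add: divide_le_eq)
  qed
  finally show ?thesis .
qed

end

subsection \<open>Product kernels\<close>

lemma emeasure_PiM_prob:
  assumes "finite I" "\<And>i. i \<in> I \<Longrightarrow> prob_space (P i)" "\<And>i. i \<in> I \<Longrightarrow> A i \<in> sets (P i)"
  shows "emeasure (Pi\<^sub>M I P) (Pi\<^sub>E I A) = (\<Prod>i\<in>I. emeasure (P i) (A i))"
proof -
  define Q where "Q i = (if i \<in> I then P i else count_space {undefined})" for i
  have "prob_space (Q i)" for i
    using assms(2) by (auto simp: Q_def intro!: prob_spaceI)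
  then interpret product_sigma_finite Q
    by (simp add: product_sigma_finite_def prob_space_imp_sigma_finite)
  have "Pi\<^sub>M I P = Pi\<^sub>M I Q" by (intro PiM_cong) (auto simp: Q_def)
  moreover have "emeasure (Pi\<^sub>M I Q) (Pi\<^sub>E I A) = (\<Prod>i\<in>I. emeasure (Q i) (A i))"
    using assms by (intro emeasure_PiM) (auto simp: Q_def)
  ultimately show ?thesis by (simp add: Q_def)
qed

text \<open>Rectangles form an intersection-stable generator, and on them the product measure is a
  finite product of measurable functions of \<open>u\<close>; for probability measures this is
  enough.\<close>

lemma measurable_PiM_kernel:
  assumes I: "finite I" and \<kappa>: "\<And>i. i \<in> I \<Longrightarrow> \<kappa> i \<in> L \<rightarrow>\<^sub>M prob_algebra (S i)"
  shows "(\<lambda>u. \<Pi>\<^sub>M i\<in>I. \<kappa> i u) \<in> L \<rightarrow>\<^sub>M prob_algebra (\<Pi>\<^sub>M i\<in>I. S i)"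
proof (rule measurable_prob_algebra_generated)
  have ps: "prob_space (\<kappa> i u)" and ss: "sets (\<kappa> i u) = sets (S i)" if "i \<in> I" "u \<in> space L" for i u
    using measurable_space[OF \<kappa>[OF that(1)] that(2)] by (auto simp: space_prob_algebra)
  show "sets (\<Pi>\<^sub>M i\<in>I. S i) = sigma_sets (\<Pi>\<^sub>E i\<in>I. space (S i)) (prod_algebra I S)" by (rule sets_PiM)
  show "Int_stable (prod_algebra I S)" by (rule Int_stable_prod_algebra)
  show "prod_algebra I S \<subseteq> Pow (\<Pi>\<^sub>E i\<in>I. space (S i))" by (rule prod_algebra_sets_into_space)
  fix u assume u: "u \<in> space L"
  show "prob_space (\<Pi>\<^sub>M i\<in>I. \<kappa> i u)" using ps u by (intro prob_space_PiM) auto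
  show "sets (\<Pi>\<^sub>M i\<in>I. \<kappa> i u) = sets (\<Pi>\<^sub>M i\<in>I. S i)" using ss u by (intro sets_PiM_cong) auto
next
  have ps: "prob_space (\<kappa> i u)" and ss: "sets (\<kappa> i u) = sets (S i)" if "i \<in> I" "u \<in> space L" for i u
    using measurable_space[OF \<kappa>[OF that(1)] that(2)] by (auto simp: space_prob_algebra)
  fix A assume "A \<in> prod_algebra I S"
  then obtain X where X: "A = Pi\<^sub>E I X" "\<And>i. i \<in> I \<Longrightarrow> X i \<in> sets (S i)"
    using I by (auto simp: prod_algebra_eq_finite)
  have "(\<lambda>u. \<Prod>i\<in>I. emeasure (\<kappa> i u) (X i)) \<in> borel_measurable L"
    using X(2) \<kappa> by (intro borel_measurable_prod_ennreal)
      (auto intro!: measurable_emeasure_kernel[OF measurable_prob_algebraD])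
  then show "(\<lambda>u. emeasure (\<Pi>\<^sub>M i\<in>I. \<kappa> i u) A) \<in> borel_measurable L"
    by (rule measurable_cong[THEN iffD1, rotated])
       (use X ps ss I in \<open>simp add: emeasure_PiM_prob\<close>)
qed

subsection \<open>Poisson random measures\<close>

text \<open>The values of a Poisson random measure with infinite intensity have infinite mass, so
  \<open>subprob_algebra\<close> cannot hold them. The generator collects conditions on finitely
  many sets at once rather than on single sets: this makes it intersection-stable, and agreement on
  it determines a probability law.\<close>

definition random_measure_algebra :: "'e measure \<Rightarrow> 'e measure measure" where
  "random_measure_algebra E = sigma {N. sets N = sets E}
     {{N. sets N = sets E \<and> (\<forall>A\<in>F. emeasure N A \<in> B A)} | F B.
        finite F \<and> F \<subseteq> sets E \<and> (\<forall>A. B A \<in> sets borel)}"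

lemma space_random_measure_algebra: "space (random_measure_algebra E) = {N. sets N = sets E}"
  unfolding random_measure_algebra_def by (rule space_measure_of) auto

lemma sets_random_measure_algebra: "sets (random_measure_algebra E) = sigma_sets {N. sets N = sets E}
     {{N. sets N = sets E \<and> (\<forall>A\<in>F. emeasure N A \<in> B A)} | F B.
        finite F \<and> F \<subseteq> sets E \<and> (\<forall>A. B A \<in> sets borel)}"
  unfolding random_measure_algebra_def by (rule sets_measure_of) auto

lemma measurable_emeasure_random_measure [measurable]:
  assumes "A \<in> sets E"
  shows "(\<lambda>N. emeasure N A) \<in> borel_measurable (random_measure_algebra E)"
proof (rule measurableI)
  fix B :: "ennreal set" assume "B \<in> sets borel"
  then have "{N. sets N = sets E \<and> (\<forall>A\<in>{A}. emeasure N A \<in> B)} \<in> sets (random_measure_algebra E)"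
    using assms unfolding sets_random_measure_algebra
    by (intro sigma_sets.Basic CollectI exI[of _ "{A}"] exI[of _ "\<lambda>_. B"]) auto
  also have "{N. sets N = sets E \<and> (\<forall>A\<in>{A}. emeasure N A \<in> B)} = (\<lambda>N. emeasure N A) -` B \<inter> space (random_measure_algebra E)"
    by (auto simp: space_random_measure_algebra)
  finally show "(\<lambda>N. emeasure N A) -` B \<inter> space (random_measure_algebra E) \<in> sets (random_measure_algebra E)" .
qed simp

lemma nn_integral_measurable_random_measure:
  fixes \<phi> :: "'e \<Rightarrow> ennreal"
  assumes "\<phi> \<in> borel_measurable E"
  shows "(\<lambda>N. \<integral>\<^sup>+x. \<phi> x \<partial>N) \<in> borel_measurable (random_measure_algebra E)"
  using assms
proof (induction \<phi> rule: borel_measurable_induct)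
  case (cong f g)
  have "(\<integral>\<^sup>+x. f x \<partial>N) = (\<integral>\<^sup>+x. g x \<partial>N)" if "N \<in> space (random_measure_algebra E)" for N
    using that cong(3) by (intro nn_integral_cong) (auto simp: space_random_measure_algebra dest!: sets_eq_imp_space_eq)
  with cong(4) show ?case by (simp cong: measurable_cong)
next
  case (set A)
  then have "(\<lambda>N. emeasure N A) \<in> borel_measurable (random_measure_algebra E)" by measurable
  then show ?case
    by (rule measurable_cong[THEN iffD1, rotated]) (use set in \<open>simp add: space_random_measure_algebra\<close>)
next
  case (mult u c)
  then have "(\<lambda>N. c * (\<integral>\<^sup>+x. u x \<partial>N)) \<in> borel_measurable (random_measure_algebra E)" by measurable
  then show ?case
    by (rule measurable_cong[THEN iffD1, rotated])
       (use mult in \<open>auto simp: space_random_measure_algebra nn_integral_cmult cong: measurable_cong_sets\<close>)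
next
  case (add u v)
  then have "(\<lambda>N. (\<integral>\<^sup>+x. v x \<partial>N) + (\<integral>\<^sup>+x. u x \<partial>N)) \<in> borel_measurable (random_measure_algebra E)" by measurable
  then show ?case
    by (rule measurable_cong[THEN iffD1, rotated])
       (use add in \<open>auto simp: space_random_measure_algebra nn_integral_add cong: measurable_cong_sets\<close>)
next
  case (seq U)
  then have "(\<lambda>N. SUP i. \<integral>\<^sup>+x. U i x \<partial>N) \<in> borel_measurable (random_measure_algebra E)" by measurable
  then show ?case
  proof (rule measurable_cong[THEN iffD1, rotated])
    fix N assume "N \<in> space (random_measure_algebra E)"
    then have "U i \<in> borel_measurable N" for i
      using seq(1) by (auto simp: space_random_measure_algebra cong: measurable_cong_sets)
    then show "(SUP i. \<integral>\<^sup>+x. U i x \<partial>N) = (\<integral>\<^sup>+x. (SUP i. U i) x \<partial>N)"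
      using seq by (simp add: nn_integral_monotone_convergence_SUP image_comp)
  qed
qed

lemma measurable_random_measure_algebraI:
  assumes "\<And>\<omega>. \<omega> \<in> space M \<Longrightarrow> sets (N \<omega>) = sets E"
    and "\<And>A. A \<in> sets E \<Longrightarrow> (\<lambda>\<omega>. emeasure (N \<omega>) A) \<in> borel_measurable M"
  shows "N \<in> M \<rightarrow>\<^sub>M random_measure_algebra E"
proof (rule measurable_sigma_sets[OF sets_random_measure_algebra])
  show "N \<in> space M \<rightarrow> {N. sets N = sets E}" using assms(1) by auto
  fix Y assume "Y \<in> {{N. sets N = sets E \<and> (\<forall>A\<in>F. emeasure N A \<in> B A)} | F B.
        finite F \<and> F \<subseteq> sets E \<and> (\<forall>A. B A \<in> sets (borel :: ennreal measure))}"
  then obtain F B where FB: "finite F" "F \<subseteq> sets E" "\<And>A. B A \<in> sets (borel :: ennreal measure)"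
    and Y: "Y = {N. sets N = sets E \<and> (\<forall>A\<in>F. emeasure N A \<in> B A)}" by auto
  have "N -` Y \<inter> space M = {\<omega> \<in> space M. \<forall>A\<in>F. emeasure (N \<omega>) A \<in> B A}"
    using assms(1) by (auto simp: Y)
  also have "\<dots> \<in> sets M"
  proof (intro sets.sets_Collect_finite_All FB(1))
    fix A assume "A \<in> F"
    then show "{\<omega> \<in> space M. emeasure (N \<omega>) A \<in> B A} \<in> sets M"
      using measurable_sets[OF assms(2)[of A] FB(3)[of A]] FB(2) by (auto simp: vimage_def Int_def conj_commute)
  qed
  finally show "N -` Y \<inter> space M \<in> sets M" .
qed auto

section \<open>Moments of Poisson counts and integrals\<close>

locale prm = prob_space M for M :: "'w measure" +
  fixes N :: "'w \<Rightarrow> 'e measure" and \<nu> :: "'e measure"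
  assumes prm: "poisson_random_measure M N \<nu>"
begin

lemma sets_N: "\<omega> \<in> space M \<Longrightarrow> sets (N \<omega>) = sets \<nu>"
  using prm by (auto simp: poisson_random_measure_def)

lemma measurable_count [measurable]: "A \<in> sets \<nu> \<Longrightarrow> (\<lambda>\<omega>. emeasure (N \<omega>) A) \<in> borel_measurable M"
  using prm by (auto simp: poisson_random_measure_def)

lemma measurable_N: "N \<in> M \<rightarrow>\<^sub>M random_measure_algebra \<nu>"
  by (intro measurable_random_measure_algebraI sets_N measurable_count)

lemma measurable_nn_integral_N [measurable]:
  "\<phi> \<in> borel_measurable \<nu> \<Longrightarrow> (\<lambda>\<omega>. \<integral>\<^sup>+x. \<phi> x \<partial>N \<omega>) \<in> borel_measurable M"
  using measurable_compose[OF measurable_N nn_integral_measurable_random_measure] .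

text \<open>Only the probabilities of natural values are prescribed, but for finite intensity they
  sum to 1, so the count is almost surely a natural number and the expectation becomes a
  series.\<close>

lemma nn_integral_count:
  assumes A: "A \<in> sets \<nu>" and g [measurable]: "g \<in> borel_measurable borel"
  shows "(\<integral>\<^sup>+\<omega>. g (emeasure (N \<omega>) A) \<partial>M) = (if emeasure \<nu> A = \<infinity> then g \<infinity>
    else (\<Sum>k. ennreal (measure \<nu> A ^ k / fact k * exp (- measure \<nu> A)) * g (of_nat k)))"
proof (cases "emeasure \<nu> A = \<infinity>")
  case True
  then have "AE \<omega> in M. emeasure (N \<omega>) A = \<infinity>"
    using prm A by (auto simp: poisson_random_measure_def)
  then have "(\<integral>\<^sup>+\<omega>. g (emeasure (N \<omega>) A) \<partial>M) = (\<integral>\<^sup>+\<omega>. g \<infinity> \<partial>M)"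
    by (intro nn_integral_cong_AE) auto
  then show ?thesis using True by (simp add: emeasure_space_1)
next
  case False
  define r where "r = measure \<nu> A"
  define E where "E k = {\<omega> \<in> space M. emeasure (N \<omega>) A = of_nat k}" for k :: nat
  have E [measurable]: "E k \<in> sets M" for k
    using A unfolding E_def by measurable
  have mE: "emeasure M (E k) = ennreal (r ^ k / fact k * exp (- r))" for k
  proof -
    have "measure M (E k) = r ^ k / fact k * exp (- r)"
      using prm A False by (auto simp: poisson_random_measure_def E_def r_def less_top)
    then show ?thesis by (simp add: emeasure_eq_measure)
  qed
  have disj: "disjoint_family E" by (auto simp: disjoint_family_on_def E_def)
  have "emeasure M (\<Union>k. E k) = (\<Sum>k. ennreal (r ^ k / fact k * exp (- r)))"
    using disj by (subst suminf_emeasure[symmetric]) (auto simp: mE)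
  also have "\<dots> = ennreal (exp r * exp (- r))"
  proof (rule suminf_ennreal_eq)
    show "(\<lambda>k. r ^ k / fact k * exp (- r)) sums (exp r * exp (- r))"
      using exp_converges[of r] by (intro sums_mult2) (simp add: divide_inverse mult.commute)
  qed (simp add: r_def)
  also have "\<dots> = 1" by (simp add: exp_minus)
  finally have "AE \<omega> in M. \<omega> \<in> (\<Union>k. E k)"
    by (intro AE_in_set_eq_1[THEN iffD2]) (auto simp: measure_def)
  then have "(\<integral>\<^sup>+\<omega>. g (emeasure (N \<omega>) A) \<partial>M) = (\<integral>\<^sup>+\<omega>. (\<Sum>k. g (of_nat k) * indicator (E k) \<omega>) \<partial>M)"
  proof (intro nn_integral_cong_AE, eventually_elim)
    case (elim \<omega>)
    then obtain k where k: "\<omega> \<in> E k" by auto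
    have Nk: "emeasure (N \<omega>) A = of_nat k" using k by (simp add: E_def)
    have "(\<Sum>j. g (of_nat j) * indicator (E j) \<omega>) = (\<Sum>j\<in>{k}. g (of_nat j) * indicator (E j) \<omega>)"
      using k disj by (intro suminf_finite) (auto simp: disjoint_family_on_def indicator_def)
    also have "\<dots> = g (of_nat k)" using k by simp
    finally show ?case unfolding Nk by (rule sym)
  qed
  also have "\<dots> = (\<Sum>k. g (of_nat k) * emeasure M (E k))"
    by (subst nn_integral_suminf) (auto simp: nn_integral_cmult_indicator)
  finally show ?thesis using False by (simp add: mE r_def mult.commute)
qed

lemma poisson_sums:
  fixes r :: real
  shows "(\<lambda>k. r ^ k / fact k * exp (- r) * real k) sums r"
    and "(\<lambda>k. r ^ k / fact k * exp (- r) * (real k)\<^sup>2) sums (r\<^sup>2 + r)"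
proof -
  have e: "(\<lambda>k. r ^ k / fact k * exp (- r)) sums 1"
    using sums_mult2[OF exp_converges[of r], of "exp (- r)"] by (simp add: divide_inverse mult.commute exp_minus)
  have "(\<lambda>k. r ^ Suc k / fact (Suc k) * exp (- r) * real (Suc k)) sums r"
    using sums_mult[OF e, of r] by (simp add: field_simps del: of_nat_Suc)
  then show 1: "(\<lambda>k. r ^ k / fact k * exp (- r) * real k) sums r"
    by (subst (asm) sums_Suc_iff) simp
  have "(\<lambda>k. r * (r ^ k / fact k * exp (- r) * real k) + r * (r ^ k / fact k * exp (- r))) sums (r * r + r * 1)"
    by (intro sums_add sums_mult 1 e)
  moreover have "r * (r ^ k / fact k * exp (- r) * real k) + r * (r ^ k / fact k * exp (- r))
    = r ^ Suc k / fact (Suc k) * exp (- r) * (real (Suc k))\<^sup>2" for k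
  proof -
    have "r * (r ^ k / fact k * exp (- r) * real k) + r * (r ^ k / fact k * exp (- r))
      = r * (r ^ k / fact k * exp (- r)) * real (Suc k)"
      by (simp add: add_divide_distrib algebra_simps)
    also have "\<dots> = r ^ Suc k / fact (Suc k) * exp (- r) * (real (Suc k))\<^sup>2"
      by (simp add: power2_eq_square del: of_nat_Suc)
    finally show ?thesis .
  qed
  ultimately have "(\<lambda>k. r ^ Suc k / fact (Suc k) * exp (- r) * (real (Suc k))\<^sup>2) sums (r\<^sup>2 + r)"
    by (simp add: power2_eq_square)
  then show "(\<lambda>k. r ^ k / fact k * exp (- r) * (real k)\<^sup>2) sums (r\<^sup>2 + r)"
    by (subst (asm) sums_Suc_iff) simp
qed

lemma mean_count: "A \<in> sets \<nu> \<Longrightarrow> (\<integral>\<^sup>+\<omega>. emeasure (N \<omega>) A \<partial>M) = emeasure \<nu> A"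
proof -
  assume A: "A \<in> sets \<nu>"
  let ?r = "measure \<nu> A"
  have "(\<Sum>k. ennreal (?r ^ k / fact k * exp (- ?r)) * of_nat k) = (\<Sum>k. ennreal (?r ^ k / fact k * exp (- ?r) * real k))"
    by (simp only: ennreal_of_nat_eq_real_of_nat ennreal_mult''[symmetric] of_nat_0_le_iff)
  also have "\<dots> = ennreal ?r" using poisson_sums(1)[of ?r] by (intro suminf_ennreal_eq) auto
  finally show ?thesis using nn_integral_count[OF A, of "\<lambda>x. x"] by (auto simp: emeasure_eq_ennreal_measure)
qed

lemma second_moment_count:
  "A \<in> sets \<nu> \<Longrightarrow> (\<integral>\<^sup>+\<omega>. emeasure (N \<omega>) A * emeasure (N \<omega>) A \<partial>M) = emeasure \<nu> A * emeasure \<nu> A + emeasure \<nu> A"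
proof -
  assume A: "A \<in> sets \<nu>"
  let ?r = "measure \<nu> A"
  have "(\<Sum>k. ennreal (?r ^ k / fact k * exp (- ?r)) * (of_nat k * of_nat k)) = (\<Sum>k. ennreal (?r ^ k / fact k * exp (- ?r) * (real k)\<^sup>2))"
    by (simp only: ennreal_of_nat_eq_real_of_nat ennreal_mult''[symmetric] of_nat_0_le_iff zero_le_square power2_eq_square)
  also have "\<dots> = ennreal (?r\<^sup>2 + ?r)" using poisson_sums(2)[of ?r] by (intro suminf_ennreal_eq) auto
  finally show ?thesis using nn_integral_count[OF A, of "\<lambda>x. x * x"]
    by (auto simp: emeasure_eq_ennreal_measure power2_eq_square ennreal_mult' ennreal_mult_top)
qed

lemma indep_counts:
  assumes "\<And>i::nat. i < m \<Longrightarrow> C i \<in> sets \<nu>" "disjoint_family_on C {..<m}"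
  shows "indep_vars (\<lambda>_. borel) (\<lambda>i \<omega>. emeasure (N \<omega>) (C i)) {..<m}"
proof -
  define D where "D i = (if i < m then C i else {})" for i
  have "range D \<subseteq> sets \<nu>" "disjoint_family D"
    using assms by (auto simp: D_def disjoint_family_on_def)
  then have "indep_vars (\<lambda>_. borel) (\<lambda>i \<omega>. emeasure (N \<omega>) (D i)) UNIV"
    using prm by (simp add: poisson_random_measure_def)
  then have "indep_vars (\<lambda>_. borel) (\<lambda>i \<omega>. emeasure (N \<omega>) (D i)) {..<m}"
    by (rule indep_vars_subset) auto
  then show ?thesis by (subst (asm) indep_vars_cong[OF refl]) (auto simp: D_def)
qed

lemma mean_count_prod_disjoint:
  assumes "A \<in> sets \<nu>" "B \<in> sets \<nu>" "A \<inter> B = {}"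
  shows "(\<integral>\<^sup>+\<omega>. emeasure (N \<omega>) A * emeasure (N \<omega>) B \<partial>M) = emeasure \<nu> A * emeasure \<nu> B"
proof -
  have "indep_vars (\<lambda>_. borel) (\<lambda>i \<omega>. emeasure (N \<omega>) (if i = 0 then A else B)) {..<2::nat}"
    using assms by (intro indep_counts) (auto simp: disjoint_family_on_def)
  from indep_vars_nn_integral[OF _ this] show ?thesis
    using assms by (simp add: numeral_2_eq_2 lessThan_Suc mean_count mult.commute)
qed

lemma mean_count_prod:
  assumes A: "A \<in> sets \<nu>" and B: "B \<in> sets \<nu>"
  shows "(\<integral>\<^sup>+\<omega>. emeasure (N \<omega>) A * emeasure (N \<omega>) B \<partial>M) = emeasure \<nu> A * emeasure \<nu> B + emeasure \<nu> (A \<inter> B)"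
proof -
  let ?A = "A - B" and ?B = "B - A" and ?C = "A \<inter> B"
  have m [measurable]: "?A \<in> sets \<nu>" "?B \<in> sets \<nu>" "?C \<in> sets \<nu>" using A B by auto
  have s: "emeasure m A = emeasure m ?A + emeasure m ?C" "emeasure m B = emeasure m ?B + emeasure m ?C"
    if "sets m = sets \<nu>" for m
  proof -
    have u: "?A \<union> ?C = A" "?B \<union> ?C = B" "?A \<inter> ?C = {}" "?B \<inter> ?C = {}" by auto
    show "emeasure m A = emeasure m ?A + emeasure m ?C" "emeasure m B = emeasure m ?B + emeasure m ?C"
      using m that plus_emeasure[of ?A m ?C] plus_emeasure[of ?B m ?C] unfolding u by auto
  qed
  have "(\<integral>\<^sup>+\<omega>. emeasure (N \<omega>) A * emeasure (N \<omega>) B \<partial>M)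
     = (\<integral>\<^sup>+\<omega>. (emeasure (N \<omega>) ?A * emeasure (N \<omega>) ?B + emeasure (N \<omega>) ?A * emeasure (N \<omega>) ?C)
        + (emeasure (N \<omega>) ?C * emeasure (N \<omega>) ?B + emeasure (N \<omega>) ?C * emeasure (N \<omega>) ?C) \<partial>M)"
    by (intro nn_integral_cong) (simp add: s[OF sets_N] distrib_left distrib_right add_ac)
  also have "\<dots> = (emeasure \<nu> ?A * emeasure \<nu> ?B + emeasure \<nu> ?A * emeasure \<nu> ?C)
        + (emeasure \<nu> ?C * emeasure \<nu> ?B + (emeasure \<nu> ?C * emeasure \<nu> ?C + emeasure \<nu> ?C))"
  proof -
    have d: "?A \<inter> ?B = {}" "?A \<inter> ?C = {}" "?C \<inter> ?B = {}" by auto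
    show ?thesis
      by (simp add: nn_integral_add mean_count_prod_disjoint[OF m(1,2) d(1)] mean_count_prod_disjoint[OF m(1,3) d(2)]
          mean_count_prod_disjoint[OF m(3,2) d(3)] second_moment_count)
  qed
  also have "\<dots> = emeasure \<nu> A * emeasure \<nu> B + emeasure \<nu> ?C"
    by (simp add: s[OF refl] distrib_left distrib_right add_ac)
  finally show ?thesis .
qed

text \<open>A Campbell formula weighted by a random variable \<open>X\<close>; taking for \<open>X\<close> first a count and
  then an integral gives second moments.\<close>

lemma campbell:
  fixes \<phi> :: "'e \<Rightarrow> ennreal"
  assumes [measurable]: "X \<in> borel_measurable M" "h \<in> borel_measurable \<nu>"
    and X: "\<And>A. A \<in> sets \<nu> \<Longrightarrow> (\<integral>\<^sup>+\<omega>. emeasure (N \<omega>) A * X \<omega> \<partial>M) = (\<integral>\<^sup>+x. indicator A x * h x \<partial>\<nu>)"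
    and "\<phi> \<in> borel_measurable \<nu>"
  shows "(\<integral>\<^sup>+\<omega>. (\<integral>\<^sup>+x. \<phi> x \<partial>N \<omega>) * X \<omega> \<partial>M) = (\<integral>\<^sup>+x. \<phi> x * h x \<partial>\<nu>)"
  using assms(4)
proof (induction \<phi> rule: borel_measurable_induct)
  case (cong f g)
  have "(\<integral>\<^sup>+x. f x \<partial>N \<omega>) = (\<integral>\<^sup>+x. g x \<partial>N \<omega>)" if "\<omega> \<in> space M" for \<omega>
    using sets_eq_imp_space_eq[OF sets_N[OF that]] cong(3) by (intro nn_integral_cong) auto
  then have "(\<integral>\<^sup>+\<omega>. (\<integral>\<^sup>+x. g x \<partial>N \<omega>) * X \<omega> \<partial>M) = (\<integral>\<^sup>+\<omega>. (\<integral>\<^sup>+x. f x \<partial>N \<omega>) * X \<omega> \<partial>M)"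
    by (intro nn_integral_cong) simp
  moreover have "(\<integral>\<^sup>+x. g x * h x \<partial>\<nu>) = (\<integral>\<^sup>+x. f x * h x \<partial>\<nu>)"
    using cong(3) by (intro nn_integral_cong) simp
  ultimately show ?case using cong by simp
next
  case (set A)
  have "(\<integral>\<^sup>+\<omega>. (\<integral>\<^sup>+x. indicator A x \<partial>N \<omega>) * X \<omega> \<partial>M) = (\<integral>\<^sup>+\<omega>. emeasure (N \<omega>) A * X \<omega> \<partial>M)"
    using set by (intro nn_integral_cong) (simp add: sets_N)
  then show ?case using X[OF set] by simp
next
  case (mult u c)
  note [measurable] = mult(2)
  have "(\<integral>\<^sup>+\<omega>. (\<integral>\<^sup>+x. c * u x \<partial>N \<omega>) * X \<omega> \<partial>M) = (\<integral>\<^sup>+\<omega>. c * ((\<integral>\<^sup>+x. u x \<partial>N \<omega>) * X \<omega>) \<partial>M)"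
    using mult(2) by (intro nn_integral_cong) (simp add: nn_integral_cmult sets_N mult.assoc cong: measurable_cong_sets)
  also have "\<dots> = c * (\<integral>\<^sup>+\<omega>. (\<integral>\<^sup>+x. u x \<partial>N \<omega>) * X \<omega> \<partial>M)" by (intro nn_integral_cmult) measurable
  also have "\<dots> = (\<integral>\<^sup>+x. c * (u x * h x) \<partial>\<nu>)" unfolding mult(4) by (intro nn_integral_cmult[symmetric]) measurable
  finally show ?case by (simp add: mult.assoc)
next
  case (add u v)
  note [measurable] = add(1,3)
  have "(\<integral>\<^sup>+\<omega>. (\<integral>\<^sup>+x. v x + u x \<partial>N \<omega>) * X \<omega> \<partial>M) = (\<integral>\<^sup>+\<omega>. (\<integral>\<^sup>+x. v x \<partial>N \<omega>) * X \<omega> + (\<integral>\<^sup>+x. u x \<partial>N \<omega>) * X \<omega> \<partial>M)"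
    using add(1,3) by (intro nn_integral_cong) (simp add: nn_integral_add sets_N distrib_right cong: measurable_cong_sets)
  also have "\<dots> = (\<integral>\<^sup>+x. v x * h x + u x * h x \<partial>\<nu>)"
    by (simp add: nn_integral_add add.IH)
  finally show ?case by (simp add: distrib_right)
next
  case (seq U)
  note [measurable] = seq(1)
  have UN: "U i \<in> borel_measurable (N \<omega>)" if "\<omega> \<in> space M" for i \<omega>
    using seq(1)[of i] sets_N[OF that] by (simp cong: measurable_cong_sets)
  have "(\<integral>\<^sup>+\<omega>. (\<integral>\<^sup>+x. (SUP i. U i) x \<partial>N \<omega>) * X \<omega> \<partial>M) = (\<integral>\<^sup>+\<omega>. (SUP i. (\<integral>\<^sup>+x. U i x \<partial>N \<omega>) * X \<omega>) \<partial>M)"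
  proof (intro nn_integral_cong)
    fix \<omega> assume "\<omega> \<in> space M"
    then have "(\<integral>\<^sup>+x. (SUP i. U i) x \<partial>N \<omega>) = (SUP i. \<integral>\<^sup>+x. U i x \<partial>N \<omega>)"
      using nn_integral_monotone_convergence_SUP[OF \<open>incseq U\<close> UN] by (simp add: image_comp)
    then show "(\<integral>\<^sup>+x. (SUP i. U i) x \<partial>N \<omega>) * X \<omega> = (SUP i. (\<integral>\<^sup>+x. U i x \<partial>N \<omega>) * X \<omega>)"
      by (simp add: SUP_mult_right_ennreal)
  qed
  also have "\<dots> = (SUP i. \<integral>\<^sup>+\<omega>. (\<integral>\<^sup>+x. U i x \<partial>N \<omega>) * X \<omega> \<partial>M)"
    using \<open>incseq U\<close> by (intro nn_integral_monotone_convergence_SUP)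
      (auto simp: incseq_def le_fun_def intro!: mult_right_mono nn_integral_mono)
  also have "\<dots> = (SUP i. \<integral>\<^sup>+x. U i x * h x \<partial>\<nu>)" by (simp add: seq.IH)
  also have "\<dots> = (\<integral>\<^sup>+x. (SUP i. U i x * h x) \<partial>\<nu>)"
    using \<open>incseq U\<close> by (intro nn_integral_monotone_convergence_SUP[symmetric])
      (auto simp: incseq_def le_fun_def intro!: mult_right_mono)
  also have "\<dots> = (\<integral>\<^sup>+x. (SUP i. U i) x * h x \<partial>\<nu>)"
    by (intro nn_integral_cong) (simp add: image_comp SUP_mult_right_ennreal)
  finally show ?case .
qed

lemma mean_integral:
  assumes "\<phi> \<in> borel_measurable \<nu>"
  shows "(\<integral>\<^sup>+\<omega>. (\<integral>\<^sup>+x. \<phi> x \<partial>N \<omega>) \<partial>M) = (\<integral>\<^sup>+x. \<phi> x \<partial>\<nu>)"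
proof -
  have "(\<integral>\<^sup>+\<omega>. (\<integral>\<^sup>+x. \<phi> x \<partial>N \<omega>) * 1 \<partial>M) = (\<integral>\<^sup>+x. \<phi> x * 1 \<partial>\<nu>)"
  proof (rule campbell)
    show "(\<integral>\<^sup>+\<omega>. emeasure (N \<omega>) A * 1 \<partial>M) = (\<integral>\<^sup>+x. indicator A x * 1 \<partial>\<nu>)" if "A \<in> sets \<nu>" for A
      using that by (simp add: mean_count)
  qed (use assms in simp_all)
  then show ?thesis by simp
qed

lemma second_moment_integral:
  assumes [measurable]: "\<phi> \<in> borel_measurable \<nu>"
  shows "(\<integral>\<^sup>+\<omega>. (\<integral>\<^sup>+x. \<phi> x \<partial>N \<omega>) * (\<integral>\<^sup>+x. \<phi> x \<partial>N \<omega>) \<partial>M)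
    = (\<integral>\<^sup>+x. \<phi> x * \<phi> x \<partial>\<nu>) + (\<integral>\<^sup>+x. \<phi> x \<partial>\<nu>) * (\<integral>\<^sup>+x. \<phi> x \<partial>\<nu>)"
proof -
  let ?m = "\<integral>\<^sup>+x. \<phi> x \<partial>\<nu>"
  have "(\<integral>\<^sup>+\<omega>. (\<integral>\<^sup>+x. \<phi> x \<partial>N \<omega>) * (\<integral>\<^sup>+x. \<phi> x \<partial>N \<omega>) \<partial>M) = (\<integral>\<^sup>+x. \<phi> x * (\<phi> x + ?m) \<partial>\<nu>)"
  proof (rule campbell)
    fix A assume A [measurable]: "A \<in> sets \<nu>"
    have "(\<integral>\<^sup>+\<omega>. (\<integral>\<^sup>+x. \<phi> x \<partial>N \<omega>) * emeasure (N \<omega>) A \<partial>M) = (\<integral>\<^sup>+x. \<phi> x * (indicator A x + emeasure \<nu> A) \<partial>\<nu>)"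
    proof (rule campbell)
      fix B assume B [measurable]: "B \<in> sets \<nu>"
      have "(\<integral>\<^sup>+x. indicator B x * (indicator A x + emeasure \<nu> A) \<partial>\<nu>) = (\<integral>\<^sup>+x. indicator (B \<inter> A) x + emeasure \<nu> A * indicator B x \<partial>\<nu>)"
        by (intro nn_integral_cong) (auto simp: indicator_def)
      also have "\<dots> = emeasure \<nu> (B \<inter> A) + emeasure \<nu> A * emeasure \<nu> B"
        by (simp add: nn_integral_add nn_integral_cmult_indicator)
      finally show "(\<integral>\<^sup>+\<omega>. emeasure (N \<omega>) B * emeasure (N \<omega>) A \<partial>M) = (\<integral>\<^sup>+x. indicator B x * (indicator A x + emeasure \<nu> A) \<partial>\<nu>)"
        by (simp add: mean_count_prod A B ac_simps)
    qed measurable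
    also have "\<dots> = (\<integral>\<^sup>+x. indicator A x * \<phi> x + emeasure \<nu> A * \<phi> x \<partial>\<nu>)"
      by (intro nn_integral_cong) (simp add: distrib_left mult.commute)
    also have "\<dots> = (\<integral>\<^sup>+x. indicator A x * \<phi> x \<partial>\<nu>) + emeasure \<nu> A * ?m"
      by (simp add: nn_integral_add nn_integral_cmult)
    also have "\<dots> = (\<integral>\<^sup>+x. indicator A x * \<phi> x + ?m * indicator A x \<partial>\<nu>)"
      by (simp add: nn_integral_add nn_integral_cmult_indicator mult.commute[of "emeasure \<nu> A"])
    also have "\<dots> = (\<integral>\<^sup>+x. indicator A x * (\<phi> x + ?m) \<partial>\<nu>)"
      by (intro nn_integral_cong) (simp add: distrib_left mult.commute)
    finally show "(\<integral>\<^sup>+\<omega>. emeasure (N \<omega>) A * (\<integral>\<^sup>+x. \<phi> x \<partial>N \<omega>) \<partial>M) = (\<integral>\<^sup>+x. indicator A x * (\<phi> x + ?m) \<partial>\<nu>)"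
      by (simp add: mult.commute)
  qed measurable
  also have "\<dots> = (\<integral>\<^sup>+x. \<phi> x * \<phi> x + ?m * \<phi> x \<partial>\<nu>)"
    by (intro nn_integral_cong) (simp add: distrib_left mult.commute)
  also have "\<dots> = (\<integral>\<^sup>+x. \<phi> x * \<phi> x \<partial>\<nu>) + ?m * ?m"
    by (simp add: nn_integral_add nn_integral_cmult)
  finally show ?thesis .
qed

end

section \<open>Measurable dependence of a Poisson law on its intensity\<close>

text \<open>The maps \<open>N u\<close> are unrelated for different \<open>u\<close>, so only their
  laws can depend measurably on \<open>u\<close>. Finitely many sets generate a finite algebra; the
  counts on its cells are independent and Poisson, with parameters measurable in \<open>u\<close>,
  and every original count is a sum of cell counts. So the probability of a generating event is that
  of a fixed event under a product kernel.\<close>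

lemma prm_kernel:
  fixes M :: "'w measure" and N :: "'u \<Rightarrow> 'w \<Rightarrow> 'e measure"
  assumes N: "\<And>u. u \<in> space L \<Longrightarrow> poisson_random_measure M (N u) (\<nu> u)"
    and E: "\<And>u. u \<in> space L \<Longrightarrow> sets (\<nu> u) = sets E"
    and \<nu>: "\<And>A. A \<in> sets E \<Longrightarrow> (\<lambda>u. emeasure (\<nu> u) A) \<in> borel_measurable L"
  shows "(\<lambda>u. distr M (random_measure_algebra E) (N u)) \<in> L \<rightarrow>\<^sub>M prob_algebra (random_measure_algebra E)"
proof (rule measurable_prob_algebra_generated)
  let ?\<Omega> = "{N. sets N = sets E}"
  let ?G = "{{N. sets N = sets E \<and> (\<forall>A\<in>F. emeasure N A \<in> B A)} | F B.
        finite F \<and> F \<subseteq> sets E \<and> (\<forall>A. B A \<in> sets (borel :: ennreal measure))}"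
  show "sets (random_measure_algebra E) = sigma_sets ?\<Omega> ?G" by (rule sets_random_measure_algebra)
  show "?G \<subseteq> Pow ?\<Omega>" by auto
  show "Int_stable ?G"
  proof (rule Int_stableI, clarify)
    fix F F' and B B' :: "'e set \<Rightarrow> ennreal set"
    assume h: "finite F" "F \<subseteq> sets E" "\<forall>A. B A \<in> sets borel" "finite F'" "F' \<subseteq> sets E" "\<forall>A. B' A \<in> sets borel"
    \<comment> \<open>Sets outside one of the two families are subjected to the void condition
      \<open>UNIV\<close>, so both conditions live on the union.\<close>
    let ?B = "\<lambda>A. (if A \<in> F then B A else UNIV) \<inter> (if A \<in> F' then B' A else UNIV)"
    have "{N. sets N = sets E \<and> (\<forall>A\<in>F. emeasure N A \<in> B A)} \<inter> {N. sets N = sets E \<and> (\<forall>A\<in>F'. emeasure N A \<in> B' A)}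
      = {N. sets N = sets E \<and> (\<forall>A\<in>F \<union> F'. emeasure N A \<in> ?B A)}" by auto
    moreover have "finite (F \<union> F')" "F \<union> F' \<subseteq> sets E" "\<forall>A. ?B A \<in> sets borel" using h by auto
    ultimately show "\<exists>F'' B''. {N. sets N = sets E \<and> (\<forall>A\<in>F. emeasure N A \<in> B A)} \<inter> {N. sets N = sets E \<and> (\<forall>A\<in>F'. emeasure N A \<in> B' A)}
      = {N. sets N = sets E \<and> (\<forall>A\<in>F''. emeasure N A \<in> B'' A)} \<and> finite F'' \<and> F'' \<subseteq> sets E \<and> (\<forall>A. B'' A \<in> sets borel)"
      by (intro exI[of _ "F \<union> F'"] exI[of _ ?B]) simp
  qed
  have prm: "prm M (N u) (\<nu> u)" if "u \<in> space L" for u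
    using N[OF that] by (auto simp: prm_def prm_axioms_def poisson_random_measure_def)
  have mN: "N u \<in> M \<rightarrow>\<^sub>M random_measure_algebra E" if "u \<in> space L" for u
    using prm.measurable_N[OF prm[OF that]] E[OF that] by (simp add: random_measure_algebra_def)
  show "prob_space (distr M (random_measure_algebra E) (N u))" if "u \<in> space L" for u
  proof -
    interpret prm M "N u" "\<nu> u" by (rule prm[OF that])
    show ?thesis by (rule prob_space_distr) (rule mN[OF that])
  qed
  show "sets (distr M (random_measure_algebra E) (N u)) = sets (random_measure_algebra E)" for u by simp
  define count_law where "count_law C u = distr M borel (\<lambda>\<omega>. emeasure (N u \<omega>) C)" for C u
  have count_law: "count_law C \<in> L \<rightarrow>\<^sub>M prob_algebra borel" if C: "C \<in> sets E" for C
  proof (rule measurable_prob_algebra_generated)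
    show "sets (borel :: ennreal measure) = sigma_sets (space borel) (sets borel)" by (rule sets.sigma_sets_eq[symmetric])
    show "Int_stable (sets (borel :: ennreal measure))" by (rule sets.Int_stable)
    show "sets (borel :: ennreal measure) \<subseteq> Pow (space borel)" by auto
    show "sets (count_law C u) = sets borel" for u by (simp add: count_law_def)
    fix u assume u: "u \<in> space L"
    interpret prm M "N u" "\<nu> u" by (rule prm[OF u])
    show "prob_space (count_law C u)" unfolding count_law_def
      using C E[OF u] by (intro prob_space_distr measurable_count) simp
  next
    fix B :: "ennreal set" assume B: "B \<in> sets borel"
    have [measurable]: "(\<lambda>u. emeasure (\<nu> u) C) \<in> borel_measurable L" using \<nu>[OF C] .
    have [measurable]: "(\<lambda>u. measure (\<nu> u) C) \<in> borel_measurable L" unfolding measure_def by measurable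
    have "(\<lambda>u. if emeasure (\<nu> u) C = \<infinity> then indicator B \<infinity> else
      (\<Sum>k. ennreal (measure (\<nu> u) C ^ k / fact k * exp (- measure (\<nu> u) C)) * indicator B (of_nat k))) \<in> borel_measurable L"
      by measurable
    then show "(\<lambda>u. emeasure (count_law C u) B) \<in> borel_measurable L"
    proof (rule measurable_cong[THEN iffD1, rotated])
      fix u assume u: "u \<in> space L"
      interpret prm M "N u" "\<nu> u" by (rule prm[OF u])
      have C': "C \<in> sets (\<nu> u)" using C E[OF u] by simp
      have "emeasure (count_law C u) B = (\<integral>\<^sup>+\<omega>. indicator B (emeasure (N u \<omega>) C) \<partial>M)"
        using nn_integral_distr[OF measurable_count[OF C'], of "indicator B"] B by (simp add: count_law_def)
      also have "\<dots> = (if emeasure (\<nu> u) C = \<infinity> then indicator B \<infinity> else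
        (\<Sum>k. ennreal (measure (\<nu> u) C ^ k / fact k * exp (- measure (\<nu> u) C)) * indicator B (of_nat k)))"
        using C' B by (intro nn_integral_count) auto
      finally show "(if emeasure (\<nu> u) C = \<infinity> then indicator B \<infinity> else
        (\<Sum>k. ennreal (measure (\<nu> u) C ^ k / fact k * exp (- measure (\<nu> u) C)) * indicator B (of_nat k))) = emeasure (count_law C u) B" ..
    qed
  qed
  fix Y assume "Y \<in> ?G"
  then obtain F and B :: "'e set \<Rightarrow> ennreal set" where F: "finite F" "F \<subseteq> sets E" and B: "\<And>A. B A \<in> sets borel"
    and Y: "Y = {N. sets N = sets E \<and> (\<forall>A\<in>F. emeasure N A \<in> B A)}" by auto
  define m where "m = card (Pow F)"
  obtain e where e: "bij_betw e {..<m} (Pow F)"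
    using ex_bij_betw_nat_finite[of "Pow F"] F by (auto simp: m_def atLeast0LessThan)
  have m: "0 < m" using F by (auto simp: m_def card_gt_0_iff)
  \<comment> \<open>The index \<open>j\<close> codes a subset \<open>e j\<close> of
    \<open>F\<close>; the cell consists of the points that lie in exactly the members of that
    subset.\<close>
  define C where "C j = {x \<in> space E. \<forall>A\<in>F. x \<in> A \<longleftrightarrow> A \<in> e j}" for j
  have CE: "C j \<in> sets E" for j
  proof -
    have "{x \<in> space E. x \<in> A \<longleftrightarrow> A \<in> e j} \<in> sets E" if "A \<in> F" for A
    proof -
      have "{x \<in> space E. x \<in> A \<longleftrightarrow> A \<in> e j} = (if A \<in> e j then A else space E - A)"
        using F that sets.sets_into_space by auto
      then show ?thesis using F that by auto
    qed
    then show ?thesis unfolding C_def using F(1) by (intro sets.sets_Collect_finite_All) auto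
  qed
  have disj: "disjoint_family_on C {..<m}"
    unfolding disjoint_family_on_def
  proof (intro ballI impI)
    fix i j assume ij: "i \<in> {..<m}" "j \<in> {..<m}" "i \<noteq> j"
    then have "e i \<noteq> e j" "e i \<subseteq> F" "e j \<subseteq> F"
      using e bij_betwE[OF e] by (auto simp: bij_betw_def inj_on_def)
    then obtain A where "A \<in> F" "A \<in> e i \<longleftrightarrow> A \<notin> e j" by blast
    then show "C i \<inter> C j = {}" by (auto simp: C_def)
  qed
  have atoms: "emeasure Q A = (\<Sum>j | j < m \<and> A \<in> e j. emeasure Q (C j))" if Q: "sets Q = sets E" and A: "A \<in> F" for Q A
  proof -
    have "A = (\<Union>j\<in>{j. j < m \<and> A \<in> e j}. C j)"
    proof
      show "A \<subseteq> (\<Union>j\<in>{j. j < m \<and> A \<in> e j}. C j)"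
      proof
        fix x assume x: "x \<in> A"
        have "{A' \<in> F. x \<in> A'} \<in> Pow F" by auto
        then obtain j where j: "j < m" "e j = {A' \<in> F. x \<in> A'}"
          using e unfolding bij_betw_def by (metis (no_types, lifting) imageE lessThan_iff)
        moreover have "x \<in> space E" using x A F sets.sets_into_space by blast
        ultimately show "x \<in> (\<Union>j\<in>{j. j < m \<and> A \<in> e j}. C j)" using x A by (auto simp: C_def)
      qed
    qed (use A in \<open>auto simp: C_def\<close>)
    moreover have "emeasure Q (\<Union>j\<in>{j. j < m \<and> A \<in> e j}. C j) = (\<Sum>j | j < m \<and> A \<in> e j. emeasure Q (C j))"
      using CE Q disj by (intro sum_emeasure[symmetric]) (auto simp: disjoint_family_on_def)
    ultimately show ?thesis by simp
  qed
  \<comment> \<open>The event \<open>Y\<close> rewritten in terms of cell counts; it is the same set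
    for all \<open>u\<close>.\<close>
  define W where "W = {z \<in> space (\<Pi>\<^sub>M j\<in>{..<m}. borel :: ennreal measure). \<forall>A\<in>F. (\<Sum>j | j < m \<and> A \<in> e j. z j) \<in> B A}"
  have W: "W \<in> sets (\<Pi>\<^sub>M j\<in>{..<m}. borel)"
    unfolding W_def
  proof (intro sets.sets_Collect_finite_All F(1))
    fix A assume "A \<in> F"
    have [measurable]: "(\<lambda>z. \<Sum>j | j < m \<and> A \<in> e j. z j) \<in> borel_measurable (\<Pi>\<^sub>M j\<in>{..<m}. borel :: ennreal measure)"
      by (intro borel_measurable_sum measurable_component_singleton) auto
    show "{z \<in> space (\<Pi>\<^sub>M j\<in>{..<m}. borel :: ennreal measure). (\<Sum>j | j < m \<and> A \<in> e j. z j) \<in> B A} \<in> sets (\<Pi>\<^sub>M j\<in>{..<m}. borel)"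
      using B[of A] by measurable
  qed
  have "(\<lambda>u. \<Pi>\<^sub>M j\<in>{..<m}. count_law (C j) u) \<in> L \<rightarrow>\<^sub>M prob_algebra (\<Pi>\<^sub>M j\<in>{..<m}. borel)"
    using count_law CE by (intro measurable_PiM_kernel) auto
  then have "(\<lambda>u. emeasure (\<Pi>\<^sub>M j\<in>{..<m}. count_law (C j) u) W) \<in> borel_measurable L"
    using W by (intro measurable_emeasure_kernel[OF measurable_prob_algebraD]) auto
  then show "(\<lambda>u. emeasure (distr M (random_measure_algebra E) (N u)) Y) \<in> borel_measurable L"
  proof (rule measurable_cong[THEN iffD1, rotated])
    fix u assume u: "u \<in> space L"
    interpret prm M "N u" "\<nu> u" by (rule prm[OF u])
    have CE': "C j \<in> sets (\<nu> u)" for j using CE E[OF u] by simp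
    have iv: "indep_vars (\<lambda>_. borel) (\<lambda>j \<omega>. emeasure (N u \<omega>) (C j)) {..<m}"
      using CE' disj by (intro indep_counts) auto
    then have eq: "distr M (\<Pi>\<^sub>M j\<in>{..<m}. borel) (\<lambda>\<omega>. \<lambda>j\<in>{..<m}. emeasure (N u \<omega>) (C j)) = (\<Pi>\<^sub>M j\<in>{..<m}. count_law (C j) u)"
      unfolding count_law_def using m CE' by (subst (asm) indep_vars_iff_distr_eq_PiM) auto
    have Ys: "Y \<in> sets (random_measure_algebra E)"
      unfolding sets_random_measure_algebra Y using F B by (intro sigma_sets.Basic) auto
    have "emeasure (\<Pi>\<^sub>M j\<in>{..<m}. count_law (C j) u) W
      = emeasure M ((\<lambda>\<omega>. \<lambda>j\<in>{..<m}. emeasure (N u \<omega>) (C j)) -` W \<inter> space M)"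
      unfolding eq[symmetric] using W CE' by (intro emeasure_distr measurable_restrict) auto
    also have "(\<lambda>\<omega>. \<lambda>j\<in>{..<m}. emeasure (N u \<omega>) (C j)) -` W \<inter> space M = N u -` Y \<inter> space M"
    proof (intro set_eqI iffI)
      fix \<omega>
      have s: "(\<Sum>j | j < m \<and> A \<in> e j. (\<lambda>j\<in>{..<m}. emeasure (N u \<omega>) (C j)) j) = emeasure (N u \<omega>) A"
        if "A \<in> F" "\<omega> \<in> space M" for A
        using that by (subst atoms[OF _ that(1)]) (auto simp: sets_N E[OF u] intro!: sum.cong)
      { assume "\<omega> \<in> (\<lambda>\<omega>. \<lambda>j\<in>{..<m}. emeasure (N u \<omega>) (C j)) -` W \<inter> space M"
        then show "\<omega> \<in> N u -` Y \<inter> space M" using s sets_N E[OF u] by (auto simp: W_def Y) }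
      { assume "\<omega> \<in> N u -` Y \<inter> space M"
        then show "\<omega> \<in> (\<lambda>\<omega>. \<lambda>j\<in>{..<m}. emeasure (N u \<omega>) (C j)) -` W \<inter> space M"
          using s by (auto simp: W_def Y space_PiM) }
    qed
    also have "emeasure M (N u -` Y \<inter> space M) = emeasure (distr M (random_measure_algebra E) (N u)) Y"
      using mN[OF u] Ys by (rule emeasure_distr[symmetric])
    finally show "emeasure (\<Pi>\<^sub>M j\<in>{..<m}. count_law (C j) u) W = emeasure (distr M (random_measure_algebra E) (N u)) Y" .
  qed
qed

subsection \<open>Normalised random measures with atoms\<close>

lemma sets_jump_measure [simp, measurable_cong]: "sets (jump_measure Q) = sets borel"
  by (simp add: jump_measure_def)

lemma nn_integral_jump_measure:
  assumes Q: "sets Q = sets (borel \<Otimes>\<^sub>M borel)" and [measurable]: "\<phi> \<in> borel_measurable borel"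
  shows "(\<integral>\<^sup>+x. \<phi> x \<partial>jump_measure Q) = (\<integral>\<^sup>+p. ennreal (fst p) * \<phi> (snd p) \<partial>Q)"
proof -
  note [measurable_cong] = Q
  show ?thesis
    unfolding jump_measure_def by (subst nn_integral_distr) (auto simp: nn_integral_density)
qed

lemma sets_add_atoms [simp, measurable_cong]: "sets (add_atoms \<mu> D J) = sets \<mu>"
  by (simp add: add_atoms_def)

lemma space_add_atoms [simp]: "space (add_atoms \<mu> D J) = space \<mu>"
  by (simp add: add_atoms_def)

lemma emeasure_add_atoms:
  assumes D: "finite D" and A: "A \<in> sets \<mu>"
  shows "emeasure (add_atoms \<mu> D J) A = emeasure \<mu> A + (\<Sum>y\<in>D. ennreal (J y) * indicator A y)"
  unfolding add_atoms_def
proof (rule emeasure_measure_of_sigma)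
  show "sigma_algebra (space \<mu>) (sets \<mu>)" by (rule sets.sigma_algebra_axioms)
  show "positive (sets \<mu>) (\<lambda>A. emeasure \<mu> A + (\<Sum>y\<in>D. ennreal (J y) * indicator A y))"
    by (simp add: positive_def)
  show "countably_additive (sets \<mu>) (\<lambda>A. emeasure \<mu> A + (\<Sum>y\<in>D. ennreal (J y) * indicator A y))"
  proof (rule countably_additiveI)
    fix B :: "nat \<Rightarrow> 'a set"
    assume B: "range B \<subseteq> sets \<mu>" "disjoint_family B" "(\<Union>i. B i) \<in> sets \<mu>"
    have "(\<Sum>i. emeasure \<mu> (B i) + (\<Sum>y\<in>D. ennreal (J y) * indicator (B i) y))
      = (\<Sum>i. emeasure \<mu> (B i)) + (\<Sum>i. \<Sum>y\<in>D. ennreal (J y) * indicator (B i) y)"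
      by (rule suminf_add[symmetric]) auto
    also have "(\<Sum>i. \<Sum>y\<in>D. ennreal (J y) * indicator (B i) y) = (\<Sum>y\<in>D. \<Sum>i. ennreal (J y) * indicator (B i) y)"
      by (rule suminf_sum) auto
    also have "\<dots> = (\<Sum>y\<in>D. ennreal (J y) * indicator (\<Union>i. B i) y)"
      using suminf_indicator[OF B(2)] by (intro sum.cong refl) simp
    also have "(\<Sum>i. emeasure \<mu> (B i)) = emeasure \<mu> (\<Union>i. B i)"
      using B by (intro suminf_emeasure) auto
    finally show "(\<Sum>i. emeasure \<mu> (B i) + (\<Sum>y\<in>D. ennreal (J y) * indicator (B i) y))
      = emeasure \<mu> (\<Union>i. B i) + (\<Sum>y\<in>D. ennreal (J y) * indicator (\<Union>i. B i) y)" .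
  qed
qed (rule A)

lemma nn_integral_add_atoms:
  assumes D: "finite D" "D \<subseteq> space \<mu>" and "\<phi> \<in> borel_measurable \<mu>"
  shows "(\<integral>\<^sup>+x. \<phi> x \<partial>add_atoms \<mu> D J) = (\<integral>\<^sup>+x. \<phi> x \<partial>\<mu>) + (\<Sum>y\<in>D. ennreal (J y) * \<phi> y)"
  using assms(3)
proof (induction \<phi> rule: borel_measurable_induct)
  case (cong f g)
  have "(\<integral>\<^sup>+x. f x \<partial>add_atoms \<mu> D J) = (\<integral>\<^sup>+x. g x \<partial>add_atoms \<mu> D J)" "(\<integral>\<^sup>+x. f x \<partial>\<mu>) = (\<integral>\<^sup>+x. g x \<partial>\<mu>)"
    using cong(3) by (auto intro!: nn_integral_cong)
  moreover have "(\<Sum>y\<in>D. ennreal (J y) * f y) = (\<Sum>y\<in>D. ennreal (J y) * g y)"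
    using cong(3) D by (intro sum.cong) auto
  ultimately show ?case using cong(4) by simp
next
  case (set A)
  then show ?case using D by (simp add: emeasure_add_atoms)
next
  case (mult u c)
  note [measurable] = mult(2)
  show ?case by (simp add: nn_integral_cmult mult.IH distrib_left sum_distrib_left mult_ac)
next
  case (add u v)
  note [measurable] = add(1,3)
  show ?case by (simp add: nn_integral_add add.IH distrib_left sum.distrib ac_simps)
next
  case (seq U)
  note [measurable] = seq(1)
  have "(\<integral>\<^sup>+x. (SUP i. U i) x \<partial>add_atoms \<mu> D J) = (SUP i. \<integral>\<^sup>+x. U i x \<partial>add_atoms \<mu> D J)"
    using nn_integral_monotone_convergence_SUP[OF \<open>incseq U\<close>, of "add_atoms \<mu> D J"] by (simp add: image_comp)
  also have "\<dots> = (SUP i. (\<integral>\<^sup>+x. U i x \<partial>\<mu>) + (\<Sum>y\<in>D. ennreal (J y) * U i y))"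
    by (simp add: seq.IH)
  also have "\<dots> = (SUP i. \<integral>\<^sup>+x. U i x \<partial>\<mu>) + (SUP i. \<Sum>y\<in>D. ennreal (J y) * U i y)"
    using \<open>incseq U\<close> by (intro ennreal_SUP_add) (auto simp: incseq_def le_fun_def intro!: nn_integral_mono sum_mono mult_left_mono)
  also have "(SUP i. \<Sum>y\<in>D. ennreal (J y) * U i y) = (\<Sum>y\<in>D. SUP i. ennreal (J y) * U i y)"
    using \<open>incseq U\<close> by (intro incseq_sumI2[THEN ennreal_SUP_sum] ennreal_SUP_sum) (auto simp: incseq_def le_fun_def intro!: mult_left_mono)
  also have "\<dots> = (\<Sum>y\<in>D. ennreal (J y) * (SUP i. U i) y)"
    by (simp add: SUP_mult_left_ennreal image_comp)
  also have "(SUP i. \<integral>\<^sup>+x. U i x \<partial>\<mu>) = (\<integral>\<^sup>+x. (SUP i. U i) x \<partial>\<mu>)"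
    using nn_integral_monotone_convergence_SUP[OF \<open>incseq U\<close>, of \<mu>] by (simp add: image_comp)
  finally show ?case .
qed

lemma sets_normalize_measure:
  "sets \<mu> = sets borel \<Longrightarrow> sets (normalize_measure \<mu>) = sets borel"
  by (simp add: normalize_measure_def)

lemma prob_space_normalize_measure:
  assumes "sets \<mu> = sets borel"
  shows "prob_space (normalize_measure \<mu>)"
proof (cases "emeasure \<mu> (space \<mu>) = 0 \<or> emeasure \<mu> (space \<mu>) = \<infinity>")
  case True
  then show ?thesis by (auto simp: normalize_measure_def intro!: prob_space_return)
next
  case False
  then show ?thesis
    using ennreal_divide_self[of "emeasure \<mu> (space \<mu>)"] unfolding divide_ennreal_def
    by (intro prob_spaceI) (auto simp: normalize_measure_def space_scale_measure divide_ennreal_def less_top mult.commute)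
qed

lemma emeasure_normalize_measure:
  "emeasure (normalize_measure \<mu>) A = (if emeasure \<mu> (space \<mu>) = 0 \<or> emeasure \<mu> (space \<mu>) = \<infinity>
     then emeasure (return borel undefined) A else 1 / emeasure \<mu> (space \<mu>) * emeasure \<mu> A)"
  by (simp add: normalize_measure_def)

section \<open>The event that a normalised mean stays below a level\<close>

text \<open>The integral of \<open>w\<close> against the jump measure whenever it exists. As a
  difference of two nonnegative integrals it is measurable in \<open>Q\<close> without any bound on
  the mass.\<close>

definition jump_integral :: "('a \<Rightarrow> real) \<Rightarrow> (real \<times> 'a::topological_space) measure \<Rightarrow> real" where
  "jump_integral w Q = enn2real (\<integral>\<^sup>+x. ennreal (w x) \<partial>jump_measure Q) - enn2real (\<integral>\<^sup>+x. ennreal (- w x) \<partial>jump_measure Q)"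

text \<open>Multiplying by the total mass turns the inequality for a ratio into a linear one, in
  which jump part and atoms separate. The mass is positive because there is at least one atom with
  positive weight, and finite by assumption, so the dummy branch of \<open>normalize_measure\<close>
  is never taken.\<close>

lemma integral_normalize_le_iff:
  fixes f :: "'a::topological_space \<Rightarrow> real"
  assumes f [measurable]: "f \<in> borel_measurable borel" and D: "finite D" "D \<noteq> {}" "\<And>y. y \<in> D \<Longrightarrow> 0 < J y"
    and fin: "(\<integral>\<^sup>+x. ennreal \<bar>f x\<bar> \<partial>jump_measure Q) < \<infinity>" "(\<integral>\<^sup>+x. 1 \<partial>jump_measure Q) < \<infinity>"
  shows "(\<integral>y. f y \<partial>normalize_measure (add_atoms (jump_measure Q) D J)) \<le> c \<longleftrightarrow>
    jump_integral (\<lambda>y. f y - c) Q + (\<Sum>y\<in>D. J y * (f y - c)) \<le> 0"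
proof -
  define \<mu> where "\<mu> = jump_measure Q"
  define \<mu>' where "\<mu>' = add_atoms \<mu> D J"
  define m where "m = emeasure \<mu>' (space \<mu>')"
  define w where "w y = f y - c" for y
  have [measurable]: "w \<in> borel_measurable borel" by (simp add: w_def[abs_def])
  have s: "sets \<mu> = sets borel" by (simp add: \<mu>_def)
  then have s': "sets \<mu>' = sets borel" by (simp add: \<mu>'_def)
  note [measurable_cong] = s s'
  have sp: "space \<mu> = UNIV" using sets_eq_imp_space_eq[OF s] by simp
  have I: "(\<integral>\<^sup>+x. \<phi> x \<partial>\<mu>') = (\<integral>\<^sup>+x. \<phi> x \<partial>\<mu>) + (\<Sum>y\<in>D. ennreal (J y) * \<phi> y)" if "\<phi> \<in> borel_measurable borel" for \<phi>
    using D sp that unfolding \<mu>'_def by (intro nn_integral_add_atoms) auto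
  have m1: "m = (\<integral>\<^sup>+x. 1 \<partial>\<mu>) + (\<Sum>y\<in>D. ennreal (J y))"
    using I[of "\<lambda>_. 1"] by (simp add: m_def)
  have "(\<Sum>y\<in>D. ennreal (J y)) = ennreal (\<Sum>y\<in>D. J y)"
    using D by (intro sum_ennreal) (auto simp: less_imp_le)
  then have mfin: "m < \<infinity>" using fin(2) by (simp add: m1 \<mu>_def less_top)
  have mpos: "0 < m"
  proof -
    obtain y where y: "y \<in> D" using D by auto
    have "0 < ennreal (J y)" using D(3)[OF y] by simp
    also have "\<dots> \<le> (\<Sum>y\<in>D. ennreal (J y))" using y D by (intro member_le_sum) auto
    also have "\<dots> \<le> m" by (simp add: m1)
    finally show ?thesis .
  qed
  define P where "P = normalize_measure \<mu>'"
  interpret P: prob_space P unfolding P_def by (rule prob_space_normalize_measure[OF s'])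
  have sP: "sets P = sets borel" using sets_normalize_measure[OF s'] by (simp add: P_def)
  note [measurable_cong] = sP
  have IP: "(\<integral>\<^sup>+x. \<phi> x \<partial>P) = 1 / m * (\<integral>\<^sup>+x. \<phi> x \<partial>\<mu>')" if [measurable]: "\<phi> \<in> borel_measurable borel" for \<phi>
  proof -
    have "\<not> (m = 0 \<or> m = \<infinity>)" using mpos mfin by auto
    then have "P = scale_measure (1 / m) \<mu>'" by (simp add: P_def normalize_measure_def m_def[symmetric])
    then show ?thesis by (simp add: nn_integral_scale_measure)
  qed
  define r where "r = 1 / enn2real m"
  have r: "0 < r" "1 / m = ennreal r"
  proof -
    have "0 < enn2real m" "m = ennreal (enn2real m)"
      using mpos mfin by (auto simp: enn2real_positive_iff less_top)
    then show "0 < r" "1 / m = ennreal r"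
      using divide_ennreal[of 1 "enn2real m"] by (auto simp: r_def)
  qed
  have "(\<integral>\<^sup>+x. ennreal \<bar>f x\<bar> \<partial>\<mu>') < \<infinity>"
  proof -
    have "(\<Sum>y\<in>D. ennreal (J y) * ennreal \<bar>f y\<bar>) = ennreal (\<Sum>y\<in>D. J y * \<bar>f y\<bar>)"
      using D by (subst sum_ennreal[symmetric]) (auto simp: less_imp_le ennreal_mult' intro!: sum.cong)
    then show ?thesis using fin(1) by (subst I) (auto simp: \<mu>_def less_top)
  qed
  then have "(\<integral>\<^sup>+x. ennreal (norm (f x)) \<partial>P) < \<infinity>"
    by (simp add: IP r ennreal_mult_less_top less_top)
  then have intf: "integrable P f" by (intro integrableI_bounded) auto
  then have "(\<integral>y. w y \<partial>P) = (\<integral>y. f y \<partial>P) - c"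
    by (simp add: w_def P.prob_space)
  then have 1: "(\<integral>y. f y \<partial>P) \<le> c \<longleftrightarrow> (\<integral>y. w y \<partial>P) \<le> 0" by simp
  have intw: "integrable P w" using intf by (simp add: w_def[abs_def])
  have finw: "(\<integral>\<^sup>+x. ennreal \<bar>w x\<bar> \<partial>\<mu>) < \<infinity>"
  proof -
    have "(\<integral>\<^sup>+x. ennreal \<bar>w x\<bar> \<partial>\<mu>) \<le> (\<integral>\<^sup>+x. ennreal \<bar>f x\<bar> + ennreal \<bar>c\<bar> * 1 \<partial>\<mu>)"
      by (intro nn_integral_mono) (auto simp: w_def ennreal_plus[symmetric] simp del: ennreal_plus intro!: ennreal_leI)
    also have "\<dots> = (\<integral>\<^sup>+x. ennreal \<bar>f x\<bar> \<partial>\<mu>) + (\<integral>\<^sup>+x. ennreal \<bar>c\<bar> * 1 \<partial>\<mu>)"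
      by (rule nn_integral_add) measurable
    also have "(\<integral>\<^sup>+x. ennreal \<bar>c\<bar> * 1 \<partial>\<mu>) = ennreal \<bar>c\<bar> * (\<integral>\<^sup>+x. 1 \<partial>\<mu>)"
      by (rule nn_integral_cmult) measurable
    also have "(\<integral>\<^sup>+x. ennreal \<bar>f x\<bar> \<partial>\<mu>) + ennreal \<bar>c\<bar> * (\<integral>\<^sup>+x. 1 \<partial>\<mu>) < \<infinity>"
      using fin by (simp add: \<mu>_def ennreal_mult_less_top less_top del: nn_integral_const)
    finally show ?thesis .
  qed
  have e: "enn2real (\<integral>\<^sup>+x. ennreal (v x) \<partial>P) = r * (enn2real (\<integral>\<^sup>+x. ennreal (v x) \<partial>\<mu>) + (\<Sum>y\<in>D. J y * max 0 (v y)))"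
    if v: "v \<in> borel_measurable borel" "\<And>x. v x \<le> \<bar>w x\<bar>" for v
  proof -
    have [measurable]: "v \<in> borel_measurable borel" by (rule v)
    have f: "(\<integral>\<^sup>+x. ennreal (v x) \<partial>\<mu>) < \<infinity>"
      by (rule le_less_trans[OF nn_integral_mono finw]) (use v in \<open>auto intro!: ennreal_leI\<close>)
    have "(\<integral>\<^sup>+x. ennreal (v x) \<partial>P) = ennreal r * ((\<integral>\<^sup>+x. ennreal (v x) \<partial>\<mu>) + (\<Sum>y\<in>D. ennreal (J y) * ennreal (v y)))"
      by (simp add: IP I r(2))
    also have "(\<Sum>y\<in>D. ennreal (J y) * ennreal (v y)) = ennreal (\<Sum>y\<in>D. J y * max 0 (v y))"
    proof -
      have "ennreal (J y) * ennreal (v y) = ennreal (J y * max 0 (v y))" if "y \<in> D" for y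
        using D(3)[OF that] by (cases "0 \<le> v y") (simp_all add: ennreal_mult' less_imp_le ennreal_neg)
      then have "(\<Sum>y\<in>D. ennreal (J y) * ennreal (v y)) = (\<Sum>y\<in>D. ennreal (J y * max 0 (v y)))"
        by (intro sum.cong) auto
      also have "\<dots> = ennreal (\<Sum>y\<in>D. J y * max 0 (v y))"
        using D(3) by (intro sum_ennreal mult_nonneg_nonneg) (auto simp: less_imp_le)
      finally show ?thesis .
    qed
    also have "(\<integral>\<^sup>+x. ennreal (v x) \<partial>\<mu>) = ennreal (enn2real (\<integral>\<^sup>+x. ennreal (v x) \<partial>\<mu>))"
      using f by (simp add: less_top)
    also have "ennreal (enn2real (\<integral>\<^sup>+x. ennreal (v x) \<partial>\<mu>)) + ennreal (\<Sum>y\<in>D. J y * max 0 (v y))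
      = ennreal (enn2real (\<integral>\<^sup>+x. ennreal (v x) \<partial>\<mu>) + (\<Sum>y\<in>D. J y * max 0 (v y)))"
      using D(3) by (intro ennreal_plus[symmetric] sum_nonneg) (auto simp: less_imp_le)
    finally have *: "(\<integral>\<^sup>+x. ennreal (v x) \<partial>P)
      = ennreal r * ennreal (enn2real (\<integral>\<^sup>+x. ennreal (v x) \<partial>\<mu>) + (\<Sum>y\<in>D. J y * max 0 (v y)))" .
    have "0 \<le> enn2real (\<integral>\<^sup>+x. ennreal (v x) \<partial>\<mu>) + (\<Sum>y\<in>D. J y * max 0 (v y))"
      using D(3) by (intro add_nonneg_nonneg sum_nonneg) (auto simp: less_imp_le)
    then show ?thesis unfolding * using r(1) by (subst ennreal_mult'[symmetric]) (simp_all del: ennreal_plus)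
  qed
  have "(\<integral>y. w y \<partial>P) = r * (enn2real (\<integral>\<^sup>+x. ennreal (w x) \<partial>\<mu>) + (\<Sum>y\<in>D. J y * max 0 (w y)))
    - r * (enn2real (\<integral>\<^sup>+x. ennreal (- w x) \<partial>\<mu>) + (\<Sum>y\<in>D. J y * max 0 (- w y)))"
    unfolding real_lebesgue_integral_def[OF intw] by (subst (1 2) e) auto
  also have "\<dots> = r * (jump_integral w Q + (\<Sum>y\<in>D. J y * (max 0 (w y) - max 0 (- w y))))"
    by (simp add: jump_integral_def \<mu>_def right_diff_distrib sum_subtractf distrib_left)
  also have "(\<Sum>y\<in>D. J y * (max 0 (w y) - max 0 (- w y))) = (\<Sum>y\<in>D. J y * w y)"
    by (intro sum.cong refl arg_cong2[where f = "(*)"]) auto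
  finally have "(\<integral>y. w y \<partial>P) \<le> 0 \<longleftrightarrow> jump_integral w Q + (\<Sum>y\<in>D. J y * w y) \<le> 0"
    using r by (simp add: mult_le_0_iff)
  then show ?thesis using 1 by (simp add: P_def \<mu>'_def \<mu>_def w_def[abs_def])
qed

abbreviation "jump_algebra \<equiv> random_measure_algebra ((borel :: real measure) \<Otimes>\<^sub>M (borel :: 'a::topological_space measure))"

lemma nn_integral_jump_measurable:
  assumes [measurable]: "\<phi> \<in> borel_measurable (borel :: 'a::topological_space measure)"
  shows "(\<lambda>Q. \<integral>\<^sup>+x. \<phi> x \<partial>jump_measure Q) \<in> borel_measurable jump_algebra"
proof -
  have "(\<lambda>Q. \<integral>\<^sup>+p. ennreal (fst p) * \<phi> (snd p) \<partial>Q) \<in> borel_measurable jump_algebra"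
    by (rule nn_integral_measurable_random_measure) measurable
  then show ?thesis
    by (rule measurable_cong[THEN iffD1, rotated])
       (simp add: space_random_measure_algebra nn_integral_jump_measure)
qed

lemma jump_integral_measurable [measurable]:
  assumes [measurable]: "w \<in> borel_measurable (borel :: 'a::topological_space measure)"
  shows "jump_integral w \<in> borel_measurable jump_algebra"
  unfolding jump_integral_def[abs_def]
  by (intro borel_measurable_diff borel_measurable_enn2real nn_integral_jump_measurable) measurable

lemma normalize_add_atoms_measurable:
  fixes D :: "'a::t1_space set"
  assumes D: "finite D"
  shows "(\<lambda>(Q, J). normalize_measure (add_atoms (jump_measure Q) D J))
    \<in> (jump_algebra \<Otimes>\<^sub>M (\<Pi>\<^sub>M y\<in>D. borel)) \<rightarrow>\<^sub>M prob_algebra borel"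
proof -
  let ?S = "jump_algebra \<Otimes>\<^sub>M (\<Pi>\<^sub>M y\<in>D. (borel :: real measure))"
  let ?\<mu> = "\<lambda>z. add_atoms (jump_measure (fst z)) D (snd z)"
  have em: "(\<lambda>z. emeasure (?\<mu> z) A) \<in> borel_measurable ?S" if A: "A \<in> sets borel" for A
  proof -
    note [measurable] = A
    have 1: "(\<lambda>z. \<integral>\<^sup>+x. indicator A x \<partial>jump_measure (fst z)) \<in> borel_measurable ?S"
      using A by (intro measurable_compose[OF measurable_fst nn_integral_jump_measurable]) measurable
    have 2: "(\<lambda>z. \<Sum>y\<in>D. ennreal (snd z y) * indicator A y) \<in> borel_measurable ?S" by measurable
    have "(\<lambda>z. (\<integral>\<^sup>+x. indicator A x \<partial>jump_measure (fst z)) + (\<Sum>y\<in>D. ennreal (snd z y) * indicator A y)) \<in> borel_measurable ?S"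
      using 1 2 by measurable
    then show ?thesis
      by (rule measurable_cong[THEN iffD1, rotated]) (use A D in \<open>simp add: emeasure_add_atoms\<close>)
  qed
  have sp: "space (?\<mu> z) = UNIV" for z
    using sets_eq_imp_space_eq[OF sets_jump_measure] by simp
  have "(\<lambda>z. normalize_measure (?\<mu> z)) \<in> ?S \<rightarrow>\<^sub>M prob_algebra borel"
  proof (rule measurable_prob_algebraI)
    show p: "prob_space (normalize_measure (?\<mu> z))" for z by (rule prob_space_normalize_measure) simp
    show "(\<lambda>z. normalize_measure (?\<mu> z)) \<in> ?S \<rightarrow>\<^sub>M subprob_algebra borel"
    proof (rule measurable_subprob_algebra)
      show "subprob_space (normalize_measure (?\<mu> z))" for z using p by (rule prob_space_imp_subprob_space)
      show "sets (normalize_measure (?\<mu> z)) = sets borel" for z by (rule sets_normalize_measure) simp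
      fix A :: "'a set" assume A: "A \<in> sets borel"
      note [measurable] = em[OF A] em[OF sets.top, simplified]
      show "(\<lambda>z. emeasure (normalize_measure (?\<mu> z)) A) \<in> borel_measurable ?S"
        unfolding emeasure_normalize_measure sp by measurable
    qed
  qed
  then show ?thesis by (simp add: case_prod_beta')
qed

lemma gamma_kernel_measurable:
  assumes "0 < p" "0 < \<theta>"
  shows "(\<lambda>u. gamma_law p (u + \<theta>)) \<in> restrict_space lborel {0<..} \<rightarrow>\<^sub>M prob_algebra borel"
proof (rule measurable_prob_algebra_generated)
  show "sets (borel :: real measure) = sigma_sets (space borel) (sets borel)" by (rule sets.sigma_sets_eq[symmetric])
  show "Int_stable (sets (borel :: real measure))" by (rule sets.Int_stable)
  show "sets (borel :: real measure) \<subseteq> Pow (space borel)" by auto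
  show "prob_space (gamma_law p (u + \<theta>))" if "u \<in> space (restrict_space lborel {0<..})" for u
    using that assms by (intro prob_space_gamma_law) auto
  show "sets (gamma_law p (u + \<theta>)) = sets borel" for u by simp
  fix A :: "real set" assume A [measurable]: "A \<in> sets borel"
  have "(\<lambda>u. \<integral>\<^sup>+t. ennreal (if 0 < t then (u + \<theta>) powr p / Gamma p * t powr (p - 1) * exp (- (u + \<theta>) * t) else 0)
     * indicator A t \<partial>lborel) \<in> borel_measurable borel"
    by (intro sigma_finite_measure.borel_measurable_nn_integral sigma_finite_lborel) measurable
  then have "(\<lambda>u. emeasure (gamma_law p (u + \<theta>)) A) \<in> borel_measurable borel"
    unfolding gamma_law_def by (subst emeasure_density) auto
  then show "(\<lambda>u. emeasure (gamma_law p (u + \<theta>)) A) \<in> borel_measurable (restrict_space lborel {0<..})"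
    by (intro measurable_restrict_space1) simp
qed

subsection \<open>The posterior law of the mean\<close>

text \<open>Extended nonnegative integrals cannot be subtracted. The square is expanded with its
  cross term moved to the other side, and that finite term is cancelled at the end.\<close>

lemma (in prob_space) nn_integral_variance:
  fixes X :: "'a \<Rightarrow> ennreal"
  assumes [measurable]: "X \<in> borel_measurable M"
    and m: "(\<integral>\<^sup>+\<omega>. X \<omega> \<partial>M) = ennreal m1" "0 \<le> m1"
    and m2: "(\<integral>\<^sup>+\<omega>. X \<omega> * X \<omega> \<partial>M) = ennreal m2 + ennreal m1 * ennreal m1" "0 \<le> m2"
  shows "(\<integral>\<^sup>+\<omega>. ennreal ((enn2real (X \<omega>) - m1)\<^sup>2) \<partial>M) = ennreal m2"
proof -
  have "AE \<omega> in M. X \<omega> \<noteq> \<infinity>" using m(1) by (intro nn_integral_noteq_infinite) auto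
  then have ae: "AE \<omega> in M. ennreal ((enn2real (X \<omega>) - m1)\<^sup>2) + ennreal (2 * m1) * X \<omega> = X \<omega> * X \<omega> + ennreal (m1\<^sup>2)"
  proof eventually_elim
    case (elim \<omega>)
    then obtain r where r: "X \<omega> = ennreal r" "0 \<le> r" by (cases "X \<omega>") auto
    have "ennreal ((r - m1)\<^sup>2) + ennreal (2 * m1) * ennreal r = ennreal ((r - m1)\<^sup>2 + 2 * m1 * r)"
      using r m(2) by (subst ennreal_plus) (auto simp: ennreal_mult')
    also have "(r - m1)\<^sup>2 + 2 * m1 * r = r * r + m1\<^sup>2" by (simp add: power2_eq_square algebra_simps)
    also have "ennreal (r * r + m1\<^sup>2) = ennreal r * ennreal r + ennreal (m1\<^sup>2)"
      using r by (subst ennreal_plus) (auto simp: ennreal_mult')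
    finally show ?case using r by simp
  qed
  have "(\<integral>\<^sup>+\<omega>. ennreal ((enn2real (X \<omega>) - m1)\<^sup>2) \<partial>M) + ennreal (2 * m1) * ennreal m1
    = (\<integral>\<^sup>+\<omega>. ennreal ((enn2real (X \<omega>) - m1)\<^sup>2) + ennreal (2 * m1) * X \<omega> \<partial>M)"
    by (subst nn_integral_add) (auto simp: nn_integral_cmult m)
  also have "\<dots> = (\<integral>\<^sup>+\<omega>. X \<omega> * X \<omega> + ennreal (m1\<^sup>2) \<partial>M)"
    by (rule nn_integral_cong_AE[OF ae])
  also have "\<dots> = ennreal m2 + ennreal m1 * ennreal m1 + ennreal (m1\<^sup>2)"
    by (subst nn_integral_add) (auto simp: m2 emeasure_space_1)
  also have "\<dots> = ennreal (2 * m1) * ennreal m1 + ennreal m2"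
    using m(2) m2(2) by (simp add: ennreal_mult'[symmetric] ennreal_plus[symmetric] power2_eq_square del: ennreal_plus)
  finally have "ennreal (2 * m1) * ennreal m1 + (\<integral>\<^sup>+\<omega>. ennreal ((enn2real (X \<omega>) - m1)\<^sup>2) \<partial>M)
     = ennreal (2 * m1) * ennreal m1 + ennreal m2" by (simp add: add.commute)
  then show ?thesis by (simp add: ennreal_add_left_cancel ennreal_mult_eq_top_iff)
qed

lemma Chebyshev_nn:
  assumes [measurable]: "A \<in> borel_measurable M" and "0 < \<epsilon>"
  shows "emeasure M {\<omega> \<in> space M. \<epsilon> \<le> \<bar>A \<omega> - m\<bar>} \<le> ennreal (1 / \<epsilon>\<^sup>2) * (\<integral>\<^sup>+\<omega>. ennreal ((A \<omega> - m)\<^sup>2) \<partial>M)"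
proof -
  have "{\<omega> \<in> space M. \<epsilon> \<le> \<bar>A \<omega> - m\<bar>} \<subseteq> {\<omega> \<in> space M. 1 \<le> ennreal (1 / \<epsilon>\<^sup>2) * ennreal ((A \<omega> - m)\<^sup>2)}"
  proof clarify
    fix \<omega> assume "\<epsilon> \<le> \<bar>A \<omega> - m\<bar>"
    then have "\<epsilon>\<^sup>2 \<le> (A \<omega> - m)\<^sup>2" using assms(2) by (simp add: abs_le_square_iff[symmetric])
    then show "1 \<le> ennreal (1 / \<epsilon>\<^sup>2) * ennreal ((A \<omega> - m)\<^sup>2)"
      using assms(2) by (simp add: ennreal_mult'[symmetric] field_simps)
  qed
  then have "emeasure M {\<omega> \<in> space M. \<epsilon> \<le> \<bar>A \<omega> - m\<bar>} \<le> emeasure M {\<omega> \<in> space M. 1 \<le> ennreal (1 / \<epsilon>\<^sup>2) * ennreal ((A \<omega> - m)\<^sup>2)}"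
    by (intro emeasure_mono) auto
  also have "\<dots> \<le> ennreal (1 / \<epsilon>\<^sup>2) * (\<integral>\<^sup>+\<omega>. ennreal ((A \<omega> - m)\<^sup>2) * indicator (space M) \<omega> \<partial>M)"
    by (rule nn_integral_Markov_inequality) auto
  also have "(\<integral>\<^sup>+\<omega>. ennreal ((A \<omega> - m)\<^sup>2) * indicator (space M) \<omega> \<partial>M) = (\<integral>\<^sup>+\<omega>. ennreal ((A \<omega> - m)\<^sup>2) \<partial>M)"
    by (intro nn_integral_cong) auto
  finally show ?thesis .
qed

section \<open>First and second moments of the jump part\<close>

locale nggp = latent a \<sigma> \<theta> for a \<sigma> \<theta> :: real +
  fixes H :: "'a::polish_space measure" and M :: "'w measure"
    and N :: "real \<Rightarrow> 'w \<Rightarrow> (real \<times> 'a) measure"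
  assumes H: "prob_space H" and sets_H: "sets H = sets borel"
    and N: "\<And>u. 0 < u \<Longrightarrow> poisson_random_measure M (N u) (nggp_intensity a \<sigma> (\<theta> + u) H)"
begin

sublocale H: prob_space H by (rule H)

lemmas [measurable_cong] = sets_H

definition jump_density :: "real \<Rightarrow> real \<Rightarrow> real" where
  "jump_density \<tau> s = (if 0 < s then a / Gamma (1 - \<sigma>) * s powr (- 1 - \<sigma>) * exp (- \<tau> * s) else 0)"

lemma nggp_intensity_eq: "nggp_intensity a \<sigma> \<tau> H = density lborel (\<lambda>s. ennreal (jump_density \<tau> s)) \<Otimes>\<^sub>M H"
  by (simp add: nggp_intensity_def jump_density_def)

lemma jump_density_measurable [measurable]: "(\<lambda>(\<tau>, s). jump_density \<tau> s) \<in> borel_measurable (borel \<Otimes>\<^sub>M borel)"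
  unfolding jump_density_def by measurable

lemma sets_nggp_intensity: "sets (nggp_intensity a \<sigma> \<tau> H) = sets (borel \<Otimes>\<^sub>M borel)"
  unfolding nggp_intensity_eq by (intro sets_pair_measure_cong) (auto simp: sets_H)

lemma emeasure_nggp_intensity_measurable:
  assumes A: "A \<in> sets (borel \<Otimes>\<^sub>M (borel :: 'a measure))"
  shows "(\<lambda>u. emeasure (nggp_intensity a \<sigma> (\<theta> + u) H) A) \<in> borel_measurable borel"
proof -
  have A1 [measurable]: "A \<in> sets (borel \<Otimes>\<^sub>M H)"
    using A sets_pair_measure_cong[OF refl sets_H, of borel] by simp
  have [measurable]: "(\<lambda>s. emeasure H (Pair s -` A)) \<in> borel_measurable borel"
    by (rule H.measurable_emeasure_Pair[OF A1])
  have "emeasure (nggp_intensity a \<sigma> (\<theta> + u) H) A = (\<integral>\<^sup>+s. ennreal (jump_density (\<theta> + u) s) * emeasure H (Pair s -` A) \<partial>lborel)" for u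
  proof -
    have "A \<in> sets (density lborel (\<lambda>s. ennreal (jump_density (\<theta> + u) s)) \<Otimes>\<^sub>M H)"
      using A sets_nggp_intensity by (simp add: nggp_intensity_eq)
    then show ?thesis
      unfolding nggp_intensity_eq by (subst H.emeasure_pair_measure_alt) (auto simp: nn_integral_density)
  qed
  moreover have "(\<lambda>u. \<integral>\<^sup>+s. ennreal (jump_density (\<theta> + u) s) * emeasure H (Pair s -` A) \<partial>lborel) \<in> borel_measurable borel"
    by (intro sigma_finite_measure.borel_measurable_nn_integral sigma_finite_lborel) measurable
  ultimately show ?thesis by simp
qed

lemma nn_integral_nggp_intensity:
  assumes [measurable]: "g \<in> borel_measurable borel" "\<phi> \<in> borel_measurable borel"
  shows "(\<integral>\<^sup>+p. g (fst p) * \<phi> (snd p) \<partial>nggp_intensity a \<sigma> \<tau> H)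
    = (\<integral>\<^sup>+s. ennreal (jump_density \<tau> s) * g s \<partial>lborel) * (\<integral>\<^sup>+x. \<phi> x \<partial>H)"
proof -
  have "(\<integral>\<^sup>+p. g (fst p) * \<phi> (snd p) \<partial>nggp_intensity a \<sigma> \<tau> H)
    = (\<integral>\<^sup>+s. \<integral>\<^sup>+x. g (fst (s, x)) * \<phi> (snd (s, x)) \<partial>H \<partial>density lborel (\<lambda>s. ennreal (jump_density \<tau> s)))"
    unfolding nggp_intensity_eq by (rule H.nn_integral_fst[symmetric]) measurable
  also have "\<dots> = (\<integral>\<^sup>+s. ennreal (jump_density \<tau> s) * (g s * (\<integral>\<^sup>+x. \<phi> x \<partial>H)) \<partial>lborel)"
    by (subst nn_integral_density) (auto simp: nn_integral_cmult)
  also have "\<dots> = (\<integral>\<^sup>+s. ennreal (jump_density \<tau> s) * g s * (\<integral>\<^sup>+x. \<phi> x \<partial>H) \<partial>lborel)"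
    by (simp add: mult.assoc)
  also have "\<dots> = (\<integral>\<^sup>+s. ennreal (jump_density \<tau> s) * g s \<partial>lborel) * (\<integral>\<^sup>+x. \<phi> x \<partial>H)"
    by (rule nn_integral_multc) measurable
  finally show ?thesis .
qed

text \<open>One factor s already tames the singularity s^(-1 - \<sigma>) at 0; what remains is a
  gamma kernel of shape k - \<sigma>. For k = 0 the integral diverges, there being infinitely many
  small jumps.\<close>

lemma nn_integral_jump_density_power:
  assumes "0 < \<tau>" "1 \<le> k"
  shows "(\<integral>\<^sup>+s. ennreal (jump_density \<tau> s) * ennreal s ^ k \<partial>lborel)
    = ennreal (a / Gamma (1 - \<sigma>) * (Gamma (real k - \<sigma>) / \<tau> powr (real k - \<sigma>)))"
proof -
  have G: "0 < Gamma (1 - \<sigma>)" using \<sigma> by (simp add: Gamma_real_pos)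
  have "(\<integral>\<^sup>+s. ennreal (jump_density \<tau> s) * ennreal s ^ k \<partial>lborel)
    = (\<integral>\<^sup>+s. ennreal (a / Gamma (1 - \<sigma>)) * ennreal (if 0 < s then s powr ((real k - \<sigma>) - 1) * exp (- \<tau> * s) else 0) \<partial>lborel)"
  proof (intro nn_integral_cong)
    fix s :: real
    show "ennreal (jump_density \<tau> s) * ennreal s ^ k
      = ennreal (a / Gamma (1 - \<sigma>)) * ennreal (if 0 < s then s powr ((real k - \<sigma>) - 1) * exp (- \<tau> * s) else 0)"
    proof (cases "0 < s")
      case True
      have "s powr (- 1 - \<sigma>) * s ^ k = s powr ((real k - \<sigma>) - 1)"
        using True by (simp add: powr_realpow[symmetric] powr_add[symmetric] algebra_simps)
      then have "jump_density \<tau> s * s ^ k = a / Gamma (1 - \<sigma>) * (s powr ((real k - \<sigma>) - 1) * exp (- \<tau> * s))"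
        using True by (simp add: jump_density_def)
      then show ?thesis using True a G by (simp add: ennreal_power ennreal_mult'[symmetric] ennreal_mult''[symmetric])
    qed (simp add: jump_density_def)
  qed
  also have "\<dots> = ennreal (a / Gamma (1 - \<sigma>)) * ennreal (Gamma (real k - \<sigma>) / \<tau> powr (real k - \<sigma>))"
    using assms \<sigma> by (subst nn_integral_cmult) (auto simp: nn_integral_gamma_kernel)
  also have "\<dots> = ennreal (a / Gamma (1 - \<sigma>) * (Gamma (real k - \<sigma>) / \<tau> powr (real k - \<sigma>)))"
    using a G by (simp add: ennreal_mult'[symmetric])
  finally show ?thesis .
qed

lemma jump_mean_intensity:
  assumes "0 < \<tau>" and [measurable]: "\<phi> \<in> borel_measurable borel"
  shows "(\<integral>\<^sup>+p. ennreal (fst p) * \<phi> (snd p) \<partial>nggp_intensity a \<sigma> \<tau> H) = ennreal (a * \<tau> powr (\<sigma> - 1)) * (\<integral>\<^sup>+x. \<phi> x \<partial>H)"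
proof -
  have "(\<integral>\<^sup>+s. ennreal (jump_density \<tau> s) * ennreal s \<partial>lborel) = ennreal (a * \<tau> powr (\<sigma> - 1))"
    using nn_integral_jump_density_power[OF assms(1), of 1] Gamma_real_pos[of "1 - \<sigma>"] \<sigma>
      powr_minus_divide[of \<tau> "1 - \<sigma>"]
    by (simp add: less_imp_neq[symmetric])
  then show ?thesis by (subst nn_integral_nggp_intensity) auto
qed

lemma jump_second_intensity:
  assumes "0 < \<tau>" and [measurable]: "\<phi> \<in> borel_measurable borel"
  shows "(\<integral>\<^sup>+p. (ennreal (fst p) * \<phi> (snd p)) * (ennreal (fst p) * \<phi> (snd p)) \<partial>nggp_intensity a \<sigma> \<tau> H)
    = ennreal (a * (1 - \<sigma>) * \<tau> powr (\<sigma> - 2)) * (\<integral>\<^sup>+x. \<phi> x * \<phi> x \<partial>H)"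
proof -
  have "Gamma (2 - \<sigma>) = (1 - \<sigma>) * Gamma (1 - \<sigma>)"
  proof -
    have "1 - \<sigma> \<notin> \<int>\<^sub>\<le>\<^sub>0"
    proof
      assume "1 - \<sigma> \<in> \<int>\<^sub>\<le>\<^sub>0"
      then obtain n where "1 - \<sigma> = of_int n" "n \<le> 0" by (elim nonpos_Ints_cases)
      then have "1 - \<sigma> \<le> 0" by simp
      then show False using \<sigma> by simp
    qed
    then show ?thesis using Gamma_plus1[of "1 - \<sigma>"] by (simp add: algebra_simps)
  qed
  then have 1: "(\<integral>\<^sup>+s. ennreal (jump_density \<tau> s) * (ennreal s * ennreal s) \<partial>lborel) = ennreal (a * (1 - \<sigma>) * \<tau> powr (\<sigma> - 2))"
    using nn_integral_jump_density_power[OF assms(1), of 2] Gamma_real_pos[of "1 - \<sigma>"] \<sigma>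
      powr_minus_divide[of \<tau> "2 - \<sigma>"]
    by (simp add: less_imp_neq[symmetric] power2_eq_square)
  have "(\<integral>\<^sup>+p. (ennreal (fst p) * \<phi> (snd p)) * (ennreal (fst p) * \<phi> (snd p)) \<partial>nggp_intensity a \<sigma> \<tau> H)
     = (\<integral>\<^sup>+p. (ennreal (fst p) * ennreal (fst p)) * (\<phi> (snd p) * \<phi> (snd p)) \<partial>nggp_intensity a \<sigma> \<tau> H)"
    by (simp add: ac_simps)
  also have "\<dots> = ennreal (a * (1 - \<sigma>) * \<tau> powr (\<sigma> - 2)) * (\<integral>\<^sup>+x. \<phi> x * \<phi> x \<partial>H)"
    using nn_integral_nggp_intensity[of "\<lambda>s. ennreal s * ennreal s" "\<lambda>x. \<phi> x * \<phi> x" \<tau>] 1 by simp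
  finally show ?thesis .
qed

lemma prm_N: "0 < u \<Longrightarrow> prm M (N u) (nggp_intensity a \<sigma> (\<theta> + u) H)"
  using N[of u] by (auto simp: prm_def prm_axioms_def poisson_random_measure_def)

lemma prob_space_M: "prob_space M"
  using prm_N[of 1] by (simp add: prm_def)

sublocale M: prob_space M by (rule prob_space_M)

lemma sets_jumps: "0 < u \<Longrightarrow> \<omega> \<in> space M \<Longrightarrow> sets (N u \<omega>) = sets (borel \<Otimes>\<^sub>M borel)"
  using prm.sets_N[OF prm_N] by (simp add: sets_nggp_intensity)

lemma measurable_jumps: "0 < u \<Longrightarrow> N u \<in> M \<rightarrow>\<^sub>M jump_algebra"
  using prm.measurable_N[OF prm_N] by (simp add: random_measure_algebra_def sets_nggp_intensity)

lemma jump_mean: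
  assumes u: "0 < u" and [measurable]: "\<phi> \<in> borel_measurable borel"
  shows "(\<integral>\<^sup>+\<omega>. (\<integral>\<^sup>+x. \<phi> x \<partial>jump_measure (N u \<omega>)) \<partial>M) = ennreal (a * (u + \<theta>) powr (\<sigma> - 1)) * (\<integral>\<^sup>+x. \<phi> x \<partial>H)"
proof -
  interpret prm M "N u" "nggp_intensity a \<sigma> (\<theta> + u) H" by (rule prm_N[OF u])
  note [measurable_cong] = sets_nggp_intensity
  have "(\<integral>\<^sup>+\<omega>. (\<integral>\<^sup>+x. \<phi> x \<partial>jump_measure (N u \<omega>)) \<partial>M) = (\<integral>\<^sup>+\<omega>. (\<integral>\<^sup>+p. ennreal (fst p) * \<phi> (snd p) \<partial>N u \<omega>) \<partial>M)"
    using sets_jumps[OF u] by (intro nn_integral_cong) (simp add: nn_integral_jump_measure)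
  also have "\<dots> = (\<integral>\<^sup>+p. ennreal (fst p) * \<phi> (snd p) \<partial>nggp_intensity a \<sigma> (\<theta> + u) H)"
    by (rule mean_integral) measurable
  finally show ?thesis using u \<theta> by (simp add: jump_mean_intensity add.commute)
qed

lemma jump_second_moment:
  assumes u: "0 < u" and [measurable]: "\<phi> \<in> borel_measurable borel"
  shows "(\<integral>\<^sup>+\<omega>. (\<integral>\<^sup>+x. \<phi> x \<partial>jump_measure (N u \<omega>)) * (\<integral>\<^sup>+x. \<phi> x \<partial>jump_measure (N u \<omega>)) \<partial>M)
    = ennreal (a * (1 - \<sigma>) * (u + \<theta>) powr (\<sigma> - 2)) * (\<integral>\<^sup>+x. \<phi> x * \<phi> x \<partial>H)
      + (ennreal (a * (u + \<theta>) powr (\<sigma> - 1)) * (\<integral>\<^sup>+x. \<phi> x \<partial>H)) * (ennreal (a * (u + \<theta>) powr (\<sigma> - 1)) * (\<integral>\<^sup>+x. \<phi> x \<partial>H))"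
proof -
  interpret prm M "N u" "nggp_intensity a \<sigma> (\<theta> + u) H" by (rule prm_N[OF u])
  note [measurable_cong] = sets_nggp_intensity
  have "(\<integral>\<^sup>+\<omega>. (\<integral>\<^sup>+x. \<phi> x \<partial>jump_measure (N u \<omega>)) * (\<integral>\<^sup>+x. \<phi> x \<partial>jump_measure (N u \<omega>)) \<partial>M)
    = (\<integral>\<^sup>+\<omega>. (\<integral>\<^sup>+p. ennreal (fst p) * \<phi> (snd p) \<partial>N u \<omega>) * (\<integral>\<^sup>+p. ennreal (fst p) * \<phi> (snd p) \<partial>N u \<omega>) \<partial>M)"
    using sets_jumps[OF u] by (intro nn_integral_cong) (simp add: nn_integral_jump_measure)
  also note second_moment_integral
  finally show ?thesis using u \<theta> by (simp add: jump_mean_intensity jump_second_intensity add.commute)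
qed

lemma jump_part_variance:
  assumes u: "0 < u" and [measurable]: "v \<in> borel_measurable borel"
    and int: "integrable H v" "integrable H (\<lambda>x. (v x)\<^sup>2)" and nonneg: "\<And>x. 0 \<le> v x"
  shows "(\<integral>\<^sup>+\<omega>. ennreal ((enn2real (\<integral>\<^sup>+x. ennreal (v x) \<partial>jump_measure (N u \<omega>)) - a * (u + \<theta>) powr (\<sigma> - 1) * (\<integral>x. v x \<partial>H))\<^sup>2) \<partial>M)
    = ennreal (a * (1 - \<sigma>) * (u + \<theta>) powr (\<sigma> - 2) * (\<integral>x. (v x)\<^sup>2 \<partial>H))"
proof (rule M.nn_integral_variance)
  have 1: "(\<integral>\<^sup>+x. ennreal (v x) \<partial>H) = ennreal (\<integral>x. v x \<partial>H)"
    using int nonneg by (intro nn_integral_eq_integral) auto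
  have 2: "(\<integral>\<^sup>+x. ennreal (v x) * ennreal (v x) \<partial>H) = ennreal (\<integral>x. (v x)\<^sup>2 \<partial>H)"
    using int nonneg by (subst nn_integral_eq_integral[symmetric]) (auto simp: power2_eq_square ennreal_mult')
  have nn: "0 \<le> (\<integral>x. v x \<partial>H)" using nonneg by simp
  show "(\<lambda>\<omega>. \<integral>\<^sup>+x. ennreal (v x) \<partial>jump_measure (N u \<omega>)) \<in> borel_measurable M"
    by (rule measurable_compose[OF measurable_jumps[OF u] nn_integral_jump_measurable]) measurable
  show "(\<integral>\<^sup>+\<omega>. (\<integral>\<^sup>+x. ennreal (v x) \<partial>jump_measure (N u \<omega>)) \<partial>M) = ennreal (a * (u + \<theta>) powr (\<sigma> - 1) * (\<integral>x. v x \<partial>H))"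
    using a by (subst jump_mean[OF u]) (auto simp: 1 ennreal_mult')
  show "0 \<le> a * (u + \<theta>) powr (\<sigma> - 1) * (\<integral>x. v x \<partial>H)" using a nn by simp
  show "(\<integral>\<^sup>+\<omega>. (\<integral>\<^sup>+x. ennreal (v x) \<partial>jump_measure (N u \<omega>)) * (\<integral>\<^sup>+x. ennreal (v x) \<partial>jump_measure (N u \<omega>)) \<partial>M)
    = ennreal (a * (1 - \<sigma>) * (u + \<theta>) powr (\<sigma> - 2) * (\<integral>x. (v x)\<^sup>2 \<partial>H))
     + ennreal (a * (u + \<theta>) powr (\<sigma> - 1) * (\<integral>x. v x \<partial>H)) * ennreal (a * (u + \<theta>) powr (\<sigma> - 1) * (\<integral>x. v x \<partial>H))"
    using a \<sigma> by (subst jump_second_moment[OF u]) (auto simp: 1 2 ennreal_mult')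
  show "0 \<le> a * (1 - \<sigma>) * (u + \<theta>) powr (\<sigma> - 2) * (\<integral>x. (v x)\<^sup>2 \<partial>H)" using a \<sigma> by simp
qed

text \<open>Second moments are available for nonnegative integrands only, so positive and negative
  part are treated separately and joined by (x - y)^2 \<le> 2 x^2 + 2 y^2. The price is a factor 2;
  only the order V^(\<sigma> - 2) matters in what follows.\<close>

lemma jump_integral_variance:
  assumes u: "0 < u" and [measurable]: "w \<in> borel_measurable borel" and int: "integrable H (\<lambda>x. (w x)\<^sup>2)"
  shows "(\<integral>\<^sup>+\<omega>. ennreal ((jump_integral w (N u \<omega>) - a * (u + \<theta>) powr (\<sigma> - 1) * (\<integral>x. w x \<partial>H))\<^sup>2) \<partial>M)
    \<le> ennreal (2 * (a * (u + \<theta>) powr (\<sigma> - 2)) * (\<integral>x. (w x)\<^sup>2 \<partial>H))"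
proof -
  let ?p = "\<lambda>x. max 0 (w x)" and ?m = "\<lambda>x. max 0 (- w x)"
  let ?c = "a * (u + \<theta>) powr (\<sigma> - 1)" and ?C = "a * (1 - \<sigma>) * (u + \<theta>) powr (\<sigma> - 2)"
  define X where "X v \<omega> = enn2real (\<integral>\<^sup>+x. ennreal (v x) \<partial>jump_measure (N u \<omega>))" for v :: "'a \<Rightarrow> real" and \<omega>
  have X [measurable]: "X v \<in> borel_measurable M" if "v \<in> borel_measurable borel" for v
    unfolding X_def using that
    by (intro borel_measurable_enn2real measurable_compose[OF measurable_jumps[OF u] nn_integral_jump_measurable]) measurable
  have wi: "integrable H w"
    by (rule H.square_integrable_imp_integrable[OF _ int]) measurable
  have pi: "integrable H ?p" "integrable H ?m" using wi by auto
  have p2: "integrable H (\<lambda>x. (?p x)\<^sup>2)" "integrable H (\<lambda>x. (?m x)\<^sup>2)"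
    by (rule Bochner_Integration.integrable_bound[OF int]; auto simp: max_def)+
  have Hw: "(\<integral>x. w x \<partial>H) = (\<integral>x. ?p x \<partial>H) - (\<integral>x. ?m x \<partial>H)"
  proof -
    have "(\<integral>x. w x \<partial>H) = (\<integral>x. ?p x - ?m x \<partial>H)"
      by (intro Bochner_Integration.integral_cong refl) (simp add: max_def)
    then show ?thesis using Bochner_Integration.integral_diff[OF pi] by simp
  qed
  have Hw2: "(\<integral>x. (w x)\<^sup>2 \<partial>H) = (\<integral>x. (?p x)\<^sup>2 \<partial>H) + (\<integral>x. (?m x)\<^sup>2 \<partial>H)"
  proof -
    have "(\<integral>x. (w x)\<^sup>2 \<partial>H) = (\<integral>x. (?p x)\<^sup>2 + (?m x)\<^sup>2 \<partial>H)"
      by (intro Bochner_Integration.integral_cong refl) (simp add: max_def)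
    then show ?thesis using Bochner_Integration.integral_add[OF p2] by simp
  qed
  have J: "jump_integral w (N u \<omega>) = X ?p \<omega> - X ?m \<omega>" for \<omega>
  proof -
    have "ennreal (max 0 r) = ennreal r" for r by (cases "0 \<le> r") (simp_all add: ennreal_neg)
    then show ?thesis unfolding jump_integral_def X_def by simp
  qed
  have sq: "(x - y)\<^sup>2 \<le> 2 * x\<^sup>2 + 2 * y\<^sup>2" for x y :: real
    using zero_le_power2[of "x + y"] by (simp add: power2_eq_square algebra_simps)
  have two: "ennreal r \<le> ennreal 2 * ennreal x + ennreal 2 * ennreal y" if "r \<le> 2 * x + 2 * y" "0 \<le> x" "0 \<le> y" for r x y
  proof -
    have "ennreal r \<le> ennreal (2 * x + 2 * y)" using that by (intro ennreal_leI)
    also have "\<dots> = ennreal 2 * ennreal x + ennreal 2 * ennreal y"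
      using that by (subst ennreal_plus) (simp_all add: ennreal_mult')
    finally show ?thesis .
  qed
  have "(\<integral>\<^sup>+\<omega>. ennreal ((jump_integral w (N u \<omega>) - ?c * (\<integral>x. w x \<partial>H))\<^sup>2) \<partial>M)
    \<le> (\<integral>\<^sup>+\<omega>. ennreal 2 * ennreal ((X ?p \<omega> - ?c * (\<integral>x. ?p x \<partial>H))\<^sup>2) + ennreal 2 * ennreal ((X ?m \<omega> - ?c * (\<integral>x. ?m x \<partial>H))\<^sup>2) \<partial>M)"
  proof (intro nn_integral_mono)
    fix \<omega>
    have "(jump_integral w (N u \<omega>) - ?c * (\<integral>x. w x \<partial>H))\<^sup>2
      = ((X ?p \<omega> - ?c * (\<integral>x. ?p x \<partial>H)) - (X ?m \<omega> - ?c * (\<integral>x. ?m x \<partial>H)))\<^sup>2"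
      unfolding J Hw by (simp add: algebra_simps)
    also note sq
    finally show "ennreal ((jump_integral w (N u \<omega>) - ?c * (\<integral>x. w x \<partial>H))\<^sup>2) \<le> ennreal 2 * ennreal ((X ?p \<omega> - ?c * (\<integral>x. ?p x \<partial>H))\<^sup>2) + ennreal 2 * ennreal ((X ?m \<omega> - ?c * (\<integral>x. ?m x \<partial>H))\<^sup>2)"
      by (intro two) auto
  qed
  also have "\<dots> = ennreal 2 * (\<integral>\<^sup>+\<omega>. ennreal ((X ?p \<omega> - ?c * (\<integral>x. ?p x \<partial>H))\<^sup>2) \<partial>M) + ennreal 2 * (\<integral>\<^sup>+\<omega>. ennreal ((X ?m \<omega> - ?c * (\<integral>x. ?m x \<partial>H))\<^sup>2) \<partial>M)"
    by (subst nn_integral_add) (auto simp: nn_integral_cmult)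
  also have "\<dots> = ennreal 2 * ennreal (?C * (\<integral>x. (?p x)\<^sup>2 \<partial>H)) + ennreal 2 * ennreal (?C * (\<integral>x. (?m x)\<^sup>2 \<partial>H))"
  proof -
    have "(\<integral>\<^sup>+\<omega>. ennreal ((X ?p \<omega> - ?c * (\<integral>x. ?p x \<partial>H))\<^sup>2) \<partial>M) = ennreal (?C * (\<integral>x. (?p x)\<^sup>2 \<partial>H))"
      unfolding X_def by (rule jump_part_variance[OF u _ pi(1) p2(1)]) auto
    moreover have "(\<integral>\<^sup>+\<omega>. ennreal ((X ?m \<omega> - ?c * (\<integral>x. ?m x \<partial>H))\<^sup>2) \<partial>M) = ennreal (?C * (\<integral>x. (?m x)\<^sup>2 \<partial>H))"
      unfolding X_def by (rule jump_part_variance[OF u _ pi(2) p2(2)]) auto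
    ultimately show ?thesis by simp
  qed
  also have "\<dots> = ennreal (2 * ?C * (\<integral>x. (w x)\<^sup>2 \<partial>H))"
  proof -
    have "0 \<le> ?C" using a \<sigma> by simp
    then have nn: "0 \<le> ?C * (\<integral>x. (?p x)\<^sup>2 \<partial>H)" "0 \<le> ?C * (\<integral>x. (?m x)\<^sup>2 \<partial>H)" by (auto intro!: mult_nonneg_nonneg)
    have "ennreal 2 * ennreal (?C * (\<integral>x. (?p x)\<^sup>2 \<partial>H)) + ennreal 2 * ennreal (?C * (\<integral>x. (?m x)\<^sup>2 \<partial>H))
      = ennreal (2 * (?C * (\<integral>x. (?p x)\<^sup>2 \<partial>H)) + 2 * (?C * (\<integral>x. (?m x)\<^sup>2 \<partial>H)))"
      using nn by (subst ennreal_plus) (auto simp: ennreal_mult')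
    then show ?thesis unfolding Hw2 by (simp add: algebra_simps)
  qed
  also have "\<dots> \<le> ennreal (2 * (a * (u + \<theta>) powr (\<sigma> - 2)) * (\<integral>x. (w x)\<^sup>2 \<partial>H))"
  proof -
    have "?C \<le> a * (u + \<theta>) powr (\<sigma> - 2)" using a \<sigma> by (intro mult_right_mono) (auto simp: mult_left_le)
    then have "2 * ?C \<le> 2 * (a * (u + \<theta>) powr (\<sigma> - 2))" by linarith
    then show ?thesis by (intro ennreal_leI mult_right_mono) simp_all
  qed
  finally show ?thesis .
qed

end

lemma distr_pair_snd:
  assumes "prob_space A" "prob_space B"
  shows "distr (A \<Otimes>\<^sub>M B) B snd = B"
proof (rule measure_eqI)
  interpret A: prob_space A by fact
  interpret B: prob_space B by fact
  fix S assume "S \<in> sets (distr (A \<Otimes>\<^sub>M B) B snd)"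
  then have S: "S \<in> sets B" by simp
  then have "emeasure (distr (A \<Otimes>\<^sub>M B) B snd) S = emeasure (A \<Otimes>\<^sub>M B) (space A \<times> S)"
    by (auto simp: emeasure_distr space_pair_measure dest: sets.sets_into_space intro!: arg_cong2[where f = emeasure])
  also have "\<dots> = emeasure B S"
    using S by (simp add: B.emeasure_pair_measure_Times A.emeasure_space_1)
  finally show "emeasure (distr (A \<Otimes>\<^sub>M B) B snd) S = emeasure B S" .
qed simp

section \<open>The posterior as a mixture over the latent variable\<close>

context nggp
begin

lemmas [measurable] = measurable_jumps

text \<open>The conditional law of jumps and atom weights given the latent variable, on a canonical
  space where the family in \<open>u\<close> is a kernel. The index type is arbitrary: atoms are
  indexed by their values in the posterior, but by sample positions when measurability in the sample
  is at stake.\<close>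

definition posterior_kernel :: "'i set \<Rightarrow> ('i \<Rightarrow> real) \<Rightarrow> real \<Rightarrow> ((real \<times> 'a) measure \<times> ('i \<Rightarrow> real)) measure" where
  "posterior_kernel D p u = distr M jump_algebra (N u) \<Otimes>\<^sub>M (\<Pi>\<^sub>M i\<in>D. gamma_law (p i) (u + \<theta>))"

abbreviation posterior_space :: "'i set \<Rightarrow> ((real \<times> 'a) measure \<times> ('i \<Rightarrow> real)) measure" where
  "posterior_space D \<equiv> jump_algebra \<Otimes>\<^sub>M (\<Pi>\<^sub>M i\<in>D. borel)"

text \<open>The coefficients \<open>v\<close> of the atoms are separate from \<open>w\<close>,
  because after reindexing by sample positions they are what varies with the sample while
  \<open>w\<close> stays fixed.\<close>

definition le_event :: "'i set \<Rightarrow> ('a \<Rightarrow> real) \<Rightarrow> ('i \<Rightarrow> real) \<Rightarrow> ((real \<times> 'a) measure \<times> ('i \<Rightarrow> real)) set" where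
  "le_event D w v = {z \<in> space (posterior_space D). jump_integral w (fst z) + (\<Sum>i\<in>D. snd z i * v i) \<le> 0}"

lemma le_event_sets [measurable]:
  assumes [measurable]: "w \<in> borel_measurable borel"
  shows "le_event D w v \<in> sets (posterior_space D)"
  unfolding le_event_def by measurable

lemma prob_space_distr_N: "0 < u \<Longrightarrow> prob_space (distr M jump_algebra (N u))"
  by (intro M.prob_space_distr) measurable

lemma prob_space_gammas: "0 < u \<Longrightarrow> (\<And>i. i \<in> D \<Longrightarrow> 0 < p i) \<Longrightarrow> prob_space (\<Pi>\<^sub>M i\<in>D. gamma_law (p i) (u + \<theta>))"
  using \<theta> by (intro prob_space_PiM prob_space_gamma_law) auto

lemma sets_gammas [measurable_cong]: "sets (\<Pi>\<^sub>M i\<in>D. gamma_law (p i) r) = sets (\<Pi>\<^sub>M i\<in>D. borel)"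
  by (intro sets_PiM_cong) auto

lemma sets_posterior_kernel: "sets (posterior_kernel D p u) = sets (posterior_space D)"
  unfolding posterior_kernel_def by (intro sets_pair_measure_cong sets_gammas) simp

lemma prob_space_posterior_kernel:
  "0 < u \<Longrightarrow> (\<And>i. i \<in> D \<Longrightarrow> 0 < p i) \<Longrightarrow> prob_space (posterior_kernel D p u)"
  unfolding posterior_kernel_def by (intro prob_space_pair prob_space_distr_N prob_space_gammas)

lemma posterior_kernel_measurable:
  assumes "finite D" "\<And>i. i \<in> D \<Longrightarrow> 0 < p i"
  shows "posterior_kernel D p \<in> R \<rightarrow>\<^sub>M prob_algebra (posterior_space D)"
  unfolding posterior_kernel_def[abs_def]
proof (rule measurable_pair_prob)
  show "(\<lambda>u. distr M jump_algebra (N u)) \<in> R \<rightarrow>\<^sub>M prob_algebra jump_algebra"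
  proof (rule prm_kernel)
    show "poisson_random_measure M (N u) (nggp_intensity a \<sigma> (\<theta> + u) H)" if "u \<in> space R" for u
      using that N by simp
    show "sets (nggp_intensity a \<sigma> (\<theta> + u) H) = sets (borel \<Otimes>\<^sub>M borel)" for u by (rule sets_nggp_intensity)
    show "(\<lambda>u. emeasure (nggp_intensity a \<sigma> (\<theta> + u) H) A) \<in> borel_measurable R" if "A \<in> sets (borel \<Otimes>\<^sub>M borel)" for A
      using emeasure_nggp_intensity_measurable[OF that] by (intro measurable_restrict_space1) simp
  qed
  show "(\<lambda>u. \<Pi>\<^sub>M i\<in>D. gamma_law (p i) (u + \<theta>)) \<in> R \<rightarrow>\<^sub>M prob_algebra (\<Pi>\<^sub>M i\<in>D. borel)"
    using assms \<theta> by (intro measurable_PiM_kernel gamma_kernel_measurable) auto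
qed

text \<open>Trades the probability space \<open>M\<close>, on which nothing is known jointly in
  \<open>u\<close>, for the law of \<open>N u\<close>.\<close>

lemma distr_posterior_kernel:
  fixes D :: "'a set"
  assumes u: "0 < u" and D: "finite D" "\<And>i. i \<in> D \<Longrightarrow> 0 < p i"
  shows "distr (M \<Otimes>\<^sub>M (\<Pi>\<^sub>M y\<in>D. gamma_law (p y) (u + \<theta>))) (prob_algebra borel)
      (\<lambda>(\<omega>, J). normalize_measure (add_atoms (jump_measure (N u \<omega>)) D J))
    = distr (posterior_kernel D p u) (prob_algebra borel)
      (\<lambda>(Q, J). normalize_measure (add_atoms (jump_measure Q) D J))"
proof -
  let ?G = "\<Pi>\<^sub>M y\<in>D. gamma_law (p y) (u + \<theta>)"
  have id: "distr ?G (\<Pi>\<^sub>M y\<in>D. borel) (\<lambda>x. x) = ?G" by (rule distr_id2) (rule sets_gammas[symmetric])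
  have "posterior_kernel D p u = distr M jump_algebra (N u) \<Otimes>\<^sub>M distr ?G (\<Pi>\<^sub>M y\<in>D. borel) (\<lambda>x. x)"
    by (simp only: posterior_kernel_def id)
  also have "\<dots> = distr (M \<Otimes>\<^sub>M ?G) (posterior_space D) (\<lambda>(\<omega>, J). (N u \<omega>, J))"
  proof (rule pair_measure_distr)
    have "prob_space ?G" by (rule prob_space_gammas[OF u D(2)])
    then show "sigma_finite_measure (distr ?G (\<Pi>\<^sub>M y\<in>D. borel) (\<lambda>x. x))"
      unfolding id by (rule prob_space_imp_sigma_finite)
  qed (use u in measurable)
  finally have eq: "posterior_kernel D p u = distr (M \<Otimes>\<^sub>M ?G) (posterior_space D) (\<lambda>(\<omega>, J). (N u \<omega>, J))" .
  have mN: "(\<lambda>(\<omega>, J). (N u \<omega>, J)) \<in> M \<Otimes>\<^sub>M ?G \<rightarrow>\<^sub>M posterior_space D" using u by measurable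
  let ?\<Psi> = "\<lambda>(Q, J). normalize_measure (add_atoms (jump_measure Q) D J)"
  have "distr (posterior_kernel D p u) (prob_algebra borel) ?\<Psi> = distr (M \<Otimes>\<^sub>M ?G) (prob_algebra borel) (?\<Psi> \<circ> (\<lambda>(\<omega>, J). (N u \<omega>, J)))"
    unfolding eq by (rule distr_distr[OF normalize_add_atoms_measurable[OF D(1)] mN])
  also have "?\<Psi> \<circ> (\<lambda>(\<omega>, J). (N u \<omega>, J)) = (\<lambda>(\<omega>, J). normalize_measure (add_atoms (jump_measure (N u \<omega>)) D J))"
    by (auto simp: fun_eq_iff)
  finally show ?thesis by (rule sym)
qed

lemma latent_law_space: "latent_law a \<sigma> \<theta> n k \<in> space (prob_algebra R)"
  using prob_space_latent_law sets_latent_law by (simp add: space_prob_algebra)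

lemma multiplicity_pos: "y \<in> distinct_values n X \<Longrightarrow> 0 < real (multiplicity_in n X y) - \<sigma>"
proof -
  assume "y \<in> distinct_values n X"
  then have "{i. i < n \<and> X i = y} \<noteq> {}" by (auto simp: distinct_values_def)
  then have "1 \<le> multiplicity_in n X y" by (simp add: multiplicity_in_def Suc_le_eq card_gt_0_iff)
  then show ?thesis using \<sigma> by simp
qed

lemma finite_distinct_values [simp]: "finite (distinct_values n X)"
  by (simp add: distinct_values_def)

lemma distinct_values_nonempty: "0 < n \<Longrightarrow> distinct_values n X \<noteq> {}"
  by (auto simp: distinct_values_def)

abbreviation "mult_shape n X y \<equiv> real (multiplicity_in n X y) - \<sigma>"

lemma nggp_posterior_eq:
  fixes n :: nat and X :: "nat \<Rightarrow> 'a"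
  defines "D \<equiv> distinct_values n X"
  shows "nggp_posterior M N a \<sigma> \<theta> n X = latent_law a \<sigma> \<theta> n (card D) \<bind>
    (\<lambda>u. distr (posterior_kernel D (mult_shape n X) u) (prob_algebra borel)
      (\<lambda>(Q, J). normalize_measure (add_atoms (jump_measure Q) D J)))"
  unfolding nggp_posterior_def D_def
  by (intro bind_cong refl distr_posterior_kernel)
     (use multiplicity_pos[of _ n X] in \<open>auto simp: space_latent_law\<close>)

lemma posterior_kernel_distr_measurable:
  fixes n :: nat and X :: "nat \<Rightarrow> 'a"
  defines "D \<equiv> distinct_values n X"
  shows "(\<lambda>u. distr (posterior_kernel D (mult_shape n X) u) (prob_algebra borel)
      (\<lambda>(Q, J). normalize_measure (add_atoms (jump_measure Q) D J))) \<in> R \<rightarrow>\<^sub>M prob_algebra (prob_algebra borel)"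
proof (rule measurable_compose[OF _ measurable_distr_prob_space])
  show "posterior_kernel D (mult_shape n X) \<in> R \<rightarrow>\<^sub>M prob_algebra (posterior_space D)"
    unfolding D_def by (intro posterior_kernel_measurable multiplicity_pos) simp_all
  show "(\<lambda>(Q, J). normalize_measure (add_atoms (jump_measure Q) D J)) \<in> posterior_space D \<rightarrow>\<^sub>M prob_algebra borel"
    unfolding D_def by (intro normalize_add_atoms_measurable) simp
qed

lemma nggp_posterior_space: "nggp_posterior M N a \<sigma> \<theta> n X \<in> space (prob_algebra (prob_algebra borel))"
  unfolding nggp_posterior_eq
  using prob_space_bind'[OF latent_law_space posterior_kernel_distr_measurable]
    sets_bind'[OF latent_law_space posterior_kernel_distr_measurable]
  by (simp add: space_prob_algebra)

lemma integral_measurable_prob_algebra: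
  fixes f :: "'a \<Rightarrow> real"
  assumes [measurable]: "f \<in> borel_measurable borel"
  shows "(\<lambda>P. \<integral>y. f y \<partial>P) \<in> borel_measurable (prob_algebra borel)"
proof -
  have "(\<lambda>P. \<integral>y. f y \<partial>P) \<in> borel_measurable (subprob_algebra borel)" by measurable
  then show ?thesis unfolding prob_algebra_def by (rule measurable_restrict_space1)
qed

definition mean_law :: "nat \<Rightarrow> (nat \<Rightarrow> 'a) \<Rightarrow> ('a \<Rightarrow> real) \<Rightarrow> real measure" where
  "mean_law n X f = distr (nggp_posterior M N a \<sigma> \<theta> n X) borel (\<lambda>P. \<integral>y. f y \<partial>P)"

lemma real_distribution_mean_law:
  assumes [measurable]: "f \<in> borel_measurable borel"
  shows "real_distribution (mean_law n X f)"
proof -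
  have s: "sets (nggp_posterior M N a \<sigma> \<theta> n X) = sets (prob_algebra borel)"
    and "prob_space (nggp_posterior M N a \<sigma> \<theta> n X)"
    using nggp_posterior_space by (auto simp: space_prob_algebra)
  then interpret prob_space "nggp_posterior M N a \<sigma> \<theta> n X" by simp
  have "(\<lambda>P. \<integral>y. f y \<partial>P) \<in> borel_measurable (nggp_posterior M N a \<sigma> \<theta> n X)"
    using integral_measurable_prob_algebra[OF assms] s by (simp cong: measurable_cong_sets)
  then show ?thesis unfolding mean_law_def by (rule real_distribution_distr)
qed

lemma AE_jump_finite:
  assumes u: "0 < u" and [measurable]: "\<phi> \<in> borel_measurable borel" and fin: "(\<integral>\<^sup>+x. \<phi> x \<partial>H) < \<infinity>"
  shows "AE Q in distr M jump_algebra (N u). (\<integral>\<^sup>+x. \<phi> x \<partial>jump_measure Q) < \<infinity>"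
proof -
  have m: "(\<lambda>Q. \<integral>\<^sup>+x. \<phi> x \<partial>jump_measure Q) \<in> borel_measurable jump_algebra"
    by (rule nn_integral_jump_measurable) measurable
  have "(\<integral>\<^sup>+Q. (\<integral>\<^sup>+x. \<phi> x \<partial>jump_measure Q) \<partial>distr M jump_algebra (N u)) = (\<integral>\<^sup>+\<omega>. (\<integral>\<^sup>+x. \<phi> x \<partial>jump_measure (N u \<omega>)) \<partial>M)"
    using m measurable_jumps[OF u] by (intro nn_integral_distr) auto
  also have "\<dots> \<noteq> \<infinity>" using fin by (simp add: jump_mean[OF u] ennreal_mult_eq_top_iff less_top)
  finally have "AE Q in distr M jump_algebra (N u). (\<integral>\<^sup>+x. \<phi> x \<partial>jump_measure Q) \<noteq> \<infinity>"
    using m by (intro nn_integral_noteq_infinite) auto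
  then show ?thesis by (auto simp: less_top)
qed

text \<open>Given the latent variable, the event that the mean is at most \<open>x\<close> coincides
  almost surely with the linear event: by the Campbell mean formula the jump measure almost surely
  has finite mass and integrates |f|, and gamma weights are almost surely positive.\<close>

lemma mean_law_le:
  fixes n :: nat and X :: "nat \<Rightarrow> 'a"
  defines "D \<equiv> distinct_values n X"
  assumes n: "0 < n" and f [measurable]: "f \<in> borel_measurable borel" and int: "integrable H f"
  shows "emeasure (mean_law n X f) {..x} = (\<integral>\<^sup>+u. emeasure (posterior_kernel D (mult_shape n X) u)
    (le_event D (\<lambda>y. f y - x) (\<lambda>y. f y - x)) \<partial>latent_law a \<sigma> \<theta> n (card D))"
proof -
  define B where "B = {P \<in> space (prob_algebra (borel :: 'a measure)). (\<integral>y. f y \<partial>P) \<le> x}"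
  have m: "(\<lambda>P. \<integral>y. f y \<partial>P) \<in> borel_measurable (prob_algebra borel)"
    by (rule integral_measurable_prob_algebra) measurable
  have B: "B \<in> sets (prob_algebra borel)" unfolding B_def using m by measurable
  let ?\<Psi> = "\<lambda>(Q, J). normalize_measure (add_atoms (jump_measure Q) D J)"
  have \<Psi>: "?\<Psi> \<in> posterior_space D \<rightarrow>\<^sub>M prob_algebra borel"
    unfolding D_def by (intro normalize_add_atoms_measurable) simp
  have s: "sets (nggp_posterior M N a \<sigma> \<theta> n X) = sets (prob_algebra borel)"
    using nggp_posterior_space by (auto simp: space_prob_algebra)
  have "emeasure (mean_law n X f) {..x} = emeasure (nggp_posterior M N a \<sigma> \<theta> n X) B"
    unfolding mean_law_def using m s sets_eq_imp_space_eq[OF s]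
    by (subst emeasure_distr) (auto simp: B_def vimage_def Int_def conj_commute cong: measurable_cong_sets)
  also have "\<dots> = (\<integral>\<^sup>+u. emeasure (distr (posterior_kernel D (mult_shape n X) u) (prob_algebra borel) ?\<Psi>) B \<partial>latent_law a \<sigma> \<theta> n (card D))"
    unfolding nggp_posterior_eq D_def
    by (rule emeasure_bind_prob_algebra[OF latent_law_space posterior_kernel_distr_measurable B])
  also have "\<dots> = (\<integral>\<^sup>+u. emeasure (posterior_kernel D (mult_shape n X) u)
    (le_event D (\<lambda>y. f y - x) (\<lambda>y. f y - x)) \<partial>latent_law a \<sigma> \<theta> n (card D))"
  proof (rule nn_integral_cong)
    fix u assume "u \<in> space (latent_law a \<sigma> \<theta> n (card D))"
    then have u: "0 < u" by (simp add: space_latent_law)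
    let ?G = "\<Pi>\<^sub>M y\<in>D. gamma_law (mult_shape n X y) (u + \<theta>)" and ?L = "distr M jump_algebra (N u)"
    have pG: "prob_space ?G" using u unfolding D_def by (intro prob_space_gammas multiplicity_pos)
    have pL: "prob_space ?L" by (rule prob_space_distr_N[OF u])
    have p: "0 < mult_shape n X y" if "y \<in> D" for y using that multiplicity_pos by (simp add: D_def)
    let ?k = "posterior_kernel D (mult_shape n X) u"
    note sk = sets_posterior_kernel[of D "mult_shape n X" u]
    have fin: "(\<integral>\<^sup>+x. ennreal \<bar>f x\<bar> \<partial>H) < \<infinity>"
      using int by (auto simp: integrable_iff_bounded)
    have "AE Q in ?L. (\<integral>\<^sup>+x. ennreal \<bar>f x\<bar> \<partial>jump_measure Q) < \<infinity> \<and> (\<integral>\<^sup>+x. 1 \<partial>jump_measure Q) < \<infinity>"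
      using AE_jump_finite[OF u _ fin] AE_jump_finite[OF u, of "\<lambda>_. 1"]
      by (simp add: H.emeasure_space_1)
    then have 1: "AE z in ?k. (\<integral>\<^sup>+x. ennreal \<bar>f x\<bar> \<partial>jump_measure (fst z)) < \<infinity> \<and> (\<integral>\<^sup>+x. 1 \<partial>jump_measure (fst z)) < \<infinity>"
    proof -
      assume "AE Q in ?L. (\<integral>\<^sup>+x. ennreal \<bar>f x\<bar> \<partial>jump_measure Q) < \<infinity> \<and> (\<integral>\<^sup>+x. 1 \<partial>jump_measure Q) < \<infinity>"
      then have "AE Q in distr (?L \<Otimes>\<^sub>M ?G) ?L fst. (\<integral>\<^sup>+x. ennreal \<bar>f x\<bar> \<partial>jump_measure Q) < \<infinity> \<and> (\<integral>\<^sup>+x. 1 \<partial>jump_measure Q) < \<infinity>"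
        by (simp only: prob_space.distr_pair_fst[OF pG])
      then show ?thesis unfolding posterior_kernel_def by (rule AE_distrD[OF measurable_fst])
    qed
    have "AE J in ?G. \<forall>y\<in>D. 0 < J y"
    proof (rule AE_finite_allI)
      show "finite D" by (simp add: D_def)
      fix y assume y: "y \<in> D"
      show "AE J in ?G. 0 < J y"
        using y p u \<theta> AE_gamma_law_pos by (intro AE_PiM_component prob_space_gamma_law) auto
    qed
    then have 2: "AE z in ?k. \<forall>y\<in>D. 0 < snd z y"
    proof -
      assume "AE J in ?G. \<forall>y\<in>D. 0 < J y"
      then have "AE J in distr (?L \<Otimes>\<^sub>M ?G) ?G snd. \<forall>y\<in>D. 0 < J y"
        by (simp only: distr_pair_snd[OF pL pG])
      then show ?thesis unfolding posterior_kernel_def by (rule AE_distrD[OF measurable_snd])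
    qed
    have "emeasure (distr ?k (prob_algebra borel) ?\<Psi>) B = emeasure ?k (?\<Psi> -` B \<inter> space ?k)"
      using \<Psi> B sk by (intro emeasure_distr) (auto cong: measurable_cong_sets)
    also have "\<dots> = emeasure ?k (le_event D (\<lambda>y. f y - x) (\<lambda>y. f y - x))"
    proof (rule emeasure_eq_AE)
      show "AE z in ?k. z \<in> ?\<Psi> -` B \<inter> space ?k \<longleftrightarrow> z \<in> le_event D (\<lambda>y. f y - x) (\<lambda>y. f y - x)"
        using 1 2 AE_space
      proof eventually_elim
        case (elim z)
        obtain Q J where z: "z = (Q, J)" by (cases z)
        have sp: "z \<in> space (posterior_space D)" using elim(3) sets_eq_imp_space_eq[OF sk] by simp
        then have "?\<Psi> z \<in> space (prob_algebra borel)" by (rule measurable_space[OF \<Psi>])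
        then have "z \<in> ?\<Psi> -` B \<inter> space ?k \<longleftrightarrow> (\<integral>y. f y \<partial>normalize_measure (add_atoms (jump_measure Q) D J)) \<le> x"
          using elim(3) by (simp add: B_def z)
        also have "\<dots> \<longleftrightarrow> jump_integral (\<lambda>y. f y - x) Q + (\<Sum>y\<in>D. J y * (f y - x)) \<le> 0"
          using elim(1,2) distinct_values_nonempty[OF n] by (intro integral_normalize_le_iff) (auto simp: z D_def)
        finally show ?case using sp by (simp add: le_event_def z)
      qed
      show "?\<Psi> -` B \<inter> space ?k \<in> sets ?k"
        using measurable_sets[OF \<Psi> B] sk sets_eq_imp_space_eq[OF sk] by simp
      show "le_event D (\<lambda>y. f y - x) (\<lambda>y. f y - x) \<in> sets ?k" using sk by simp
    qed
    finally show "emeasure (distr ?k (prob_algebra borel) ?\<Psi>) B = emeasure ?k (le_event D (\<lambda>y. f y - x) (\<lambda>y. f y - x))" .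
  qed
  finally show ?thesis .
qed

section \<open>Comparison of the posterior with a centred gamma sum\<close>

definition gamma_sum_law :: "'i set \<Rightarrow> ('i \<Rightarrow> real) \<Rightarrow> ('i \<Rightarrow> real) \<Rightarrow> real measure" where
  "gamma_sum_law D p v = distr (\<Pi>\<^sub>M y\<in>D. gamma_law (p y) 1) borel (\<lambda>G. \<Sum>y\<in>D. (G y - p y) * v y)"

text \<open>Multiplied by \<open>u + \<theta>\<close>, the atom weights become independent with rate
  1, so the right-hand side is the same for every \<open>u\<close> and survives the averaging over
  the latent variable unchanged.\<close>

lemma emeasure_gamma_sum:
  assumes u: "0 < u" and D: "finite D" "\<And>y. y \<in> D \<Longrightarrow> 0 < p y"
  shows "emeasure (posterior_kernel D p u) {z \<in> space (posterior_space D). (\<Sum>y\<in>D. ((u + \<theta>) * snd z y - p y) * v y) \<le> c}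
    = emeasure (gamma_sum_law D p v) {..c}"
proof -
  let ?G = "\<Pi>\<^sub>M y\<in>D. gamma_law (p y) (u + \<theta>)" and ?L = "distr M jump_algebra (N u)"
  let ?G1 = "\<Pi>\<^sub>M y\<in>D. gamma_law (p y) 1"
  have V: "0 < u + \<theta>" using u \<theta> by simp
  have pG: "prob_space ?G" by (rule prob_space_gammas[OF u D(2)])
  have pL: "prob_space ?L" by (rule prob_space_distr_N[OF u])
  have "?G1 = (\<Pi>\<^sub>M y\<in>D. distr (gamma_law (p y) (u + \<theta>)) (gamma_law (p y) 1) ((*) (u + \<theta>)))"
  proof (intro PiM_cong refl)
    fix y assume y: "y \<in> D"
    have "distr (gamma_law (p y) (u + \<theta>)) (gamma_law (p y) 1) ((*) (u + \<theta>)) = distr (gamma_law (p y) (u + \<theta>)) borel ((*) (u + \<theta>))"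
      by (intro distr_cong) auto
    then show "gamma_law (p y) 1 = distr (gamma_law (p y) (u + \<theta>)) (gamma_law (p y) 1) ((*) (u + \<theta>))"
      using D(2)[OF y] V by (simp add: distr_gamma_law_scale)
  qed
  also have "\<dots> = distr ?G ?G1 (compose D ((*) (u + \<theta>)))"
    using D V by (intro distr_PiM_finite_prob_space'[symmetric] prob_space_gamma_law) auto
  finally have G1: "?G1 = distr ?G ?G1 (compose D ((*) (u + \<theta>)))" .
  have [measurable]: "(\<lambda>G. \<Sum>y\<in>D. (G y - p y) * v y) \<in> borel_measurable (\<Pi>\<^sub>M y\<in>D. borel)" by measurable
  have cm [measurable]: "compose D ((*) (u + \<theta>)) \<in> ?G \<rightarrow>\<^sub>M (\<Pi>\<^sub>M y\<in>D. borel)"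
    unfolding compose_def by measurable
  have "gamma_sum_law D p v = distr ?G borel (\<lambda>J. \<Sum>y\<in>D. ((u + \<theta>) * J y - p y) * v y)"
    unfolding gamma_sum_law_def by (subst G1, subst distr_distr) (auto simp: comp_def compose_def intro!: distr_cong sum.cong)
  then have "emeasure (gamma_sum_law D p v) {..c} = emeasure ?G {J \<in> space ?G. (\<Sum>y\<in>D. ((u + \<theta>) * J y - p y) * v y) \<le> c}"
    by (simp add: emeasure_distr vimage_def Int_def conj_commute)
  also have "\<dots> = emeasure (distr (?L \<Otimes>\<^sub>M ?G) ?G snd) {J \<in> space ?G. (\<Sum>y\<in>D. ((u + \<theta>) * J y - p y) * v y) \<le> c}"
    by (simp add: distr_pair_snd[OF pL pG])
  also have "\<dots> = emeasure (posterior_kernel D p u) {z \<in> space (posterior_space D). (\<Sum>y\<in>D. ((u + \<theta>) * snd z y - p y) * v y) \<le> c}"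
  proof -
    have "{J \<in> space ?G. (\<Sum>y\<in>D. ((u + \<theta>) * J y - p y) * v y) \<le> c} \<in> sets ?G" by measurable
    from emeasure_distr[OF measurable_snd this, of ?L] show ?thesis
      unfolding posterior_kernel_def
      by (auto simp: space_pair_measure space_PiM intro!: arg_cong2[where f = emeasure])
  qed
  finally show ?thesis ..
qed

text \<open>After multiplication by V = u + \<theta> the linear form is a fluctuation of the jump
  part, the error \<open>d * h\<close> made in replacing a V^\<sigma> by \<sigma> k, the centred
  gamma sum and the constant \<open>B\<close>. The first two are allowed \<epsilon> each, whence the
  shift by 2 \<epsilon>, and the two terms of \<open>c\<close> pay for their exceeding it. The
  factor V^2 raises the variance order V^(\<sigma> - 2) of the jump part to V^\<sigma>.\<close>

lemma kernel_le_event_bounds: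
  fixes D :: "'i set" and p v :: "'i \<Rightarrow> real" and w :: "'a \<Rightarrow> real" and u k \<epsilon> :: real
  assumes u: "0 < u" and D: "finite D" "\<And>y. y \<in> D \<Longrightarrow> 0 < p y"
    and w [measurable]: "w \<in> borel_measurable borel" and int: "integrable H (\<lambda>x. (w x)\<^sup>2)" and \<epsilon>: "0 < \<epsilon>"
  defines "h \<equiv> \<integral>x. w x \<partial>H" and "h2 \<equiv> \<integral>x. (w x)\<^sup>2 \<partial>H" and "d \<equiv> a * (u + \<theta>) powr \<sigma> - \<sigma> * k"
  defines "B \<equiv> \<sigma> * k * h + (\<Sum>y\<in>D. p y * v y)"
    and "c \<equiv> (2 * h2 * (a * (u + \<theta>) powr \<sigma>) + h\<^sup>2 * d\<^sup>2) / \<epsilon>\<^sup>2"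
  shows "emeasure (posterior_kernel D p u) (le_event D w v) \<le> emeasure (gamma_sum_law D p v) {..- B + 2 * \<epsilon>} + ennreal c"
    and "emeasure (gamma_sum_law D p v) {..- B - 2 * \<epsilon>} \<le> emeasure (posterior_kernel D p u) (le_event D w v) + ennreal c"
proof -
  let ?k = "posterior_kernel D p u" and ?L = "distr M jump_algebra (N u)"
  let ?G = "\<Pi>\<^sub>M y\<in>D. gamma_law (p y) (u + \<theta>)"
  define V where "V = u + \<theta>"
  have V: "0 < V" using u \<theta> by (simp add: V_def)
  have sk: "sets ?k = sets (posterior_space D)" by (rule sets_posterior_kernel)
  have spk: "space ?k = space (posterior_space D)" by (rule sets_eq_imp_space_eq[OF sk])
  interpret k: prob_space ?k using u D by (intro prob_space_posterior_kernel) auto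
  have pG: "prob_space ?G" by (rule prob_space_gammas[OF u D(2)])
  have h2: "0 \<le> h2" by (simp add: h2_def)
  have c0: "0 \<le> 2 * h2 * (a * V powr \<sigma>) / \<epsilon>\<^sup>2" "0 \<le> h\<^sup>2 * d\<^sup>2 / \<epsilon>\<^sup>2" using h2 a by auto
  have c_eq: "c = 2 * h2 * (a * V powr \<sigma>) / \<epsilon>\<^sup>2 + h\<^sup>2 * d\<^sup>2 / \<epsilon>\<^sup>2"
    by (simp add: c_def V_def add_divide_distrib)
  define S where "S = {Q \<in> space jump_algebra. \<epsilon> \<le> \<bar>V * jump_integral w Q - a * V powr \<sigma> * h\<bar>}"
  have S [measurable]: "S \<in> sets jump_algebra" unfolding S_def by measurable
  define E1 where "E1 = {z \<in> space (posterior_space D). \<epsilon> \<le> \<bar>V * jump_integral w (fst z) - a * V powr \<sigma> * h\<bar>}"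
  have E1 [measurable]: "E1 \<in> sets (posterior_space D)" unfolding E1_def by measurable
  define Z where "Z z = (\<Sum>y\<in>D. (V * snd z y - p y) * v y)" for z :: "(real \<times> 'a) measure \<times> ('i \<Rightarrow> real)"
  define Ez where "Ez r = {z \<in> space (posterior_space D). Z z \<le> r}" for r
  have Ez [measurable]: "Ez r \<in> sets (posterior_space D)" for r unfolding Ez_def Z_def by measurable
  have kEz: "emeasure ?k (Ez r) = emeasure (gamma_sum_law D p v) {..r}" for r
    using emeasure_gamma_sum[OF u D] by (simp add: Ez_def Z_def V_def)
  have kE1: "emeasure ?k E1 \<le> ennreal (2 * h2 * (a * V powr \<sigma>) / \<epsilon>\<^sup>2)"
  proof -
    have "emeasure ?k E1 = emeasure (distr (?L \<Otimes>\<^sub>M ?G) ?L fst) S"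
    proof (subst emeasure_distr)
      show "emeasure ?k E1 = emeasure (?L \<Otimes>\<^sub>M ?G) (fst -` S \<inter> space (?L \<Otimes>\<^sub>M ?G))"
        unfolding posterior_kernel_def
        by (rule arg_cong2[where f = emeasure]) (auto simp: E1_def S_def space_pair_measure space_PiM)
    qed auto
    also have "\<dots> = emeasure M (N u -` S \<inter> space M)"
      using u by (simp add: prob_space.distr_pair_fst[OF pG] emeasure_distr)
    also have "N u -` S \<inter> space M = {\<omega> \<in> space M. \<epsilon> \<le> \<bar>V * jump_integral w (N u \<omega>) - a * V powr \<sigma> * h\<bar>}"
      using measurable_space[OF measurable_jumps[OF u]] by (auto simp: S_def)
    also have "emeasure M \<dots> \<le> ennreal (1 / \<epsilon>\<^sup>2) * (\<integral>\<^sup>+\<omega>. ennreal ((V * jump_integral w (N u \<omega>) - a * V powr \<sigma> * h)\<^sup>2) \<partial>M)"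
      using u \<epsilon> by (intro Chebyshev_nn) measurable
    also have "(\<integral>\<^sup>+\<omega>. ennreal ((V * jump_integral w (N u \<omega>) - a * V powr \<sigma> * h)\<^sup>2) \<partial>M)
       = (\<integral>\<^sup>+\<omega>. ennreal (V\<^sup>2) * ennreal ((jump_integral w (N u \<omega>) - a * V powr (\<sigma> - 1) * h)\<^sup>2) \<partial>M)"
    proof (intro nn_integral_cong)
      fix \<omega>
      have "V * jump_integral w (N u \<omega>) - a * V powr \<sigma> * h = V * (jump_integral w (N u \<omega>) - a * V powr (\<sigma> - 1) * h)"
        using powr_mult_base[of V "\<sigma> - 1"] V by (simp add: right_diff_distrib mult_ac)
      then show "ennreal ((V * jump_integral w (N u \<omega>) - a * V powr \<sigma> * h)\<^sup>2) = ennreal (V\<^sup>2) * ennreal ((jump_integral w (N u \<omega>) - a * V powr (\<sigma> - 1) * h)\<^sup>2)"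
        by (simp add: power_mult_distrib ennreal_mult')
    qed
    also have "\<dots> = ennreal (V\<^sup>2) * (\<integral>\<^sup>+\<omega>. ennreal ((jump_integral w (N u \<omega>) - a * V powr (\<sigma> - 1) * h)\<^sup>2) \<partial>M)"
      using u by (intro nn_integral_cmult) measurable
    also have "\<dots> \<le> ennreal (V\<^sup>2) * ennreal (2 * (a * V powr (\<sigma> - 2)) * h2)"
      using jump_integral_variance[OF u w int] by (intro mult_left_mono) (auto simp: V_def h_def h2_def)
    also have "\<dots> = ennreal (2 * h2 * (a * V powr \<sigma>))"
    proof -
      have "V\<^sup>2 * V powr (\<sigma> - 2) = V powr \<sigma>"
        using V powr_realpow[of V 2] powr_add[of V 2 "\<sigma> - 2"] by simp
      then have "V\<^sup>2 * (2 * (a * V powr (\<sigma> - 2)) * h2) = 2 * h2 * (a * V powr \<sigma>)" by (simp add: mult_ac)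
      then show ?thesis by (simp only: ennreal_mult'[OF zero_le_power2, symmetric])
    qed
    finally have "emeasure ?k E1 \<le> ennreal (1 / \<epsilon>\<^sup>2) * ennreal (2 * h2 * (a * V powr \<sigma>))"
      by (simp add: mult_left_mono)
    then show ?thesis by (simp add: ennreal_mult'[symmetric])
  qed
  have ev: "le_event D w v \<in> sets ?k" using sk by simp
  have dV: "d = a * V powr \<sigma> - \<sigma> * k" by (simp add: d_def V_def)
  have decomp: "V * (jump_integral w (fst z) + (\<Sum>y\<in>D. snd z y * v y))
    = (V * jump_integral w (fst z) - a * V powr \<sigma> * h) + d * h + Z z + B" for z
    by (simp add: Z_def B_def dV algebra_simps sum_subtractf sum_distrib_left sum.distrib)
  have le_iff: "z \<in> le_event D w v \<longleftrightarrow> z \<in> space (posterior_space D) \<and>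
    (V * jump_integral w (fst z) - a * V powr \<sigma> * h) + d * h + Z z + B \<le> 0" for z
    unfolding decomp[symmetric] using V by (simp add: le_event_def mult_le_0_iff)
  show "emeasure ?k (le_event D w v) \<le> emeasure (gamma_sum_law D p v) {..- B + 2 * \<epsilon>} + ennreal c"
  \<comment> \<open>Given \<open>u\<close>, the number \<open>d * h\<close> is not random. If it is
    too large, the second term of \<open>c\<close> is at least 1 and the claim is trivial; this
    keeps the bound in a form that can be integrated over \<open>u\<close>.\<close>
  proof (cases "\<epsilon> \<le> \<bar>d * h\<bar>")
    case True
    then have "\<epsilon>\<^sup>2 \<le> (d * h)\<^sup>2" using \<epsilon> by (simp add: abs_le_square_iff[symmetric])
    then have "1 \<le> h\<^sup>2 * d\<^sup>2 / \<epsilon>\<^sup>2" using \<epsilon> by (simp add: power_mult_distrib field_simps)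
    then have "1 \<le> c" using c0 c_eq by linarith
    then have "emeasure ?k (le_event D w v) \<le> ennreal c"
      using k.emeasure_le_1 by (metis dual_order.trans ennreal_1 ennreal_leI)
    then show ?thesis by (simp add: add_increasing)
  next
    case False
    have "le_event D w v \<subseteq> Ez (- B + 2 * \<epsilon>) \<union> E1"
      unfolding Ez_def E1_def using False by (auto simp: le_iff)
    then have "emeasure ?k (le_event D w v) \<le> emeasure ?k (Ez (- B + 2 * \<epsilon>) \<union> E1)"
      using sk by (intro emeasure_mono) auto
    also have "\<dots> \<le> emeasure ?k (Ez (- B + 2 * \<epsilon>)) + emeasure ?k E1"
      using sk by (intro emeasure_subadditive) auto
    also have "\<dots> \<le> emeasure (gamma_sum_law D p v) {..- B + 2 * \<epsilon>} + ennreal c"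
      unfolding kEz using kE1 c0 c_eq by (intro add_mono order_refl order_trans[OF kE1] ennreal_leI) auto
    finally show ?thesis .
  qed
  show "emeasure (gamma_sum_law D p v) {..- B - 2 * \<epsilon>} \<le> emeasure ?k (le_event D w v) + ennreal c"
  proof (cases "\<epsilon> \<le> \<bar>d * h\<bar>")
    case True
    then have "\<epsilon>\<^sup>2 \<le> (d * h)\<^sup>2" using \<epsilon> by (simp add: abs_le_square_iff[symmetric])
    then have "1 \<le> h\<^sup>2 * d\<^sup>2 / \<epsilon>\<^sup>2" using \<epsilon> by (simp add: power_mult_distrib field_simps)
    then have "1 \<le> c" using c0 c_eq by linarith
    then have "emeasure ?k (Ez (- B - 2 * \<epsilon>)) \<le> ennreal c"
      using k.emeasure_le_1 by (metis dual_order.trans ennreal_1 ennreal_leI)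
    then show ?thesis unfolding kEz by (simp add: add_increasing)
  next
    case False
    have "Ez (- B - 2 * \<epsilon>) \<subseteq> le_event D w v \<union> E1"
      unfolding Ez_def E1_def using False by (auto simp: le_iff)
    then have "emeasure ?k (Ez (- B - 2 * \<epsilon>)) \<le> emeasure ?k (le_event D w v \<union> E1)"
      using sk by (intro emeasure_mono) auto
    also have "\<dots> \<le> emeasure ?k (le_event D w v) + emeasure ?k E1"
      using sk by (intro emeasure_subadditive) auto
    also have "\<dots> \<le> emeasure ?k (le_event D w v) + ennreal c"
      using kE1 c0 c_eq by (intro add_mono order_refl order_trans[OF kE1] ennreal_leI) auto
    finally show ?thesis unfolding kEz .
  qed
qed

lemma prob_space_gamma_sum_law:
  "(\<And>y. y \<in> D \<Longrightarrow> 0 < p y) \<Longrightarrow> real_distribution (gamma_sum_law D p v)"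
proof -
  assume p: "\<And>y. y \<in> D \<Longrightarrow> 0 < p y"
  interpret prob_space "\<Pi>\<^sub>M y\<in>D. gamma_law (p y) 1"
    using p by (intro prob_space_PiM prob_space_gamma_law) auto
  show ?thesis unfolding gamma_sum_law_def by (intro real_distribution_distr) measurable
qed

text \<open>The conditional bounds are averaged over the latent variable: the gamma term is constant
  in \<open>u\<close>, and \<open>\<rho>\<close> bounds the average of the Chebyshev cost through
  the two moment bounds for a V^\<sigma>. The parameters \<epsilon> and \<open>K\<close> stay free,
  since \<epsilon> will be of order \<surd>n and \<open>K\<close> is chosen at the very end.\<close>

lemma mean_law_cdf_bounds:
  fixes n :: nat and X :: "nat \<Rightarrow> 'a" and f :: "'a \<Rightarrow> real" and x \<epsilon> K :: real
  defines "D \<equiv> distinct_values n X"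
  assumes n: "3 \<le> n" and f [measurable]: "f \<in> borel_measurable borel"
    and int2: "integrable H (\<lambda>y. (f y - x)\<^sup>2)" and \<epsilon>: "0 < \<epsilon>" and K: "\<theta> \<le> K"
  defines "h \<equiv> \<integral>y. f y - x \<partial>H" and "h2 \<equiv> \<integral>y. (f y - x)\<^sup>2 \<partial>H"
  defines "B \<equiv> \<sigma> * real (card D) * h + (\<Sum>y\<in>D. mult_shape n X y * (f y - x))"
    and "\<rho> \<equiv> (2 * h2 * latent_bound n (card D) + h\<^sup>2 * ((\<sigma> + 2 * a * (2 * K) powr \<sigma>) * latent_bound n (card D)
       + 2 * a * \<theta> * real n * K powr (\<sigma> - 1))) / \<epsilon>\<^sup>2"
  shows "cdf (mean_law n X f) x \<le> cdf (gamma_sum_law D (mult_shape n X) (\<lambda>y. f y - x)) (- B + 2 * \<epsilon>) + \<rho>"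
    and "cdf (gamma_sum_law D (mult_shape n X) (\<lambda>y. f y - x)) (- B - 2 * \<epsilon>) \<le> cdf (mean_law n X f) x + \<rho>"
proof -
  let ?w = "\<lambda>y. f y - x" and ?p = "mult_shape n X" and ?l = "latent_law a \<sigma> \<theta> n (card D)"
  have D: "finite D" "\<And>y. y \<in> D \<Longrightarrow> 0 < ?p y" using multiplicity_pos by (auto simp: D_def)
  have intw: "integrable H ?w" by (rule H.square_integrable_imp_integrable[OF _ int2]) measurable
  then have "integrable H (\<lambda>y. ?w y + x)" by (intro Bochner_Integration.integrable_add) auto
  then have intf: "integrable H f" by simp
  interpret l: prob_space ?l by (rule prob_space_latent_law)
  interpret m: real_distribution "mean_law n X f" by (rule real_distribution_mean_law[OF f])
  interpret g: real_distribution "gamma_sum_law D ?p ?w" by (rule prob_space_gamma_sum_law[OF D(2)])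
  note sl = sets_latent_law[of n "card D"]
  define c where "c u = (2 * h2 * (a * (u + \<theta>) powr \<sigma>) + h\<^sup>2 * (a * (u + \<theta>) powr \<sigma> - \<sigma> * real (card D))\<^sup>2) / \<epsilon>\<^sup>2" for u
  have h2: "0 \<le> h2" by (simp add: h2_def)
  have E0: "0 \<le> latent_bound n (card D)" using a \<sigma> \<theta> by (simp add: latent_bound_def)
  have V0: "0 \<le> (\<sigma> + 2 * a * (2 * K) powr \<sigma>) * latent_bound n (card D) + 2 * a * \<theta> * real n * K powr (\<sigma> - 1)"
    using a \<sigma> \<theta> E0 by (intro add_nonneg_nonneg mult_nonneg_nonneg) auto
  have \<rho>0: "0 \<le> \<rho>" unfolding \<rho>_def using h2 E0 V0 by simp
  have lm: "g \<in> borel_measurable ?l" if "g \<in> borel_measurable borel" for g :: "real \<Rightarrow> ennreal"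
    using that by (subst measurable_cong_sets[OF sl refl]) (auto intro: measurable_restrict_space1)
  have cm: "(\<lambda>u. ennreal (c u)) \<in> borel_measurable ?l"
    unfolding c_def by (rule lm) measurable
  have el: "ennreal p * ennreal x + ennreal q * ennreal y = ennreal (p * x + q * y)"
    if "0 \<le> p" "0 \<le> x" "0 \<le> q" "0 \<le> y" for p q x y
    using that by (simp add: ennreal_mult)
  have ci: "(\<integral>\<^sup>+u. ennreal (c u) \<partial>?l) \<le> ennreal \<rho>"
  proof -
    have m1: "(\<lambda>u. ennreal (a * (u + \<theta>) powr \<sigma>)) \<in> borel_measurable ?l"
      by (rule lm) measurable
    have m2: "(\<lambda>u. ennreal ((a * (u + \<theta>) powr \<sigma> - \<sigma> * real (card D))\<^sup>2)) \<in> borel_measurable ?l"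
      by (rule lm) measurable
    have "(\<integral>\<^sup>+u. ennreal (c u) \<partial>?l) = (\<integral>\<^sup>+u. ennreal (2 * h2 / \<epsilon>\<^sup>2) * ennreal (a * (u + \<theta>) powr \<sigma>)
       + ennreal (h\<^sup>2 / \<epsilon>\<^sup>2) * ennreal ((a * (u + \<theta>) powr \<sigma> - \<sigma> * real (card D))\<^sup>2) \<partial>?l)"
    proof (intro nn_integral_cong)
      fix u
      have "ennreal (2 * h2 / \<epsilon>\<^sup>2) * ennreal (a * (u + \<theta>) powr \<sigma>)
         + ennreal (h\<^sup>2 / \<epsilon>\<^sup>2) * ennreal ((a * (u + \<theta>) powr \<sigma> - \<sigma> * real (card D))\<^sup>2)
        = ennreal (2 * h2 / \<epsilon>\<^sup>2 * (a * (u + \<theta>) powr \<sigma>) + h\<^sup>2 / \<epsilon>\<^sup>2 * (a * (u + \<theta>) powr \<sigma> - \<sigma> * real (card D))\<^sup>2)"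
        using h2 a by (intro el) auto
      then show "ennreal (c u) = ennreal (2 * h2 / \<epsilon>\<^sup>2) * ennreal (a * (u + \<theta>) powr \<sigma>)
         + ennreal (h\<^sup>2 / \<epsilon>\<^sup>2) * ennreal ((a * (u + \<theta>) powr \<sigma> - \<sigma> * real (card D))\<^sup>2)"
        by (simp add: c_def add_divide_distrib)
    qed
    also have "\<dots> = ennreal (2 * h2 / \<epsilon>\<^sup>2) * (\<integral>\<^sup>+u. ennreal (a * (u + \<theta>) powr \<sigma>) \<partial>?l)
       + ennreal (h\<^sup>2 / \<epsilon>\<^sup>2) * (\<integral>\<^sup>+u. ennreal ((a * (u + \<theta>) powr \<sigma> - \<sigma> * real (card D))\<^sup>2) \<partial>?l)"
      using m1 m2 by (subst nn_integral_add) (auto simp: nn_integral_cmult)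
    also have "\<dots> \<le> ennreal (2 * h2 / \<epsilon>\<^sup>2) * ennreal (latent_bound n (card D))
       + ennreal (h\<^sup>2 / \<epsilon>\<^sup>2) * ennreal ((\<sigma> + 2 * a * (2 * K) powr \<sigma>) * latent_bound n (card D) + 2 * a * \<theta> * real n * K powr (\<sigma> - 1))"
      by (intro add_mono mult_left_mono latent_law_mean latent_law_variance n K) auto
    also have "\<dots> = ennreal (2 * h2 / \<epsilon>\<^sup>2 * latent_bound n (card D)
       + h\<^sup>2 / \<epsilon>\<^sup>2 * ((\<sigma> + 2 * a * (2 * K) powr \<sigma>) * latent_bound n (card D) + 2 * a * \<theta> * real n * K powr (\<sigma> - 1)))"
      using h2 E0 V0 by (intro el) auto
    also have "2 * h2 / \<epsilon>\<^sup>2 * latent_bound n (card D)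
       + h\<^sup>2 / \<epsilon>\<^sup>2 * ((\<sigma> + 2 * a * (2 * K) powr \<sigma>) * latent_bound n (card D) + 2 * a * \<theta> * real n * K powr (\<sigma> - 1)) = \<rho>"
      by (simp add: \<rho>_def add_divide_distrib)
    finally show ?thesis .
  qed
  let ?e = "\<lambda>u. emeasure (posterior_kernel D ?p u) (le_event D ?w ?w)"
  have em: "?e \<in> borel_measurable ?l"
  proof (subst measurable_cong_sets[OF sl refl], rule measurable_emeasure_kernel[OF measurable_prob_algebraD])
    show "posterior_kernel D ?p \<in> R \<rightarrow>\<^sub>M prob_algebra (posterior_space D)" by (rule posterior_kernel_measurable[OF D])
    show "le_event D ?w ?w \<in> sets (posterior_space D)" by measurable
  qed
  have F: "emeasure (mean_law n X f) {..x} = (\<integral>\<^sup>+u. ?e u \<partial>?l)"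
    unfolding D_def using n by (intro mean_law_le f intf) simp
  have up: "?e u \<le> emeasure (gamma_sum_law D ?p ?w) {..- B + 2 * \<epsilon>} + ennreal (c u)"
    and lo: "emeasure (gamma_sum_law D ?p ?w) {..- B - 2 * \<epsilon>} \<le> ?e u + ennreal (c u)" if "u \<in> space ?l" for u
    unfolding B_def c_def h_def h2_def
    using kernel_le_event_bounds[OF _ D _ int2 \<epsilon>, of u] that by (auto simp: space_latent_law)
  have "emeasure (mean_law n X f) {..x} \<le> (\<integral>\<^sup>+u. emeasure (gamma_sum_law D ?p ?w) {..- B + 2 * \<epsilon>} + ennreal (c u) \<partial>?l)"
    unfolding F by (intro nn_integral_mono up)
  also have "\<dots> = emeasure (gamma_sum_law D ?p ?w) {..- B + 2 * \<epsilon>} + (\<integral>\<^sup>+u. ennreal (c u) \<partial>?l)"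
    using cm by (subst nn_integral_add) (auto simp: l.emeasure_space_1)
  also have "\<dots> \<le> emeasure (gamma_sum_law D ?p ?w) {..- B + 2 * \<epsilon>} + ennreal \<rho>" by (intro add_left_mono ci)
  finally have "ennreal (cdf (mean_law n X f) x) \<le> ennreal (cdf (gamma_sum_law D ?p ?w) (- B + 2 * \<epsilon>) + \<rho>)"
    using \<rho>0 by (simp add: cdf_def m.emeasure_eq_measure g.emeasure_eq_measure ennreal_plus)
  then show "cdf (mean_law n X f) x \<le> cdf (gamma_sum_law D ?p ?w) (- B + 2 * \<epsilon>) + \<rho>"
    using \<rho>0 by (subst (asm) ennreal_le_iff) (auto simp: cdf_def)
  have "emeasure (gamma_sum_law D ?p ?w) {..- B - 2 * \<epsilon>} = (\<integral>\<^sup>+u. emeasure (gamma_sum_law D ?p ?w) {..- B - 2 * \<epsilon>} \<partial>?l)"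
    by (simp add: l.emeasure_space_1)
  also have "\<dots> \<le> (\<integral>\<^sup>+u. ?e u + ennreal (c u) \<partial>?l)" by (intro nn_integral_mono lo)
  also have "\<dots> = emeasure (mean_law n X f) {..x} + (\<integral>\<^sup>+u. ennreal (c u) \<partial>?l)"
    unfolding F using cm em by (intro nn_integral_add)
  also have "\<dots> \<le> emeasure (mean_law n X f) {..x} + ennreal \<rho>" by (intro add_left_mono ci)
  finally have "ennreal (cdf (gamma_sum_law D ?p ?w) (- B - 2 * \<epsilon>)) \<le> ennreal (cdf (mean_law n X f) x + \<rho>)"
    using \<rho>0 by (simp add: cdf_def m.emeasure_eq_measure g.emeasure_eq_measure ennreal_plus)
  then show "cdf (gamma_sum_law D ?p ?w) (- B - 2 * \<epsilon>) \<le> cdf (mean_law n X f) x + \<rho>"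
    using \<rho>0 by (subst (asm) ennreal_le_iff) (auto simp: cdf_def)
qed

section \<open>Measurability of the posterior distribution function in the sample\<close>

text \<open>Replaces the random set of values by a set of sample positions. Such a set ranges over
  countably many possibilities, and the values then appear only in the coefficients of the
  event.\<close>

lemma kernel_le_event_reindex:
  fixes X :: "'i \<Rightarrow> 'j" and v p :: "'j \<Rightarrow> real"
  assumes u: "0 < u" and C: "finite C" "inj_on X C" and p: "\<And>y. y \<in> X ` C \<Longrightarrow> 0 < p y"
    and w [measurable]: "w \<in> borel_measurable borel"
  shows "emeasure (posterior_kernel (X ` C) p u) (le_event (X ` C) w v)
    = emeasure (posterior_kernel C (\<lambda>i. p (X i)) u) (le_event C w (\<lambda>i. v (X i)))"
proof -
  let ?L = "distr M jump_algebra (N u)"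
  let ?GD = "\<Pi>\<^sub>M y\<in>X ` C. gamma_law (p y) (u + \<theta>)" and ?GR = "\<Pi>\<^sub>M i\<in>C. gamma_law (p (X i)) (u + \<theta>)"
  let ?t = "\<lambda>J. \<lambda>i\<in>C. J (X i)"
  have pG: "prob_space ?GR" using u p by (intro prob_space_gammas) auto
  have g: "distr ?GD ?GR ?t = ?GR"
    using u \<theta> p C by (intro distr_PiM_reindex prob_space_gamma_law) auto
  have tm [measurable]: "?t \<in> ?GD \<rightarrow>\<^sub>M ?GR"
    by (intro measurable_restrict measurable_compose[OF measurable_component_singleton]) auto
  have "posterior_kernel C (\<lambda>i. p (X i)) u = distr ?L ?L (\<lambda>x. x) \<Otimes>\<^sub>M distr ?GD ?GR ?t"
    by (simp add: posterior_kernel_def g distr_id)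
  also have "\<dots> = distr (?L \<Otimes>\<^sub>M ?GD) (?L \<Otimes>\<^sub>M ?GR) (\<lambda>(Q, J). (Q, ?t J))"
    using pG by (intro pair_measure_distr tm) (auto simp: g prob_space_imp_sigma_finite)
  finally have eq: "posterior_kernel C (\<lambda>i. p (X i)) u = distr (?L \<Otimes>\<^sub>M ?GD) (?L \<Otimes>\<^sub>M ?GR) (\<lambda>(Q, J). (Q, ?t J))" .
  have ev: "le_event C w (\<lambda>i. v (X i)) \<in> sets (?L \<Otimes>\<^sub>M ?GR)"
    using sets_posterior_kernel[of C "\<lambda>i. p (X i)" u] by (simp add: posterior_kernel_def)
  have "emeasure (posterior_kernel C (\<lambda>i. p (X i)) u) (le_event C w (\<lambda>i. v (X i)))
    = emeasure (?L \<Otimes>\<^sub>M ?GD) ((\<lambda>(Q, J). (Q, ?t J)) -` le_event C w (\<lambda>i. v (X i)) \<inter> space (?L \<Otimes>\<^sub>M ?GD))"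
    unfolding eq using ev tm by (intro emeasure_distr) auto
  also have "(\<lambda>(Q, J). (Q, ?t J)) -` le_event C w (\<lambda>i. v (X i)) \<inter> space (?L \<Otimes>\<^sub>M ?GD) = le_event (X ` C) w v"
    using C by (auto simp: le_event_def space_pair_measure space_PiM sum.reindex)
  finally show ?thesis by (simp add: posterior_kernel_def)
qed

text \<open>The law of the posterior mean depends on the sample through the pattern of ties, a
  countable-valued statistic, and on the values of \<open>f\<close>, which enter the event only linearly.\<close>

definition tie_pattern :: "nat \<Rightarrow> (nat \<Rightarrow> 'a) \<Rightarrow> nat list" where
  "tie_pattern n X = map (\<lambda>i. LEAST j. X j = X i) [0..<n]"

text \<open>A first occurrence carries the value that it represents and is its own first occurrence.
  Hence two representatives with the same value coincide, and the entries equal to \<open>j\<close>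
  are the positions tied with \<open>j\<close>.\<close>

lemma tie_pattern:
  shows "X ` set (tie_pattern n X) = distinct_values n X"
    and "inj_on X (set (tie_pattern n X))"
    and "j \<in> set (tie_pattern n X) \<Longrightarrow> count_list (tie_pattern n X) j = multiplicity_in n X (X j)"
proof -
  let ?r = "\<lambda>i. LEAST j. X j = X i"
  have r: "X (?r i) = X i" for i by (rule LeastI[of "\<lambda>j. X j = X i" i]) simp
  have s: "set (tie_pattern n X) = ?r ` {..<n}" by (auto simp: tie_pattern_def)
  show "X ` set (tie_pattern n X) = distinct_values n X"
    unfolding s distinct_values_def by (simp add: image_image r)
  have rr: "?r (?r i) = ?r i" for i by (simp add: r)
  have fixr: "?r j = j" if "j \<in> set (tie_pattern n X)" for j
    using that rr unfolding s by auto
  show "inj_on X (set (tie_pattern n X))"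
  proof (rule inj_onI)
    fix i j assume ij: "i \<in> set (tie_pattern n X)" "j \<in> set (tie_pattern n X)" "X i = X j"
    then have "?r i = ?r j" by simp
    then show "i = j" using fixr[OF ij(1)] fixr[OF ij(2)] by simp
  qed
  assume j: "j \<in> set (tie_pattern n X)"
  have "?r i = j \<longleftrightarrow> X i = X j" for i
  proof
    show "X i = X j" if "?r i = j" using r[of i] unfolding that by simp
    show "?r i = j" if "X i = X j" using fixr[OF j] unfolding that .
  qed
  then have "{i. i < n \<and> ?r i = j} = {i. i < n \<and> X i = X j}" by auto
  moreover have "count_list (tie_pattern n X) j = card {i. i < n \<and> ?r i = j}"
  proof -
    have "count_list (map ?r [0..<n]) j = length (filter (\<lambda>x. j = x) (map ?r [0..<n]))"
      by (simp add: count_list_eq_length_filter)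
    also have "\<dots> = length (filter (\<lambda>i. ?r i = j) [0..<n])"
    proof -
      have "filter (\<lambda>x. j = x) (map ?r [0..<n]) = map ?r (filter (\<lambda>i. j = ?r i) [0..<n])"
        by (simp only: filter_map comp_def)
      also have "(\<lambda>i. j = ?r i) = (\<lambda>i. ?r i = j)" by (rule ext) (rule eq_commute)
      finally show ?thesis by (simp only: length_map)
    qed
    also have "\<dots> = card {i. i < n \<and> ?r i = j}"
      by (subst length_filter_conv_card) (intro arg_cong[where f = card], auto)
    finally show ?thesis by (simp add: tie_pattern_def)
  qed
  ultimately show "count_list (tie_pattern n X) j = multiplicity_in n X (X j)"
    by (simp add: multiplicity_in_def)
qed

lemma tie_pattern_measurable [measurable]:
  "tie_pattern n \<in> (\<Pi>\<^sub>M i\<in>(UNIV::nat set). borel) \<rightarrow>\<^sub>M count_space UNIV"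
proof (subst measurable_count_space_eq2_countable, intro conjI ballI)
  fix r :: "nat list"
  have [measurable]: "Measurable.pred (\<Pi>\<^sub>M i\<in>(UNIV::nat set). (borel :: 'a measure)) (\<lambda>X. X j = X i)" for i j
    unfolding pred_def by (rule measurable_equality_set) measurable
  have [measurable]: "(\<lambda>X. LEAST j. X j = X i) \<in> (\<Pi>\<^sub>M i\<in>(UNIV::nat set). (borel :: 'a measure)) \<rightarrow>\<^sub>M count_space UNIV" for i
    by measurable
  have "tie_pattern n -` {r} \<inter> space (\<Pi>\<^sub>M i\<in>(UNIV::nat set). (borel :: 'a measure))
    = {X \<in> space (\<Pi>\<^sub>M i\<in>(UNIV::nat set). (borel :: 'a measure)). length r = n \<and> (\<forall>i<n. (LEAST j. X j = X i) = r ! i)}"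
  proof -
    have "tie_pattern n X = r \<longleftrightarrow> length r = n \<and> (\<forall>i<n. (LEAST j. X j = X i) = r ! i)" for X
      unfolding tie_pattern_def by (subst list_eq_iff_nth_eq) auto
    then show ?thesis by auto
  qed
  also have "\<dots> \<in> sets (\<Pi>\<^sub>M i\<in>(UNIV::nat set). borel)"
    by measurable
  finally show "tie_pattern n -` {r} \<inter> space (\<Pi>\<^sub>M i\<in>(UNIV::nat set). (borel :: 'a measure)) \<in> sets (\<Pi>\<^sub>M i\<in>(UNIV::nat set). borel)" .
qed auto

lemma cdf_mean_law_measurable:
  assumes n: "0 < n" and f [measurable]: "f \<in> borel_measurable borel" and int: "integrable H f"
  shows "(\<lambda>X. cdf (mean_law n X f) x) \<in> borel_measurable (\<Pi>\<^sub>M i\<in>(UNIV::nat set). borel)"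
proof -
  let ?S = "\<Pi>\<^sub>M i\<in>(UNIV::nat set). (borel :: 'a measure)"
  let ?w = "\<lambda>y. f y - x"
  \<comment> \<open>The pattern is frozen: \<open>\<Phi> r\<close> makes sense at every
    \<open>X\<close> and is measurable there, but it is the wanted probability only where the
    pattern of \<open>X\<close> is \<open>r\<close>. The pieces are glued over the countably many
    patterns.\<close>
  define \<Phi> where "\<Phi> r X = (\<integral>\<^sup>+u. emeasure (posterior_kernel (set r) (\<lambda>j. real (count_list r j) - \<sigma>) u)
     (le_event (set r) ?w (\<lambda>i. ?w (X i))) \<partial>latent_law a \<sigma> \<theta> n (card (set r)))" for r :: "nat list" and X
  have \<Phi>: "\<Phi> r \<in> borel_measurable ?S" for r
  proof -
    have pos: "0 < real (count_list r j) - \<sigma>" if "j \<in> set r" for j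
    proof -
      have "count_list r j \<noteq> 0" using that by (simp add: count_list_0_iff)
      then have "1 \<le> real (count_list r j)" by linarith
      then show ?thesis using \<sigma> by simp
    qed
    have k: "posterior_kernel (set r) (\<lambda>j. real (count_list r j) - \<sigma>) \<in> R \<rightarrow>\<^sub>M subprob_algebra (posterior_space (set r))"
      using pos by (intro measurable_prob_algebraD posterior_kernel_measurable) auto
    have sl: "sets (latent_law a \<sigma> \<theta> n (card (set r))) = sets R" by (rule sets_latent_law)
    have "(\<lambda>y. emeasure (posterior_kernel (set r) (\<lambda>j. real (count_list r j) - \<sigma>) (snd y)) (le_event (set r) ?w (\<lambda>i. ?w (fst y i))))
        \<in> borel_measurable (?S \<Otimes>\<^sub>M R)"
    proof (rule emeasure_measurable_subprob_algebra2[where N = "posterior_space (set r)"])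
      show "(\<lambda>y. posterior_kernel (set r) (\<lambda>j. real (count_list r j) - \<sigma>) (snd y)) \<in> ?S \<Otimes>\<^sub>M R \<rightarrow>\<^sub>M subprob_algebra (posterior_space (set r))"
        by (rule measurable_compose[OF measurable_snd k])
      let ?Q = "(?S \<Otimes>\<^sub>M R) \<Otimes>\<^sub>M posterior_space (set r)"
      have m1: "(\<lambda>q. jump_integral ?w (fst (snd q))) \<in> borel_measurable ?Q"
        by (rule measurable_compose[OF measurable_compose[OF measurable_snd measurable_fst] jump_integral_measurable]) measurable
      have m2: "(\<lambda>q. snd (snd q) i) \<in> borel_measurable ?Q" if "i \<in> set r" for i
        using measurable_compose[OF measurable_compose[OF measurable_snd measurable_snd] measurable_component_singleton[OF that]] .
      have m3: "(\<lambda>q. f (fst (fst q) i)) \<in> borel_measurable ?Q" for i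
      proof -
        have "(\<lambda>X. X i) \<in> ?S \<rightarrow>\<^sub>M borel" by measurable
        from measurable_compose[OF measurable_compose[OF measurable_compose[OF measurable_fst measurable_fst] this] f]
        show ?thesis .
      qed
      have "(\<lambda>q. jump_integral ?w (fst (snd q)) + (\<Sum>i\<in>set r. snd (snd q) i * (f (fst (fst q) i) - x))) \<in> borel_measurable ?Q"
        by (intro borel_measurable_add borel_measurable_sum borel_measurable_times borel_measurable_diff m1 m2 m3) auto
      from borel_measurable_le[OF this borel_measurable_const]
      have "{q \<in> space ((?S \<Otimes>\<^sub>M R) \<Otimes>\<^sub>M posterior_space (set r)).
          jump_integral ?w (fst (snd q)) + (\<Sum>i\<in>set r. snd (snd q) i * (f (fst (fst q) i) - x)) \<le> 0} \<in> sets ((?S \<Otimes>\<^sub>M R) \<Otimes>\<^sub>M posterior_space (set r))"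
        by this
      also have "{q \<in> space ((?S \<Otimes>\<^sub>M R) \<Otimes>\<^sub>M posterior_space (set r)).
          jump_integral ?w (fst (snd q)) + (\<Sum>i\<in>set r. snd (snd q) i * (f (fst (fst q) i) - x)) \<le> 0}
        = (SIGMA y:space (?S \<Otimes>\<^sub>M R). le_event (set r) ?w (\<lambda>i. ?w (fst y i)))"
        by (auto simp: le_event_def space_pair_measure)
      finally show "(SIGMA y:space (?S \<Otimes>\<^sub>M R). le_event (set r) ?w (\<lambda>i. ?w (fst y i))) \<in> sets ((?S \<Otimes>\<^sub>M R) \<Otimes>\<^sub>M posterior_space (set r))" .
    qed
    then have "(\<lambda>(X, u). emeasure (posterior_kernel (set r) (\<lambda>j. real (count_list r j) - \<sigma>) u) (le_event (set r) ?w (\<lambda>i. ?w (X i))))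
        \<in> borel_measurable (?S \<Otimes>\<^sub>M latent_law a \<sigma> \<theta> n (card (set r)))"
      using sets_pair_measure_cong[OF refl sl, of ?S] by (simp add: case_prod_beta' cong: measurable_cong_sets)
    then show ?thesis unfolding \<Phi>_def
      by (intro sigma_finite_measure.borel_measurable_nn_integral prob_space_imp_sigma_finite prob_space_latent_law)
  qed
  have "emeasure (mean_law n X f) {..x} = \<Phi> (tie_pattern n X) X" for X
  proof -
    note tp = tie_pattern[where n = n and X = X]
    have c: "card (set (tie_pattern n X)) = card (distinct_values n X)"
      using card_image[OF tp(2)] tp(1) by simp
    have "emeasure (mean_law n X f) {..x} = (\<integral>\<^sup>+u. emeasure (posterior_kernel (distinct_values n X) (mult_shape n X) u)
      (le_event (distinct_values n X) ?w ?w) \<partial>latent_law a \<sigma> \<theta> n (card (distinct_values n X)))"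
      by (rule mean_law_le[OF n f int])
    also have "\<dots> = \<Phi> (tie_pattern n X) X"
      unfolding \<Phi>_def c
    proof (rule nn_integral_cong)
      fix u assume "u \<in> space (latent_law a \<sigma> \<theta> n (card (distinct_values n X)))"
      then have u: "0 < u" by (simp add: space_latent_law)
      have "emeasure (posterior_kernel (X ` set (tie_pattern n X)) (mult_shape n X) u) (le_event (X ` set (tie_pattern n X)) ?w ?w)
        = emeasure (posterior_kernel (set (tie_pattern n X)) (\<lambda>i. mult_shape n X (X i)) u) (le_event (set (tie_pattern n X)) ?w (\<lambda>i. ?w (X i)))"
        using tp(1,2) multiplicity_pos[of _ n X] by (intro kernel_le_event_reindex u) auto
      also have "posterior_kernel (set (tie_pattern n X)) (\<lambda>i. mult_shape n X (X i)) u
        = posterior_kernel (set (tie_pattern n X)) (\<lambda>j. real (count_list (tie_pattern n X) j) - \<sigma>) u"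
        unfolding posterior_kernel_def using tp(3) by (intro arg_cong2[where f = "(\<Otimes>\<^sub>M)"] refl PiM_cong) auto
      finally show "emeasure (posterior_kernel (distinct_values n X) (mult_shape n X) u) (le_event (distinct_values n X) ?w ?w)
        = emeasure (posterior_kernel (set (tie_pattern n X)) (\<lambda>j. real (count_list (tie_pattern n X) j) - \<sigma>) u) (le_event (set (tie_pattern n X)) ?w (\<lambda>i. ?w (X i)))"
        unfolding tp(1) .
    qed
    finally show ?thesis .
  qed
  moreover have "(\<lambda>X. \<Phi> (tie_pattern n X) X) \<in> borel_measurable ?S"
    by (rule measurable_compose_countable[OF \<Phi> tie_pattern_measurable])
  ultimately show ?thesis unfolding cdf_def measure_def by simp
qed

end

subsection \<open>Samples from a discrete distribution\<close>

lemma (in prob_space) second_moment_indep_sum: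
  fixes X :: "nat \<Rightarrow> 'a \<Rightarrow> real"
  assumes ind: "indep_vars (\<lambda>_. borel) X UNIV" and mean: "\<And>i. expectation (X i) = 0"
    and sq: "\<And>i. integrable M (\<lambda>\<omega>. (X i \<omega>)\<^sup>2)" "\<And>i. expectation (\<lambda>\<omega>. (X i \<omega>)\<^sup>2) = v"
  shows "integrable M (\<lambda>\<omega>. (\<Sum>i<n. X i \<omega>)\<^sup>2)" "expectation (\<lambda>\<omega>. (\<Sum>i<n. X i \<omega>)\<^sup>2) = real n * v"
proof (induction n)
  case (Suc n)
  have rv [measurable]: "random_variable borel (X i)" for i using ind by (auto simp: indep_vars_def2)
  have Xi: "integrable M (X i)" for i by (rule square_integrable_imp_integrable[OF rv sq(1)])
  have iv: "indep_var borel (X n) borel (\<lambda>\<omega>. \<Sum>i<n. X i \<omega>)"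
    by (intro indep_vars_sum indep_vars_subset[OF ind]) auto
  have Si: "integrable M (\<lambda>\<omega>. \<Sum>i<n. X i \<omega>)" using Xi by auto
  note c = indep_var_integrable[OF iv Xi Si] indep_var_lebesgue_integral[OF iv Xi Si]
  have e: "(\<Sum>i<Suc n. X i \<omega>)\<^sup>2 = (\<Sum>i<n. X i \<omega>)\<^sup>2 + 2 * (X n \<omega> * (\<Sum>i<n. X i \<omega>)) + (X n \<omega>)\<^sup>2" for \<omega>
    by (simp add: power2_eq_square algebra_simps)
  { case 1 show ?case unfolding e by (intro Bochner_Integration.integrable_add integrable_mult_right c Suc.IH(1) sq) }
  { case 2
    have "expectation (\<lambda>\<omega>. (\<Sum>i<Suc n. X i \<omega>)\<^sup>2) = expectation (\<lambda>\<omega>. (\<Sum>i<n. X i \<omega>)\<^sup>2) + 2 * (expectation (X n) * expectation (\<lambda>\<omega>. \<Sum>i<n. X i \<omega>)) + v"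
      unfolding e using c Suc.IH(1) sq by simp
    then show ?case by (simp add: Suc.IH(2) mean algebra_simps) }
qed auto

locale discrete_sample = P0: prob_space P0 for P0 :: "'a::polish_space measure" +
  assumes sets_P0: "sets P0 = sets borel"
    and discrete: "\<exists>S. countable S \<and> (AE x in P0. x \<in> S)"
begin

lemmas [measurable_cong] = sets_P0

abbreviation "\<Omega> \<equiv> \<Pi>\<^sub>M i\<in>(UNIV::nat set). P0"

sublocale S: product_prob_space "\<lambda>_. P0" "UNIV :: nat set"
  by unfold_locales

lemma sets_\<Omega> [measurable_cong]: "sets \<Omega> = sets (\<Pi>\<^sub>M i\<in>(UNIV::nat set). borel)"
  by (intro sets_PiM_cong) (auto simp: sets_P0)

lemma distr_coordinate: "distr \<Omega> P0 (\<lambda>X. X i) = P0"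
  using S.PiM_component[of i] by simp

lemma indep_coordinates:
  assumes [measurable]: "g \<in> borel_measurable borel"
  shows "S.indep_vars (\<lambda>_. borel) (\<lambda>i X. g (X i)) (UNIV :: nat set)"
proof -
  have "S.indep_vars (\<lambda>_. P0) (\<lambda>i X. X i) (UNIV :: nat set)"
    by (subst S.indep_vars_iff_distr_eq_PiM) (auto simp: distr_coordinate restrict_def distr_id)
  then show ?thesis by (rule S.indep_vars_compose2) measurable
qed

lemma integral_coordinate:
  fixes g :: "'a \<Rightarrow> real"
  assumes [measurable]: "g \<in> borel_measurable borel"
  shows "(\<integral>X. g (X i) \<partial>\<Omega>) = (\<integral>x. g x \<partial>P0)"
    and "integrable \<Omega> (\<lambda>X. g (X i)) \<longleftrightarrow> integrable P0 g"
  using integral_distr[of "\<lambda>X. X i" \<Omega> P0 g] integrable_distr_eq[of "\<lambda>X. X i" \<Omega> P0 g]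
  by (simp_all add: distr_coordinate)

text \<open>Enumerate a countable carrier of \<open>P0\<close>; almost every point is eventually
  among the first \<open>m\<close> values, and dominated convergence removes the tail. The
  discreteness of \<open>P0\<close> enters here and reaches the rest through this lemma.\<close>

lemma finite_concentration:
  fixes \<phi> :: "'a \<Rightarrow> real"
  assumes [measurable]: "\<phi> \<in> borel_measurable borel" and int: "integrable P0 \<phi>" and \<epsilon>: "0 < \<epsilon>"
  obtains A where "finite A" "(\<integral>x. \<bar>\<phi> x\<bar> * indicator (- A) x \<partial>P0) < \<epsilon>"
proof -
  obtain S where S: "countable S" "AE x in P0. x \<in> S" using discrete by auto
  have ne: "S \<noteq> {}"
  proof
    assume "S = {}"
    then have "AE x in P0. False" using S(2) by simp
    then show False by simp
  qed
  define A where "A m = from_nat_into S ` {..<m}" for m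
  have finA: "finite (A m)" for m by (simp add: A_def)
  have [measurable]: "A m \<in> sets borel" for m using finA by (intro borel_closed finite_imp_closed)
  have "(\<lambda>m. \<integral>x. \<bar>\<phi> x\<bar> * indicator (- A m) x \<partial>P0) \<longlonglongrightarrow> (\<integral>x. 0 \<partial>P0)"
  proof (rule integral_dominated_convergence[where w = "\<lambda>x. \<bar>\<phi> x\<bar>"])
    show "AE x in P0. (\<lambda>m. \<bar>\<phi> x\<bar> * indicator (- A m) x) \<longlonglongrightarrow> 0"
      using S(2)
    proof eventually_elim
      case (elim x)
      then obtain k where k: "from_nat_into S k = x" using from_nat_into_surj[OF S(1)] by blast
      have "\<forall>\<^sub>F m in sequentially. \<bar>\<phi> x\<bar> * indicator (- A m) x = 0"
        using eventually_gt_at_top[of k]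
        by eventually_elim (use k in \<open>auto simp: A_def\<close>)
      then show ?case by (rule tendsto_eventually)
    qed
    show "integrable P0 (\<lambda>x. \<bar>\<phi> x\<bar>)" using int by simp
  qed (auto simp: indicator_def)
  then have "\<forall>\<^sub>F m in sequentially. (\<integral>x. \<bar>\<phi> x\<bar> * indicator (- A m) x \<partial>P0) < \<epsilon>"
    using \<epsilon> by (intro order_tendstoD) auto
  then obtain m where "(\<integral>x. \<bar>\<phi> x\<bar> * indicator (- A m) x \<partial>P0) < \<epsilon>"
    by (auto simp: eventually_sequentially)
  then show thesis using finA that by blast
qed

text \<open>Convergence to 0 in probability under the infinite product of \<open>P0\<close>.\<close>

definition vanishes :: "(nat \<Rightarrow> (nat \<Rightarrow> 'a) \<Rightarrow> real) \<Rightarrow> bool" where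
  "vanishes Z \<longleftrightarrow> (\<forall>\<eta>>0. (\<lambda>n. measure \<Omega> {X \<in> space \<Omega>. \<eta> \<le> \<bar>Z n X\<bar>}) \<longlonglongrightarrow> 0)"

lemma vanishesI:
  assumes "\<And>\<eta> \<delta>. 0 < \<eta> \<Longrightarrow> 0 < \<delta> \<Longrightarrow> \<forall>\<^sub>F n in sequentially. measure \<Omega> {X \<in> space \<Omega>. \<eta> \<le> \<bar>Z n X\<bar>} \<le> \<delta>"
  shows "vanishes Z"
  unfolding vanishes_def
proof (intro allI impI)
  fix \<eta> :: real assume \<eta>: "0 < \<eta>"
  show "(\<lambda>n. measure \<Omega> {X \<in> space \<Omega>. \<eta> \<le> \<bar>Z n X\<bar>}) \<longlonglongrightarrow> 0"
  proof (rule order_tendstoI)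
    fix r :: real assume "r < 0"
    then show "\<forall>\<^sub>F n in sequentially. r < measure \<Omega> {X \<in> space \<Omega>. \<eta> \<le> \<bar>Z n X\<bar>}"
      by (intro always_eventually allI less_le_trans[OF _ measure_nonneg])
  next
    fix r :: real assume "0 < r"
    then show "\<forall>\<^sub>F n in sequentially. measure \<Omega> {X \<in> space \<Omega>. \<eta> \<le> \<bar>Z n X\<bar>} < r"
      using assms[OF \<eta>, of "r / 2"] by (auto elim: eventually_mono)
  qed
qed

text \<open>The bound is uniform in the sample size. It controls both the rare distinct values and
  the error of truncation in the weak law.\<close>

lemma tail_mean_Markov:
  fixes \<phi> :: "'a \<Rightarrow> real"
  assumes [measurable]: "\<phi> \<in> borel_measurable borel" and int: "integrable P0 \<phi>" and A: "finite A" and \<eta>: "0 < \<eta>" and n: "0 < n"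
  shows "measure \<Omega> {X \<in> space \<Omega>. \<eta> \<le> (\<Sum>i<n. \<bar>\<phi> (X i)\<bar> * indicator (- A) (X i)) / real n}
    \<le> (\<integral>x. \<bar>\<phi> x\<bar> * indicator (- A) x \<partial>P0) / \<eta>"
proof -
  have [measurable]: "A \<in> sets borel" using A by (intro borel_closed finite_imp_closed)
  define g where "g x = \<bar>\<phi> x\<bar> * indicator (- A) x" for x
  have [measurable]: "g \<in> borel_measurable borel" unfolding g_def by measurable
  have gi: "integrable P0 g"
    by (rule Bochner_Integration.integrable_bound[OF int]) (auto simp: g_def indicator_def)
  have gi': "integrable \<Omega> (\<lambda>X. g (X i))" for i
    using gi by (subst integral_coordinate) auto
  have si: "integrable \<Omega> (\<lambda>X. (\<Sum>i<n. g (X i)) / real n)"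
    using gi' by (intro integrable_divide Bochner_Integration.integrable_sum)
  have "AE X in \<Omega>. 0 \<le> (\<Sum>i<n. g (X i)) / real n"
    by (intro AE_I2 divide_nonneg_nonneg sum_nonneg) (auto simp: g_def)
  from integral_Markov_inequality_measure[OF si sets.empty_sets this \<eta>]
  have "measure \<Omega> {X \<in> space \<Omega>. \<eta> \<le> (\<Sum>i<n. g (X i)) / real n} \<le> (\<integral>X. (\<Sum>i<n. g (X i)) / real n \<partial>\<Omega>) / \<eta>" .
  also have "(\<integral>X. (\<Sum>i<n. g (X i)) / real n \<partial>\<Omega>) = (\<integral>x. g x \<partial>P0)"
  proof -
    have "(\<integral>X. g (X i) \<partial>\<Omega>) = (\<integral>x. g x \<partial>P0)" for i by (rule integral_coordinate(1)) measurable
    then show ?thesis using gi' n by simp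
  qed
  finally show ?thesis by (simp only: g_def)
qed

text \<open>Only finitely many atoms carry all but a small part of the mass, so distinct values
  are rare.\<close>

lemma distinct_sum_vanishes:
  fixes \<phi> :: "'a \<Rightarrow> real"
  assumes \<phi> [measurable]: "\<phi> \<in> borel_measurable borel" and int: "integrable P0 \<phi>" and nonneg: "\<And>x. 0 \<le> \<phi> x"
  shows "vanishes (\<lambda>n X. (\<Sum>y\<in>distinct_values n X. \<phi> y) / real n)"
proof (rule vanishesI)
  fix \<eta> \<delta> :: real assume \<eta>: "0 < \<eta>" and \<delta>: "0 < \<delta>"
  obtain A where A: "finite A" "(\<integral>x. \<bar>\<phi> x\<bar> * indicator (- A) x \<partial>P0) < \<delta> * (\<eta> / 2)"
    using finite_concentration[OF \<phi> int, of "\<delta> * (\<eta> / 2)"] \<eta> \<delta> by auto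
  define C where "C = (\<Sum>y\<in>A. \<phi> y)"
  have "(\<lambda>n. C / real n) \<longlonglongrightarrow> 0" by (rule lim_const_over_n)
  then have "\<forall>\<^sub>F n in sequentially. C / real n < \<eta> / 2" using \<eta> by (intro order_tendstoD) auto
  then show "\<forall>\<^sub>F n in sequentially. measure \<Omega> {X \<in> space \<Omega>. \<eta> \<le> \<bar>(\<Sum>y\<in>distinct_values n X. \<phi> y) / real n\<bar>} \<le> \<delta>"
    using eventually_gt_at_top[of 0]
  proof eventually_elim
    case (elim n)
    let ?T = "\<lambda>X. (\<Sum>i<n. \<bar>\<phi> (X i)\<bar> * indicator (- A) (X i))"
    \<comment> \<open>Each point of \<open>A\<close> is counted at most once, which gives a
      constant; outside \<open>A\<close> a sum over distinct values is at most the sum over all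
      occurrences.\<close>
    have bound: "(\<Sum>y\<in>distinct_values n X. \<phi> y) \<le> C + ?T X" for X
    proof -
      have fin: "finite (distinct_values n X)" by (simp add: distinct_values_def)
      have "(\<Sum>y\<in>distinct_values n X. \<phi> y) = (\<Sum>y\<in>distinct_values n X. \<phi> y * indicator A y) + (\<Sum>y\<in>distinct_values n X. \<phi> y * indicator (- A) y)"
        by (subst sum.distrib[symmetric]) (intro sum.cong refl, simp split: split_indicator)
      also have "(\<Sum>y\<in>distinct_values n X. \<phi> y * indicator A y) = (\<Sum>y\<in>distinct_values n X \<inter> A. \<phi> y)"
        unfolding sum.inter_restrict[OF fin] by (intro sum.cong refl) (simp split: split_indicator)
      also have "\<dots> \<le> C" unfolding C_def using A nonneg by (intro sum_mono2) auto
      also have "(\<Sum>y\<in>distinct_values n X. \<phi> y * indicator (- A) y) \<le> (\<Sum>i<n. \<phi> (X i) * indicator (- A) (X i))"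
        unfolding distinct_values_def using nonneg
        by (intro order_trans[OF sum_image_le]) (auto simp: indicator_def)
      also have "(\<Sum>i<n. \<phi> (X i) * indicator (- A) (X i)) = ?T X" using nonneg by simp
      finally show ?thesis by simp
    qed
    have [measurable]: "A \<in> sets borel" using A by (intro borel_closed finite_imp_closed)
    have "measure \<Omega> {X \<in> space \<Omega>. \<eta> \<le> \<bar>(\<Sum>y\<in>distinct_values n X. \<phi> y) / real n\<bar>}
      \<le> measure \<Omega> {X \<in> space \<Omega>. \<eta> / 2 \<le> ?T X / real n}"
    proof (rule S.finite_measure_mono)
      show "{X \<in> space \<Omega>. \<eta> \<le> \<bar>(\<Sum>y\<in>distinct_values n X. \<phi> y) / real n\<bar>} \<subseteq> {X \<in> space \<Omega>. \<eta> / 2 \<le> ?T X / real n}"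
      proof clarify
        fix X assume X: "\<eta> \<le> \<bar>(\<Sum>y\<in>distinct_values n X. \<phi> y) / real n\<bar>"
        have "\<bar>(\<Sum>y\<in>distinct_values n X. \<phi> y) / real n\<bar> = (\<Sum>y\<in>distinct_values n X. \<phi> y) / real n"
          using nonneg by (simp add: sum_nonneg)
        also have "\<dots> \<le> (C + ?T X) / real n" by (intro divide_right_mono bound) simp
        finally show "\<eta> / 2 \<le> ?T X / real n"
          using X elim(1) unfolding add_divide_distrib by linarith
      qed
    qed measurable
    also have "\<dots> \<le> (\<integral>x. \<bar>\<phi> x\<bar> * indicator (- A) x \<partial>P0) / (\<eta> / 2)"
      using elim \<eta> by (intro tail_mean_Markov \<phi> int A) auto
    also have "\<dots> \<le> \<delta>" using A(2) \<eta> by (simp add: field_simps)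
    finally show ?case .
  qed
qed

section \<open>Weak laws of large numbers for the sample\<close>

lemma weak_law_square_integrable:
  fixes \<phi> :: "'a \<Rightarrow> real"
  assumes \<phi> [measurable]: "\<phi> \<in> borel_measurable borel" and int: "integrable P0 (\<lambda>x. (\<phi> x)\<^sup>2)" and \<eta>: "0 < \<eta>"
  shows "(\<lambda>n. measure \<Omega> {X \<in> space \<Omega>. \<eta> \<le> \<bar>(\<Sum>i<n. \<phi> (X i)) / real n - (\<integral>x. \<phi> x \<partial>P0)\<bar>}) \<longlonglongrightarrow> 0"
proof -
  define m where "m = (\<integral>x. \<phi> x \<partial>P0)"
  define v where "v = (\<integral>x. (\<phi> x - m)\<^sup>2 \<partial>P0)"
  have i1: "integrable P0 \<phi>" by (rule P0.square_integrable_imp_integrable[OF _ int]) measurable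
  have i2: "integrable P0 (\<lambda>x. (\<phi> x - m)\<^sup>2)"
    using i1 int by (simp add: power2_diff)
  have ind: "S.indep_vars (\<lambda>_. borel) (\<lambda>i X. \<phi> (X i) - m) (UNIV :: nat set)"
    by (rule indep_coordinates[of "\<lambda>x. \<phi> x - m"]) measurable
  have c: "integrable \<Omega> (\<lambda>X. (\<phi> (X i) - m)\<^sup>2)" "(\<integral>X. (\<phi> (X i) - m)\<^sup>2 \<partial>\<Omega>) = v" "(\<integral>X. \<phi> (X i) - m \<partial>\<Omega>) = 0" for i
    using integral_coordinate[of "\<lambda>x. (\<phi> x - m)\<^sup>2" i] integral_coordinate[of "\<lambda>x. \<phi> x - m" i] i1 i2
    by (simp_all add: v_def m_def P0.prob_space)
  note sm = S.second_moment_indep_sum[OF ind c(3) c(1) c(2)]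
  have bound: "measure \<Omega> {X \<in> space \<Omega>. \<eta> \<le> \<bar>(\<Sum>i<n. \<phi> (X i)) / real n - m\<bar>} \<le> v / \<eta>\<^sup>2 / real n" if n: "0 < n" for n
  proof -
    have "{X \<in> space \<Omega>. \<eta> \<le> \<bar>(\<Sum>i<n. \<phi> (X i)) / real n - m\<bar>} = {X \<in> space \<Omega>. (real n * \<eta>)\<^sup>2 \<le> (\<Sum>i<n. \<phi> (X i) - m)\<^sup>2}"
    proof -
      have "\<eta> \<le> \<bar>(\<Sum>i<n. \<phi> (X i)) / real n - m\<bar> \<longleftrightarrow> (real n * \<eta>)\<^sup>2 \<le> (\<Sum>i<n. \<phi> (X i) - m)\<^sup>2" for X
      proof -
        have "(\<Sum>i<n. \<phi> (X i) - m) = real n * ((\<Sum>i<n. \<phi> (X i)) / real n - m)"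
          using n by (simp add: sum_subtractf field_simps)
        then have "(real n * \<eta>)\<^sup>2 \<le> (\<Sum>i<n. \<phi> (X i) - m)\<^sup>2 \<longleftrightarrow> \<bar>real n * \<eta>\<bar> \<le> \<bar>real n * ((\<Sum>i<n. \<phi> (X i)) / real n - m)\<bar>"
          by (simp only: abs_le_square_iff)
        then show ?thesis using n \<eta> by (simp add: abs_mult)
      qed
      then show ?thesis by simp
    qed
    also have "measure \<Omega> \<dots> \<le> (\<integral>X. (\<Sum>i<n. \<phi> (X i) - m)\<^sup>2 \<partial>\<Omega>) / (real n * \<eta>)\<^sup>2"
      using sm(1) n \<eta> by (intro integral_Markov_inequality_measure[where A = "{}"]) auto
    also have "\<dots> = v / \<eta>\<^sup>2 / real n" unfolding sm(2) using n by (simp add: power2_eq_square)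
    finally show ?thesis .
  qed
  have "(\<lambda>n. measure \<Omega> {X \<in> space \<Omega>. \<eta> \<le> \<bar>(\<Sum>i<n. \<phi> (X i)) / real n - m\<bar>}) \<longlonglongrightarrow> 0"
  proof (rule Lim_null_comparison)
    show "\<forall>\<^sub>F n in sequentially. norm (measure \<Omega> {X \<in> space \<Omega>. \<eta> \<le> \<bar>(\<Sum>i<n. \<phi> (X i)) / real n - m\<bar>}) \<le> v / \<eta>\<^sup>2 / real n"
      using eventually_gt_at_top[of 0] by eventually_elim (use bound in simp)
    show "(\<lambda>n. v / \<eta>\<^sup>2 / real n) \<longlonglongrightarrow> 0" by (rule lim_const_over_n)
  qed
  then show ?thesis by (simp add: m_def)
qed

text \<open>The law is needed for g^2, which is merely integrable, so Chebyshev's inequality does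
  not apply directly. Restricted to a finite set that carries most of the integral, \<phi> is
  bounded; the remainder is handled by Markov's inequality.\<close>

lemma weak_law:
  fixes \<phi> :: "'a \<Rightarrow> real"
  assumes \<phi> [measurable]: "\<phi> \<in> borel_measurable borel" and int: "integrable P0 \<phi>"
  shows "vanishes (\<lambda>n X. (\<Sum>i<n. \<phi> (X i)) / real n - (\<integral>x. \<phi> x \<partial>P0))"
proof (rule vanishesI)
  fix \<eta> \<delta> :: real assume \<eta>: "0 < \<eta>" and \<delta>: "0 < \<delta>"
  \<comment> \<open>The first entry keeps the shift of the mean below \<eta> / 3, the second brings
    the Markov bound at level \<eta> / 3 below \<delta> / 2.\<close>
  define \<epsilon> where "\<epsilon> = min (\<eta> / 3) (\<delta> / 2 * (\<eta> / 3))"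
  have \<epsilon>: "0 < \<epsilon>" using \<eta> \<delta> by (simp add: \<epsilon>_def)
  obtain A where A: "finite A" "(\<integral>x. \<bar>\<phi> x\<bar> * indicator (- A) x \<partial>P0) < \<epsilon>"
    using finite_concentration[OF \<phi> int \<epsilon>] by auto
  have [measurable]: "A \<in> sets borel" using A by (intro borel_closed finite_imp_closed)
  define \<psi> where "\<psi> x = \<phi> x * indicator A x" for x
  define \<tau> where "\<tau> x = \<bar>\<phi> x\<bar> * indicator (- A) x" for x
  have \<psi>m [measurable]: "\<psi> \<in> borel_measurable borel" "\<tau> \<in> borel_measurable borel"
    unfolding \<psi>_def \<tau>_def by measurable
  have \<psi>\<tau>: "\<bar>\<phi> x - \<psi> x\<bar> = \<tau> x" for x by (simp add: \<psi>_def \<tau>_def indicator_def)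
  have A': "(\<integral>x. \<tau> x \<partial>P0) < \<epsilon>" using A(2) by (simp only: \<tau>_def)
  have \<psi>i: "integrable P0 \<psi>" "integrable P0 \<tau>"
    by (rule Bochner_Integration.integrable_bound[OF int]; auto simp: \<psi>_def \<tau>_def indicator_def)+
  have \<psi>2: "integrable P0 (\<lambda>x. (\<psi> x)\<^sup>2)"
  proof (rule P0.integrable_const_bound[where B = "\<Sum>y\<in>A. (\<phi> y)\<^sup>2"])
    have "(\<psi> x)\<^sup>2 \<le> (\<Sum>y\<in>A. (\<phi> y)\<^sup>2)" for x
      using A member_le_sum[of x A "\<lambda>y. (\<phi> y)\<^sup>2"] by (cases "x \<in> A") (auto simp: \<psi>_def intro: sum_nonneg)
    then show "AE x in P0. norm ((\<psi> x)\<^sup>2) \<le> (\<Sum>y\<in>A. (\<phi> y)\<^sup>2)" by simp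
  qed measurable
  have diff: "\<bar>(\<integral>x. \<phi> x \<partial>P0) - (\<integral>x. \<psi> x \<partial>P0)\<bar> < \<eta> / 3"
  proof -
    have "(\<integral>x. \<phi> x \<partial>P0) - (\<integral>x. \<psi> x \<partial>P0) = (\<integral>x. \<phi> x - \<psi> x \<partial>P0)" using int \<psi>i by simp
    also have "\<bar>\<dots>\<bar> \<le> (\<integral>x. \<bar>\<phi> x - \<psi> x\<bar> \<partial>P0)" by (rule integral_abs_bound)
    also have "\<dots> = (\<integral>x. \<tau> x \<partial>P0)"
      by (simp only: \<psi>\<tau>)
    also have "\<dots> < \<eta> / 3" using A' by (simp add: \<epsilon>_def)
    finally show ?thesis .
  qed
  have "(\<lambda>n. measure \<Omega> {X \<in> space \<Omega>. \<eta> / 3 \<le> \<bar>(\<Sum>i<n. \<psi> (X i)) / real n - (\<integral>x. \<psi> x \<partial>P0)\<bar>}) \<longlonglongrightarrow> 0"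
    using \<eta> by (intro weak_law_square_integrable \<psi>2 \<psi>m) auto
  then have "\<forall>\<^sub>F n in sequentially. measure \<Omega> {X \<in> space \<Omega>. \<eta> / 3 \<le> \<bar>(\<Sum>i<n. \<psi> (X i)) / real n - (\<integral>x. \<psi> x \<partial>P0)\<bar>} < \<delta> / 2"
    using \<delta> by (intro order_tendstoD) auto
  then show "\<forall>\<^sub>F n in sequentially. measure \<Omega> {X \<in> space \<Omega>. \<eta> \<le> \<bar>(\<Sum>i<n. \<phi> (X i)) / real n - (\<integral>x. \<phi> x \<partial>P0)\<bar>} \<le> \<delta>"
    using eventually_gt_at_top[of 0]
  proof eventually_elim
    case (elim n)
    let ?E1 = "{X \<in> space \<Omega>. \<eta> / 3 \<le> \<bar>(\<Sum>i<n. \<psi> (X i)) / real n - (\<integral>x. \<psi> x \<partial>P0)\<bar>}"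
    let ?E2 = "{X \<in> space \<Omega>. \<eta> / 3 \<le> (\<Sum>i<n. \<tau> (X i)) / real n}"
    have "measure \<Omega> {X \<in> space \<Omega>. \<eta> \<le> \<bar>(\<Sum>i<n. \<phi> (X i)) / real n - (\<integral>x. \<phi> x \<partial>P0)\<bar>} \<le> measure \<Omega> (?E1 \<union> ?E2)"
    proof (rule S.finite_measure_mono)
      show "{X \<in> space \<Omega>. \<eta> \<le> \<bar>(\<Sum>i<n. \<phi> (X i)) / real n - (\<integral>x. \<phi> x \<partial>P0)\<bar>} \<subseteq> ?E1 \<union> ?E2"
      proof
        fix X assume X: "X \<in> {X \<in> space \<Omega>. \<eta> \<le> \<bar>(\<Sum>i<n. \<phi> (X i)) / real n - (\<integral>x. \<phi> x \<partial>P0)\<bar>}"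
        have "\<bar>(\<Sum>i<n. \<phi> (X i)) / real n - (\<Sum>i<n. \<psi> (X i)) / real n\<bar> = \<bar>\<Sum>i<n. \<phi> (X i) - \<psi> (X i)\<bar> / real n"
          by (simp add: sum_subtractf diff_divide_distrib[symmetric])
        also have "\<dots> \<le> (\<Sum>i<n. \<bar>\<phi> (X i) - \<psi> (X i)\<bar>) / real n" by (intro divide_right_mono sum_abs) simp
        also have "(\<Sum>i<n. \<bar>\<phi> (X i) - \<psi> (X i)\<bar>) = (\<Sum>i<n. \<tau> (X i))"
          by (simp only: \<psi>\<tau>)
        finally have d: "\<bar>(\<Sum>i<n. \<phi> (X i)) / real n - (\<Sum>i<n. \<psi> (X i)) / real n\<bar> \<le> (\<Sum>i<n. \<tau> (X i)) / real n" .
        show "X \<in> ?E1 \<union> ?E2"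
        proof (rule ccontr)
          assume "X \<notin> ?E1 \<union> ?E2"
          then have "\<bar>(\<Sum>i<n. \<psi> (X i)) / real n - (\<integral>x. \<psi> x \<partial>P0)\<bar> < \<eta> / 3" "(\<Sum>i<n. \<tau> (X i)) / real n < \<eta> / 3"
            using X by (auto simp only: mem_Collect_eq Un_iff not_le)
          moreover have "\<eta> \<le> \<bar>(\<Sum>i<n. \<phi> (X i)) / real n - (\<integral>x. \<phi> x \<partial>P0)\<bar>" using X by (simp only: mem_Collect_eq)
          ultimately show False using d diff by linarith
        qed
      qed
    qed measurable
    also have "\<dots> \<le> measure \<Omega> ?E1 + measure \<Omega> ?E2" by (intro measure_Un_le) measurable
    also have "\<dots> \<le> \<delta> / 2 + (\<integral>x. \<tau> x \<partial>P0) / (\<eta> / 3)"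
      using elim \<eta> tail_mean_Markov[OF \<phi> int A(1), of "\<eta> / 3" n] by (intro add_mono) (auto simp only: \<tau>_def)
    also have "\<dots> \<le> \<delta> / 2 + \<delta> / 2"
      using A' \<eta> by (intro add_left_mono) (simp add: \<epsilon>_def field_simps)
    finally show ?case by simp
  qed
qed

end

subsection \<open>Asymptotics of the posterior quantiles\<close>

text \<open>Right continuity of the distribution function puts the infimum into the set. Questions
  about quantiles thereby become questions about the distribution function at one point.\<close>

lemma (in real_distribution) quantile_le_iff:
  assumes p: "0 < p" "p < 1"
  shows "quantile M p \<le> x \<longleftrightarrow> p \<le> cdf M x"
proof -
  let ?A = "{t. p \<le> cdf M t}"
  have ne: "?A \<noteq> {}"
  proof -
    have "\<forall>\<^sub>F t in at_top. p < cdf M t" using order_tendstoD(1)[OF cdf_lim_at_top_prob p(2)] .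
    then obtain t where "p < cdf M t" by (auto simp: eventually_at_top_linorder)
    then show ?thesis by (auto intro: less_imp_le)
  qed
  have bdd: "bdd_below ?A"
  proof -
    have "\<forall>\<^sub>F t in at_bot. cdf M t < p" using order_tendstoD(2)[OF cdf_lim_at_bot p(1)] .
    then obtain b where b: "\<And>t. t \<le> b \<Longrightarrow> cdf M t < p" by (auto simp: eventually_at_bot_linorder)
    have "b \<le> t" if "t \<in> ?A" for t
    proof (rule ccontr)
      assume "\<not> b \<le> t"
      then have "cdf M t < p" by (intro b) simp
      then show False using that by simp
    qed
    then show ?thesis by (rule bdd_belowI)
  qed
  show ?thesis
  proof
    assume "p \<le> cdf M x"
    then show "quantile M p \<le> x" unfolding quantile_def by (intro cInf_lower bdd) simp
  next
    assume q: "quantile M p \<le> x"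
    have ge: "p \<le> cdf M y" if "x < y" for y
    proof -
      have "Inf ?A < y" using q that by (simp add: quantile_def)
      then obtain t where "t \<in> ?A" "t < y" using cInf_lessD[OF ne] by blast
      then show ?thesis using cdf_nondecreasing[of t y] by simp
    qed
    have "(cdf M \<longlongrightarrow> cdf M x) (at_right x)"
      using cdf_is_right_cont[of x] by (simp add: continuous_within)
    moreover have "\<forall>\<^sub>F y in at_right x. p \<le> cdf M y"
      unfolding eventually_at_right_field using ge gt_ex by blast
    ultimately show "p \<le> cdf M x" by (rule tendsto_lowerbound) simp
  qed
qed

abbreviation std_normal_cdf :: "real \<Rightarrow> real" where
  "std_normal_cdf \<equiv> cdf std_normal_distribution"

lemma isCont_std_normal_cdf: "isCont std_normal_cdf t"
proof -
  interpret real_distribution std_normal_distribution by (rule real_dist_normal_dist)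
  have "{t} \<in> null_sets std_normal_distribution"
  proof -
    have "AE x in lborel. x \<in> {t} \<longrightarrow> ennreal (std_normal_density x) = 0"
      using AE_lborel_singleton[of t] by eventually_elim simp
    then show ?thesis by (simp add: null_sets_density_iff)
  qed
  then have "measure std_normal_distribution {t} = 0" by (auto simp: measure_def null_sets_def)
  then show ?thesis by (subst isCont_cdf)
qed

lemma std_normal_cdf_surj:
  assumes "0 < p" "p < 1"
  obtains t where "std_normal_cdf t = p"
proof -
  interpret real_distribution std_normal_distribution by (rule real_dist_normal_dist)
  have "\<forall>\<^sub>F t in at_top. p < std_normal_cdf t" using order_tendstoD(1)[OF cdf_lim_at_top_prob assms(2)] .
  then obtain b where b: "p < std_normal_cdf b" by (auto simp: eventually_at_top_linorder)
  have "\<forall>\<^sub>F t in at_bot. std_normal_cdf t < p" using order_tendstoD(2)[OF cdf_lim_at_bot assms(1)] .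
  then obtain a where a: "std_normal_cdf a < p" by (auto simp: eventually_at_bot_linorder)
  have "a \<le> b"
    using a b cdf_nondecreasing[of b a] by (cases "a \<le> b") auto
  then obtain t where "std_normal_cdf t = p"
    using IVT[of std_normal_cdf a p b] a b isCont_std_normal_cdf by auto
  then show thesis by (rule that)
qed

lemma sum_multiplicity:
  "(\<Sum>y\<in>distinct_values n X. real (multiplicity_in n X y) * \<phi> y) = (\<Sum>i<n. \<phi> (X i))"
proof -
  have "(\<Sum>i<n. \<phi> (X i)) = (\<Sum>y\<in>X ` {..<n}. \<Sum>i | i \<in> {..<n} \<and> X i = y. \<phi> (X i))"
    by (rule sum.image_gen) simp
  also have "\<dots> = (\<Sum>y\<in>X ` {..<n}. \<Sum>i | i < n \<and> X i = y. \<phi> y)"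
    by (intro sum.cong refl) auto
  finally show ?thesis by (simp add: distinct_values_def multiplicity_in_def)
qed

text \<open>Dividing each occurrence by its multiplicity turns a sum over a random set into one over
  fixed positions, a form whose measurability in the sample is visible.\<close>

lemma sum_distinct_values:
  "(\<Sum>y\<in>distinct_values n X. \<phi> y) = (\<Sum>i<n. \<phi> (X i) / real (multiplicity_in n X (X i)))"
proof -
  have "(\<Sum>i<n. \<phi> (X i) / real (multiplicity_in n X (X i)))
    = (\<Sum>y\<in>distinct_values n X. real (multiplicity_in n X y) * (\<phi> y / real (multiplicity_in n X y)))"
    by (rule sum_multiplicity[symmetric])
  also have "\<dots> = (\<Sum>y\<in>distinct_values n X. \<phi> y)"
  proof (intro sum.cong refl)
    fix y assume "y \<in> distinct_values n X"
    then have "{i. i < n \<and> X i = y} \<noteq> {}" by (auto simp: distinct_values_def)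
    then have "multiplicity_in n X y \<noteq> 0" by (simp add: multiplicity_in_def)
    then show "real (multiplicity_in n X y) * (\<phi> y / real (multiplicity_in n X y)) = \<phi> y" by simp
  qed
  finally show ?thesis ..
qed

context discrete_sample
begin

lemma distinct_sum_measurable:
  fixes \<phi> :: "'a \<Rightarrow> real"
  assumes [measurable]: "\<phi> \<in> borel_measurable borel"
  shows "(\<lambda>X. \<Sum>y\<in>distinct_values n X. \<phi> y) \<in> borel_measurable \<Omega>"
proof -
  have e: "real (multiplicity_in n X y) = (\<Sum>j<n. if X j = y then 1 else 0)" for X :: "nat \<Rightarrow> 'a" and y
  proof -
    have "{i. i < n \<and> X i = y} = {j \<in> {..<n}. X j = y}" by auto
    then show ?thesis unfolding multiplicity_in_def by (simp add: sum.If_cases Int_def)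
  qed
  have [measurable]: "Measurable.pred \<Omega> (\<lambda>X. X j = X i)" for i j
    unfolding pred_def by (rule measurable_equality_set) measurable
  have "(\<lambda>X. \<Sum>i<n. \<phi> (X i) / real (multiplicity_in n X (X i))) \<in> borel_measurable \<Omega>"
    unfolding e by measurable
  then show ?thesis unfolding sum_distinct_values .
qed

lemma distinct_card_measurable: "(\<lambda>X. real (card (distinct_values n X))) \<in> borel_measurable \<Omega>"
  using distinct_sum_measurable[of "\<lambda>_. 1" n] by simp

end

section \<open>The corrected threshold and its centring\<close>

locale nggp_sample = nggp a \<sigma> \<theta> H M N + discrete_sample P0
  for a \<sigma> \<theta> :: real and H :: "'a::polish_space measure" and M :: "'w measure" and N and P0 :: "'a measure" +
  fixes f :: "'a \<Rightarrow> real"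
  assumes f [measurable]: "f \<in> borel_measurable borel"
    and f_P0: "integrable P0 (\<lambda>x. (f x)\<^sup>2)" and f_H: "integrable H (\<lambda>x. (f x)\<^sup>2)"
    and nondegenerate: "0 < (\<integral>x. (f x - (\<integral>y. f y \<partial>P0))\<^sup>2 \<partial>P0)"
begin

definition c :: real where "c = (\<integral>x. f x \<partial>P0)"

definition g :: "'a \<Rightarrow> real" where "g x = f x - c"

definition s2 :: real where "s2 = (\<integral>x. (g x)\<^sup>2 \<partial>P0)"

definition s :: real where "s = sqrt s2"

definition Hg :: real where "Hg = (\<integral>x. g x \<partial>H)"

definition corr :: "nat \<Rightarrow> (nat \<Rightarrow> 'a) \<Rightarrow> real" where
  "corr n X = \<sigma> * real (card (distinct_values n X)) / real n * ((\<integral>y. f y \<partial>H) - distinct_mean n X f)"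

definition score :: "nat \<Rightarrow> (nat \<Rightarrow> 'a) \<Rightarrow> real" where "score n X = (\<Sum>i<n. g (X i))"

text \<open>The threshold at which the centred posterior sum has mean \<open>- s t \<surd>n\<close>, so that the posterior
  distribution function there is close to \<open>\<Phi> t\<close>.\<close>

definition cut :: "nat \<Rightarrow> (nat \<Rightarrow> 'a) \<Rightarrow> real \<Rightarrow> real" where
  "cut n X t = c + corr n X + score n X / real n + s * t / sqrt (real n)"

lemma g_measurable [measurable]: "g \<in> borel_measurable borel"
  unfolding g_def by measurable

lemma s2_pos: "0 < s2"
  using nondegenerate by (simp add: s2_def g_def c_def)

lemma s_pos: "0 < s" and s_sq: "s\<^sup>2 = s2"
  using s2_pos by (auto simp: s_def)

lemma int_P0: "integrable P0 f" "integrable P0 g" "integrable P0 (\<lambda>x. (g x)\<^sup>2)"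
proof -
  show 1: "integrable P0 f" by (rule P0.square_integrable_imp_integrable[OF _ f_P0]) measurable
  then show "integrable P0 g" by (simp add: g_def[abs_def])
  show "integrable P0 (\<lambda>x. (g x)\<^sup>2)" using 1 f_P0 by (simp add: g_def power2_diff)
qed

lemma int_H: "integrable H f" "integrable H g" "integrable H (\<lambda>x. (g x)\<^sup>2)" "integrable H (\<lambda>x. (f x - r)\<^sup>2)"
proof -
  show 1: "integrable H f" by (rule H.square_integrable_imp_integrable[OF _ f_H]) measurable
  then show "integrable H g" by (simp add: g_def[abs_def])
  show "integrable H (\<lambda>x. (g x)\<^sup>2)" using 1 f_H by (simp add: g_def power2_diff)
  show "integrable H (\<lambda>x. (f x - r)\<^sup>2)" using 1 f_H by (simp add: power2_diff)
qed

lemma mean_g: "(\<integral>x. g x \<partial>P0) = 0"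
  using int_P0 by (simp add: g_def c_def P0.prob_space)

lemma corr_eq:
  assumes "0 < n"
  shows "real n * corr n X = \<sigma> * (real (card (distinct_values n X)) * Hg - (\<Sum>y\<in>distinct_values n X. g y))"
proof -
  have "card (distinct_values n X) \<noteq> 0" using distinct_values_nonempty[OF assms, of X] by simp
  moreover have "(\<integral>y. f y \<partial>H) = Hg + c" using int_H by (simp add: Hg_def g_def H.prob_space)
  moreover have "(\<Sum>y\<in>distinct_values n X. f y) = (\<Sum>y\<in>distinct_values n X. g y) + real (card (distinct_values n X)) * c"
    by (simp add: g_def sum_subtractf)
  ultimately show ?thesis using assms
    by (simp add: corr_def distinct_mean_def field_simps)
qed

text \<open>As a function of the threshold the left side is affine with slope -n, because the
  weights \<sigma> k + \<Sum> (n_y - \<sigma>) add up to n. Its zero is therefore the sample mean of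
  \<open>f\<close> plus the correction, and moving the threshold by s t / \<surd>n changes the value
  by -s t \<surd>n.\<close>

lemma cut_centering:
  assumes n: "0 < n"
  shows "\<sigma> * real (card (distinct_values n X)) * (\<integral>y. f y - cut n X t \<partial>H)
      + (\<Sum>y\<in>distinct_values n X. mult_shape n X y * (f y - cut n X t)) = - (s * t * sqrt n)"
proof -
  let ?D = "distinct_values n X" and ?k = "real (card (distinct_values n X))"
  define h where "h = cut n X t - c"
  have w: "f y - cut n X t = g y - h" for y by (simp add: h_def g_def)
  have "(\<Sum>y\<in>?D. mult_shape n X y * (g y - h)) = (\<Sum>y\<in>?D. real (multiplicity_in n X y) * (g y - h)) - \<sigma> * (\<Sum>y\<in>?D. g y - h)"
  proof -
    have "(\<Sum>y\<in>?D. mult_shape n X y * \<phi> y) = (\<Sum>y\<in>?D. real (multiplicity_in n X y) * \<phi> y) - \<sigma> * (\<Sum>y\<in>?D. \<phi> y)" for \<phi> :: "'a \<Rightarrow> real"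
      by (simp add: left_diff_distrib sum_subtractf sum_distrib_left)
    then show ?thesis .
  qed
  also have "\<dots> = score n X - real n * h - \<sigma> * ((\<Sum>y\<in>?D. g y) - ?k * h)"
  proof -
    have "(\<Sum>y\<in>?D. g y - h) = (\<Sum>y\<in>?D. g y) - ?k * h" by (simp add: sum_subtractf)
    moreover have "(\<Sum>i<n. g (X i) - h) = score n X - real n * h" by (simp add: score_def sum_subtractf)
    ultimately show ?thesis by (simp only: sum_multiplicity[of n X "\<lambda>y. g y - h"])
  qed
  finally have 1: "(\<Sum>y\<in>?D. mult_shape n X y * (g y - h)) = score n X - real n * h - \<sigma> * ((\<Sum>y\<in>?D. g y) - ?k * h)" .
  have 2: "(\<integral>y. g y - h \<partial>H) = Hg - h" using int_H by (simp add: Hg_def H.prob_space)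
  have "real n * h = real n * corr n X + score n X + s * t * (real n / sqrt n)"
    using n by (simp add: h_def cut_def distrib_left)
  then have 3: "real n * h = \<sigma> * (?k * Hg - (\<Sum>y\<in>?D. g y)) + score n X + s * t * sqrt n"
    by (simp add: corr_eq[OF n] real_div_sqrt)
  show ?thesis unfolding w 1 2 3 by (simp add: algebra_simps)
qed

lemma latent_bound_lim:
  fixes n k :: "nat \<Rightarrow> nat"
  assumes n: "filterlim n at_top sequentially" and k: "(\<lambda>m. real (k m) / real (n m)) \<longlonglongrightarrow> 0"
  shows "(\<lambda>m. latent_bound (n m) (k m) / real (n m)) \<longlonglongrightarrow> 0"
proof (rule Lim_null_comparison)
  let ?C = "4 + 2 * a * (2 * \<theta>) powr \<sigma>"
  have nr: "filterlim (\<lambda>m. real (n m)) at_top sequentially"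
    by (rule filterlim_compose[OF filterlim_real_sequentially n])
  have i1: "(\<lambda>m. 1 / real (n m)) \<longlonglongrightarrow> 0" using tendsto_inverse_0_at_top[OF nr] by (simp add: inverse_eq_divide)
  have i2: "(\<lambda>m. 1 / sqrt (real (n m))) \<longlonglongrightarrow> 0"
    using tendsto_inverse_0_at_top[OF filterlim_compose[OF sqrt_at_top nr]] by (simp add: inverse_eq_divide)
  show "(\<lambda>m. ?C * (1 / real (n m)) + 4 * \<sigma> * (real (k m) / real (n m)) + (2 * \<theta> + 2 * a) * (1 / sqrt (real (n m)))) \<longlonglongrightarrow> 0"
    by (rule tendsto_eq_intros i1 i2 k refl | simp)+
  show "\<forall>\<^sub>F m in sequentially. norm (latent_bound (n m) (k m) / real (n m))
    \<le> ?C * (1 / real (n m)) + 4 * \<sigma> * (real (k m) / real (n m)) + (2 * \<theta> + 2 * a) * (1 / sqrt (real (n m)))"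
  proof -
    have "\<forall>\<^sub>F m in sequentially. 1 \<le> n m" using n by (simp add: filterlim_at_top)
    then show ?thesis
    proof eventually_elim
      case (elim m)
      have q: "1 \<le> sqrt (real (n m))" using elim by simp
      then have "sqrt (real (n m)) powr \<sigma> \<le> sqrt (real (n m)) powr 1" using \<sigma> by (intro powr_mono) auto
      then have "2 * a * sqrt (real (n m)) powr \<sigma> \<le> 2 * a * sqrt (real (n m))" using a q by (intro mult_left_mono) auto
      then have "latent_bound (n m) (k m) \<le> ?C + 4 * \<sigma> * real (k m) + (2 * \<theta> + 2 * a) * sqrt (real (n m))"
        unfolding latent_bound_def by (simp add: algebra_simps)
      then have "latent_bound (n m) (k m) / real (n m) \<le> (?C + 4 * \<sigma> * real (k m) + (2 * \<theta> + 2 * a) * sqrt (real (n m))) / real (n m)"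
        by (intro divide_right_mono) auto
      also have "\<dots> = ?C * (1 / real (n m)) + 4 * \<sigma> * (real (k m) / real (n m)) + (2 * \<theta> + 2 * a) * (sqrt (real (n m)) / real (n m))"
        by (simp add: add_divide_distrib)
      also have "sqrt (real (n m)) / real (n m) = 1 / sqrt (real (n m))" by (simp add: sqrt_divide_self_eq inverse_eq_divide)
      finally show ?case
        using a \<sigma> \<theta> by (simp add: latent_bound_def)
    qed
  qed
qed

section \<open>The normal limit along deterministic arrays of samples\<close>

text \<open>Nothing is random in the data here: for each \<open>m\<close> there is a sample of its
  own, unrelated to the others. The threshold differs from \<open>c\<close> by h \<rightarrow> 0, so
  \<open>w\<close> may be replaced by \<open>g\<close> in all averages. The variance of the gamma
  sum is then asymptotic to n s^2, and its largest weight is o(\<surd>n) because the squares of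
  \<open>g\<close> over the distinct values sum to o(n).\<close>

lemma cdf_limit:
  fixes n :: "nat \<Rightarrow> nat" and X :: "nat \<Rightarrow> nat \<Rightarrow> 'a" and t :: real
  assumes n: "filterlim n at_top sequentially" and n3: "\<And>m. 3 \<le> n m"
    and lk: "(\<lambda>m. real (card (distinct_values (n m) (X m))) / real (n m)) \<longlonglongrightarrow> 0"
    and lg: "(\<lambda>m. (\<Sum>y\<in>distinct_values (n m) (X m). (g y)\<^sup>2) / real (n m)) \<longlonglongrightarrow> 0"
    and lS: "(\<lambda>m. score (n m) (X m) / real (n m)) \<longlonglongrightarrow> 0"
    and lv: "(\<lambda>m. (\<Sum>i<n m. (g (X m i))\<^sup>2) / real (n m)) \<longlonglongrightarrow> s2"
  shows "(\<lambda>m. cdf (mean_law (n m) (X m) f) (cut (n m) (X m) t)) \<longlonglongrightarrow> std_normal_cdf t"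
proof -
  define D where "D m = distinct_values (n m) (X m)" for m
  define k where "k m = card (D m)" for m
  define x where "x m = cut (n m) (X m) t" for m
  define h where "h m = x m - c" for m
  define w where "w m y = f y - x m" for m y
  define p where "p m = mult_shape (n m) (X m)" for m
  define q where "q m = sqrt (real (n m))" for m
  have w: "w m y = g y - h m" for m y by (simp add: w_def h_def g_def)
  have n0: "0 < n m" "0 < real (n m)" for m using n3[of m] by auto
  have q0: "0 < q m" and qq: "q m * q m = real (n m)" "(q m)\<^sup>2 = real (n m)" for m using n0 by (auto simp: q_def)
  have finD: "finite (D m)" for m by (simp add: D_def)
  have p0: "0 < p m y" if "y \<in> D m" for m y using that multiplicity_pos by (simp add: D_def p_def)
  note lk = lk[folded D_def, folded k_def] and lg = lg[folded D_def]
  have nr: "filterlim (\<lambda>m. real (n m)) at_top sequentially"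
    by (rule filterlim_compose[OF filterlim_real_sequentially n])
  have lq: "(\<lambda>m. 1 / q m) \<longlonglongrightarrow> 0"
    unfolding q_def using tendsto_inverse_0_at_top[OF filterlim_compose[OF sqrt_at_top nr]] by (simp add: inverse_eq_divide)
  have lcorr: "(\<lambda>m. corr (n m) (X m)) \<longlonglongrightarrow> 0"
  proof (rule Lim_null_comparison)
    show "(\<lambda>m. \<sigma> * ((\<bar>Hg\<bar> + 1) * (real (k m) / real (n m)) + (\<Sum>y\<in>D m. (g y)\<^sup>2) / real (n m))) \<longlonglongrightarrow> 0"
      by (rule tendsto_eq_intros lk lg refl | simp)+
    show "\<forall>\<^sub>F m in sequentially. norm (corr (n m) (X m)) \<le> \<sigma> * ((\<bar>Hg\<bar> + 1) * (real (k m) / real (n m)) + (\<Sum>y\<in>D m. (g y)\<^sup>2) / real (n m))"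
    proof (rule always_eventually, rule allI)
      fix m
      \<comment> \<open>Bounding |g| by 1 + g^2 reduces the sum to the two statistics
        \<open>lk\<close> and \<open>lg\<close>, which are known to vanish.\<close>
      have "\<bar>\<Sum>y\<in>D m. g y\<bar> \<le> (\<Sum>y\<in>D m. 1 + (g y)\<^sup>2)"
      proof (rule order_trans[OF sum_abs sum_mono])
        fix y
        show "\<bar>g y\<bar> \<le> 1 + (g y)\<^sup>2" using zero_le_power2[of "\<bar>g y\<bar> - 1"] by (simp add: power2_diff)
      qed
      then have 1: "\<bar>\<Sum>y\<in>D m. g y\<bar> \<le> real (k m) + (\<Sum>y\<in>D m. (g y)\<^sup>2)" by (simp add: sum.distrib k_def)
      have "real (n m) * \<bar>corr (n m) (X m)\<bar> = \<bar>real (n m) * corr (n m) (X m)\<bar>" by (simp add: abs_mult)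
      also have "\<dots> = \<sigma> * \<bar>real (k m) * Hg - (\<Sum>y\<in>D m. g y)\<bar>"
        using \<sigma> by (simp add: corr_eq[OF n0(1)] abs_mult D_def k_def)
      also have "\<dots> \<le> \<sigma> * (real (k m) * \<bar>Hg\<bar> + (real (k m) + (\<Sum>y\<in>D m. (g y)\<^sup>2)))"
        using \<sigma> 1 abs_triangle_ineq4[of "real (k m) * Hg" "\<Sum>y\<in>D m. g y"]
        by (intro mult_left_mono) (auto simp: abs_mult)
      finally have "\<bar>corr (n m) (X m)\<bar> \<le> \<sigma> * (real (k m) * \<bar>Hg\<bar> + (real (k m) + (\<Sum>y\<in>D m. (g y)\<^sup>2))) / real (n m)"
        using n0(2)[of m] by (simp add: pos_le_divide_eq mult.commute)
      then show "norm (corr (n m) (X m)) \<le> \<sigma> * ((\<bar>Hg\<bar> + 1) * (real (k m) / real (n m)) + (\<Sum>y\<in>D m. (g y)\<^sup>2) / real (n m))"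
        by (simp add: add_divide_distrib algebra_simps)
    qed
  qed
  have h_eq: "h m = corr (n m) (X m) + score (n m) (X m) / real (n m) + s * t * (1 / q m)" for m
    by (simp add: h_def x_def cut_def q_def)
  have lh: "h \<longlonglongrightarrow> 0"
    unfolding h_eq[abs_def] by (rule tendsto_eq_intros lcorr lS lq refl | simp)+
  have lw1: "(\<lambda>m. (\<Sum>i<n m. (w m (X m i))\<^sup>2) / real (n m)) \<longlonglongrightarrow> s2"
  proof -
    have "(\<Sum>i<n m. (w m (X m i))\<^sup>2) / real (n m)
      = (\<Sum>i<n m. (g (X m i))\<^sup>2) / real (n m) - 2 * h m * (score (n m) (X m) / real (n m)) + (h m)\<^sup>2" for m
    proof -
      have "(\<Sum>i<n m. (w m (X m i))\<^sup>2) = (\<Sum>i<n m. (g (X m i))\<^sup>2) - 2 * h m * score (n m) (X m) + real (n m) * (h m)\<^sup>2"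
        unfolding w score_def by (simp add: power2_diff sum.distrib sum_subtractf sum_distrib_left mult_ac)
      then show ?thesis using n0(2)[of m] by (simp add: add_divide_distrib diff_divide_distrib)
    qed
    then show ?thesis by (simp only:) (rule tendsto_eq_intros lv lh lS refl | simp)+
  qed
  have lw2: "(\<lambda>m. (\<Sum>y\<in>D m. (w m y)\<^sup>2) / real (n m)) \<longlonglongrightarrow> 0"
  proof (rule Lim_null_comparison)
    show "(\<lambda>m. 2 * ((\<Sum>y\<in>D m. (g y)\<^sup>2) / real (n m)) + 2 * (h m)\<^sup>2 * (real (k m) / real (n m))) \<longlonglongrightarrow> 0"
      by (rule tendsto_eq_intros lg lk lh refl | simp)+
    show "\<forall>\<^sub>F m in sequentially. norm ((\<Sum>y\<in>D m. (w m y)\<^sup>2) / real (n m)) \<le> 2 * ((\<Sum>y\<in>D m. (g y)\<^sup>2) / real (n m)) + 2 * (h m)\<^sup>2 * (real (k m) / real (n m))"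
    proof (rule always_eventually, rule allI)
      fix m
      have "(\<Sum>y\<in>D m. (w m y)\<^sup>2) \<le> (\<Sum>y\<in>D m. 2 * (g y)\<^sup>2 + 2 * (h m)\<^sup>2)"
      proof (rule sum_mono)
        fix y
        show "(w m y)\<^sup>2 \<le> 2 * (g y)\<^sup>2 + 2 * (h m)\<^sup>2"
          unfolding w using zero_le_power2[of "g y + h m"] by (simp add: power2_eq_square algebra_simps)
      qed
      also have "\<dots> = 2 * (\<Sum>y\<in>D m. (g y)\<^sup>2) + 2 * (h m)\<^sup>2 * real (k m)"
        by (simp add: sum.distrib sum_distrib_left k_def)
      finally have "(\<Sum>y\<in>D m. (w m y)\<^sup>2) / real (n m) \<le> (2 * (\<Sum>y\<in>D m. (g y)\<^sup>2) + 2 * (h m)\<^sup>2 * real (k m)) / real (n m)"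
        using n0 by (intro divide_right_mono) auto
      then show "norm ((\<Sum>y\<in>D m. (w m y)\<^sup>2) / real (n m)) \<le> 2 * ((\<Sum>y\<in>D m. (g y)\<^sup>2) / real (n m)) + 2 * (h m)\<^sup>2 * (real (k m) / real (n m))"
        by (simp add: add_divide_distrib sum_nonneg)
    qed
  qed
  define v where "v m y = w m y / (s * q m)" for m y
  define G where "G m = distr (\<Pi>\<^sub>M y\<in>D m. gamma_law (p m y) 1) borel (\<lambda>G. \<Sum>y\<in>D m. (G y - p m y) * v m y)" for m
  have conv: "weak_conv_m G std_normal_distribution"
    unfolding G_def
  proof (rule gamma_array_weak_conv[OF finD p0])
    have "(\<Sum>y\<in>D m. p m y * (v m y)\<^sup>2) = 1 / s2 * ((\<Sum>i<n m. (w m (X m i))\<^sup>2) / real (n m) - \<sigma> * ((\<Sum>y\<in>D m. (w m y)\<^sup>2) / real (n m)))" for m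
    proof -
      have "(\<Sum>y\<in>D m. p m y * (w m y)\<^sup>2) = (\<Sum>i<n m. (w m (X m i))\<^sup>2) - \<sigma> * (\<Sum>y\<in>D m. (w m y)\<^sup>2)"
        unfolding p_def D_def
        by (simp add: left_diff_distrib sum_subtractf sum_distrib_left sum_multiplicity[of "n m" "X m" "\<lambda>y. (w m y)\<^sup>2"])
      moreover have "(\<Sum>y\<in>D m. p m y * (v m y)\<^sup>2) = (\<Sum>y\<in>D m. p m y * (w m y)\<^sup>2) / (s2 * real (n m))"
        by (simp add: v_def power_divide power_mult_distrib s_sq qq sum_divide_distrib)
      ultimately show ?thesis by (simp add: diff_divide_distrib right_diff_distrib)
    qed
    moreover have "(\<lambda>m. 1 / s2 * ((\<Sum>i<n m. (w m (X m i))\<^sup>2) / real (n m) - \<sigma> * ((\<Sum>y\<in>D m. (w m y)\<^sup>2) / real (n m)))) \<longlonglongrightarrow> 1 / s2 * (s2 - \<sigma> * 0)"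
      by (intro tendsto_intros lw1 lw2)
    ultimately show "(\<lambda>m. \<Sum>y\<in>D m. p m y * (v m y)\<^sup>2) \<longlonglongrightarrow> 1" using s2_pos by simp
    \<comment> \<open>The uniform bound for the weights: a single square is at most the sum of
      squares over all distinct values.\<close>
    show "(\<lambda>m. sqrt ((\<Sum>y\<in>D m. (w m y)\<^sup>2) / real (n m)) / s) \<longlonglongrightarrow> 0"
      using tendsto_divide[OF tendsto_real_sqrt[OF lw2] tendsto_const[of s]] s_pos by simp
    fix m y assume y: "y \<in> D m"
    have "(w m y)\<^sup>2 \<le> (\<Sum>y\<in>D m. (w m y)\<^sup>2)" using y finD by (intro member_le_sum) auto
    then have "\<bar>w m y\<bar> \<le> sqrt (\<Sum>y\<in>D m. (w m y)\<^sup>2)" by (metis real_sqrt_abs real_sqrt_le_iff)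
    then have "\<bar>w m y\<bar> / (s * q m) \<le> sqrt (\<Sum>y\<in>D m. (w m y)\<^sup>2) / (s * q m)"
      using s_pos q0[of m] by (intro divide_right_mono) auto
    then show "\<bar>v m y\<bar> \<le> sqrt ((\<Sum>y\<in>D m. (w m y)\<^sup>2) / real (n m)) / s"
      using s_pos q0[of m] by (simp add: v_def abs_divide abs_mult real_sqrt_divide q_def mult.commute)
  qed
  have Gcdf: "(\<lambda>m. cdf (G m) r) \<longlonglongrightarrow> std_normal_cdf r" for r
    using conv isCont_std_normal_cdf[of r] by (simp add: weak_conv_m_def weak_conv_def)
  have scale: "cdf (gamma_sum_law (D m) (p m) (w m)) r = cdf (G m) (r / (s * q m))" for m r
  proof -
    have sq: "0 < s * q m" using s_pos q0[of m] by simp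
    have "(\<Sum>y\<in>D m. (J y - p m y) * v m y) \<le> r / (s * q m) \<longleftrightarrow> (\<Sum>y\<in>D m. (J y - p m y) * w m y) \<le> r" for J
    proof -
      have "(\<Sum>y\<in>D m. (J y - p m y) * v m y) = (\<Sum>y\<in>D m. (J y - p m y) * w m y) / (s * q m)"
        by (simp add: v_def sum_divide_distrib)
      then show ?thesis using sq by (simp add: divide_le_cancel)
    qed
    then show ?thesis
      unfolding cdf_def gamma_sum_law_def G_def by (simp add: measure_distr vimage_def)
  qed
  have lh2: "(\<lambda>m. (\<integral>y. w m y \<partial>H)\<^sup>2) \<longlonglongrightarrow> Hg\<^sup>2"
  proof -
    have "(\<integral>y. w m y \<partial>H) = Hg - h m" for m unfolding w using int_H by (simp add: Hg_def H.prob_space)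
    then show ?thesis using tendsto_power[OF tendsto_diff[OF tendsto_const lh], of Hg 2] by simp
  qed
  have lh3: "(\<lambda>m. (\<integral>y. (w m y)\<^sup>2 \<partial>H)) \<longlonglongrightarrow> (\<integral>y. (g y)\<^sup>2 \<partial>H)"
  proof -
    have "(\<integral>y. (w m y)\<^sup>2 \<partial>H) = (\<integral>y. (g y)\<^sup>2 \<partial>H) - 2 * h m * Hg + (h m)\<^sup>2" for m
    proof -
      have "(\<integral>y. (w m y)\<^sup>2 \<partial>H) = (\<integral>y. (g y)\<^sup>2 - 2 * h m * g y + (h m)\<^sup>2 \<partial>H)"
        unfolding w by (simp add: power2_diff algebra_simps)
      then show ?thesis using int_H by (simp add: Hg_def H.prob_space)
    qed
    then show ?thesis by (simp only:) (rule tendsto_eq_intros lh refl | simp)+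
  qed
  have lE: "(\<lambda>m. latent_bound (n m) (k m) / real (n m)) \<longlonglongrightarrow> 0"
    by (rule latent_bound_lim[OF n lk])
  \<comment> \<open>The Chebyshev tolerance is \<open>e * q m\<close>, a fraction of the scale
    \<surd>n of the gamma sum. Its square cancels the order n of the second moment, and only the
    term with K^(\<sigma> - 1) survives in the limit.\<close>
  define \<rho> where "\<rho> e K m = (2 * (\<integral>y. (w m y)\<^sup>2 \<partial>H) * latent_bound (n m) (k m) + (\<integral>y. w m y \<partial>H)\<^sup>2 *
     ((\<sigma> + 2 * a * (2 * K) powr \<sigma>) * latent_bound (n m) (k m) + 2 * a * \<theta> * real (n m) * K powr (\<sigma> - 1))) / (e * q m)\<^sup>2" for e K m
  have l\<rho>: "\<rho> e K \<longlonglongrightarrow> Hg\<^sup>2 * (2 * a * \<theta> * K powr (\<sigma> - 1)) / e\<^sup>2" if e: "0 < e" for e K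
  proof -
    have "\<rho> e K = (\<lambda>m. (2 * (\<integral>y. (w m y)\<^sup>2 \<partial>H) * (latent_bound (n m) (k m) / real (n m)) + (\<integral>y. w m y \<partial>H)\<^sup>2 *
     ((\<sigma> + 2 * a * (2 * K) powr \<sigma>) * (latent_bound (n m) (k m) / real (n m)) + 2 * a * \<theta> * K powr (\<sigma> - 1))) / e\<^sup>2)"
    proof
      fix m
      show "\<rho> e K m = (2 * (\<integral>y. (w m y)\<^sup>2 \<partial>H) * (latent_bound (n m) (k m) / real (n m)) + (\<integral>y. w m y \<partial>H)\<^sup>2 *
     ((\<sigma> + 2 * a * (2 * K) powr \<sigma>) * (latent_bound (n m) (k m) / real (n m)) + 2 * a * \<theta> * K powr (\<sigma> - 1))) / e\<^sup>2"
        using n0(2)[of m] e by (simp add: \<rho>_def power_mult_distrib qq field_simps)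
    qed
    moreover have "(\<lambda>m. (2 * A m * L m + B m * (c1 * L m + c2)) / e\<^sup>2) \<longlonglongrightarrow> \<beta> * c2 / e\<^sup>2"
      if "A \<longlonglongrightarrow> \<alpha>" "B \<longlonglongrightarrow> \<beta>" "L \<longlonglongrightarrow> 0" for A B L :: "nat \<Rightarrow> real" and \<alpha> \<beta> c1 c2 :: real
      using e by (auto intro!: tendsto_eq_intros that)
    note this[OF lh3 lh2 lE]
    ultimately show ?thesis by (simp only:)
  qed
  have bounds: "cdf (mean_law (n m) (X m) f) (x m) \<le> cdf (G m) (t + 2 * e / s) + \<rho> e K m"
    "cdf (G m) (t - 2 * e / s) \<le> cdf (mean_law (n m) (X m) f) (x m) + \<rho> e K m" if e: "0 < e" and K: "\<theta> \<le> K" for e K m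
  proof -
    have eq: "0 < e * q m" using e q0[of m] by simp
    note b = mean_law_cdf_bounds[where n = "n m" and X = "X m" and x = "x m" and f = f and \<epsilon> = "e * q m" and K = K, OF n3 f int_H(4) eq K]
    note cc = cut_centering[OF n0(1), of m "X m" t, folded x_def, folded w_def, folded D_def, folded p_def q_def]
    have r1: "(- (- (s * t * q m)) + 2 * (e * q m)) / (s * q m) = t + 2 * e / s"
      "(- (- (s * t * q m)) - 2 * (e * q m)) / (s * q m) = t - 2 * e / s"
      using s_pos q0[of m] by (simp_all add: field_simps)
    show "cdf (mean_law (n m) (X m) f) (x m) \<le> cdf (G m) (t + 2 * e / s) + \<rho> e K m"
      using b(1)[folded w_def, folded D_def, folded p_def, unfolded cc] unfolding scale r1 \<rho>_def k_def .
    show "cdf (G m) (t - 2 * e / s) \<le> cdf (mean_law (n m) (X m) f) (x m) + \<rho> e K m"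
      using b(2)[folded w_def, folded D_def, folded p_def, unfolded cc] unfolding scale r1 \<rho>_def k_def .
  qed
  have "(\<lambda>m. cdf (mean_law (n m) (X m) f) (x m)) \<longlonglongrightarrow> std_normal_cdf t"
  proof (rule tendstoI)
    fix \<delta> :: real assume \<delta>: "0 < \<delta>"
    have "(std_normal_cdf \<longlongrightarrow> std_normal_cdf t) (at t)" using isCont_std_normal_cdf by (simp add: isCont_def)
    then obtain d where d: "0 < d" "\<And>r. dist r t < d \<Longrightarrow> dist (std_normal_cdf r) (std_normal_cdf t) < \<delta> / 3"
      using \<delta> isCont_std_normal_cdf[of t] unfolding continuous_at_eps_delta dist_real_def
      by (metis divide_pos_pos zero_less_numeral)
    \<comment> \<open>The shift 2 \<epsilon> becomes 2 e / s = d / 2 on the normal scale, within the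
      radius of continuity.\<close>
    define e where "e = s * d / 4"
    have e: "0 < e" "2 * e / s < d" using s_pos d by (auto simp: e_def)
    have "0 < 2 * e / s" using e(1) s_pos by simp
    then have "\<bar>std_normal_cdf (t + 2 * e / s) - std_normal_cdf t\<bar> < \<delta> / 3" "\<bar>std_normal_cdf (t - 2 * e / s) - std_normal_cdf t\<bar> < \<delta> / 3"
      using d(2)[of "t + 2 * e / s"] d(2)[of "t - 2 * e / s"] e(2) unfolding dist_real_def by auto
    then have P: "std_normal_cdf (t + 2 * e / s) < std_normal_cdf t + \<delta> / 3" "std_normal_cdf t - \<delta> / 3 < std_normal_cdf (t - 2 * e / s)"
      by linarith+
    \<comment> \<open>\<open>K\<close> is fixed before the limit in \<open>m\<close>, so that the
      surviving part of \<open>\<rho>\<close> lies below \<delta> / 3; here \<sigma> < 1 is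
      decisive.\<close>
    have "((\<lambda>K. Hg\<^sup>2 * (2 * a * \<theta> * K powr (\<sigma> - 1)) / e\<^sup>2) \<longlongrightarrow> Hg\<^sup>2 * (2 * a * \<theta> * 0) / e\<^sup>2) at_top"
      using \<sigma> e by (intro tendsto_intros tendsto_neg_powr filterlim_ident) auto
    then have "\<forall>\<^sub>F K in at_top. Hg\<^sup>2 * (2 * a * \<theta> * K powr (\<sigma> - 1)) / e\<^sup>2 < \<delta> / 3"
      using \<delta> by (intro order_tendstoD(2)) auto
    then have "\<forall>\<^sub>F K in at_top. Hg\<^sup>2 * (2 * a * \<theta> * K powr (\<sigma> - 1)) / e\<^sup>2 < \<delta> / 3 \<and> \<theta> \<le> K"
      using eventually_ge_at_top[of \<theta>] by eventually_elim simp
    then obtain K where K: "Hg\<^sup>2 * (2 * a * \<theta> * K powr (\<sigma> - 1)) / e\<^sup>2 < \<delta> / 3" "\<theta> \<le> K"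
      by (auto simp: eventually_at_top_linorder)
    have "\<forall>\<^sub>F m in sequentially. \<rho> e K m < \<delta> / 3" by (rule order_tendstoD(2)[OF l\<rho>[OF e(1)] K(1)])
    moreover have "\<forall>\<^sub>F m in sequentially. cdf (G m) (t + 2 * e / s) < std_normal_cdf t + \<delta> / 3"
      by (rule order_tendstoD(2)[OF Gcdf P(1)])
    moreover have "\<forall>\<^sub>F m in sequentially. std_normal_cdf t - \<delta> / 3 < cdf (G m) (t - 2 * e / s)"
      by (rule order_tendstoD(1)[OF Gcdf P(2)])
    ultimately show "\<forall>\<^sub>F m in sequentially. dist (cdf (mean_law (n m) (X m) f) (x m)) (std_normal_cdf t) < \<delta>"
    proof eventually_elim
      case (elim m)
      then show ?case using bounds[OF e(1) K(2), of m] \<delta> by (simp add: dist_real_def abs_less_iff)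
    qed
  qed
  then show ?thesis by (simp add: x_def)
qed

section \<open>Uniform approximation on typical samples\<close>

text \<open>The four statistics are those whose limits \<open>cdf_limit\<close> assumes. They share
  one tolerance, so a failure of uniformity can be tested along a single null sequence.\<close>

definition atypical :: "real \<Rightarrow> nat \<Rightarrow> (nat \<Rightarrow> 'a) set" where
  "atypical \<kappa> n =
    {X \<in> space \<Omega>. \<kappa> \<le> \<bar>real (card (distinct_values n X)) / real n\<bar>}
    \<union> {X \<in> space \<Omega>. \<kappa> \<le> \<bar>(\<Sum>y\<in>distinct_values n X. (g y)\<^sup>2) / real n\<bar>}
    \<union> {X \<in> space \<Omega>. \<kappa> \<le> \<bar>score n X / real n\<bar>}
    \<union> {X \<in> space \<Omega>. \<kappa> \<le> \<bar>(\<Sum>i<n. (g (X i))\<^sup>2) / real n - s2\<bar>}"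

lemma statistics_measurable [measurable]:
  "(\<lambda>X. real (card (distinct_values n X))) \<in> borel_measurable \<Omega>"
  "(\<lambda>X. \<Sum>y\<in>distinct_values n X. (g y)\<^sup>2) \<in> borel_measurable \<Omega>"
  "(\<lambda>X. \<Sum>y\<in>distinct_values n X. f y) \<in> borel_measurable \<Omega>"
  "score n \<in> borel_measurable \<Omega>" "(\<lambda>X. \<Sum>i<n. (g (X i))\<^sup>2) \<in> borel_measurable \<Omega>"
proof -
  show "(\<lambda>X. real (card (distinct_values n X))) \<in> borel_measurable \<Omega>" by (rule distinct_card_measurable)
  show "(\<lambda>X. \<Sum>y\<in>distinct_values n X. (g y)\<^sup>2) \<in> borel_measurable \<Omega>" by (rule distinct_sum_measurable) measurable
  show "(\<lambda>X. \<Sum>y\<in>distinct_values n X. f y) \<in> borel_measurable \<Omega>" by (rule distinct_sum_measurable[OF f])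
  show "score n \<in> borel_measurable \<Omega>" unfolding score_def[abs_def] by measurable
  show "(\<lambda>X. \<Sum>i<n. (g (X i))\<^sup>2) \<in> borel_measurable \<Omega>" by measurable
qed

lemma corr_measurable [measurable]: "corr n \<in> borel_measurable \<Omega>"
  unfolding corr_def[abs_def] distinct_mean_def by measurable

lemma cut_measurable [measurable]: "(\<lambda>X. cut n X t) \<in> borel_measurable \<Omega>"
  unfolding cut_def by measurable

lemma atypical_measurable [measurable]: "atypical \<kappa> n \<in> sets \<Omega>"
  unfolding atypical_def by measurable

lemma atypical_vanishes:
  assumes \<kappa>: "0 < \<kappa>"
  shows "(\<lambda>n. measure \<Omega> (atypical \<kappa> n)) \<longlonglongrightarrow> 0"
proof (rule Lim_null_comparison)
  let ?A = "\<lambda>n. {X \<in> space \<Omega>. \<kappa> \<le> \<bar>real (card (distinct_values n X)) / real n\<bar>}"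
  let ?B = "\<lambda>n. {X \<in> space \<Omega>. \<kappa> \<le> \<bar>(\<Sum>y\<in>distinct_values n X. (g y)\<^sup>2) / real n\<bar>}"
  let ?C = "\<lambda>n. {X \<in> space \<Omega>. \<kappa> \<le> \<bar>score n X / real n\<bar>}"
  let ?D = "\<lambda>n. {X \<in> space \<Omega>. \<kappa> \<le> \<bar>(\<Sum>i<n. (g (X i))\<^sup>2) / real n - s2\<bar>}"
  have "vanishes (\<lambda>n X. real (card (distinct_values n X)) / real n)"
    by (rule distinct_sum_vanishes[of "\<lambda>_. 1", unfolded real_of_card[symmetric]]) auto
  moreover have "vanishes (\<lambda>n X. (\<Sum>y\<in>distinct_values n X. (g y)\<^sup>2) / real n)"
    by (rule distinct_sum_vanishes) (use int_P0 in auto)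
  moreover have "vanishes (\<lambda>n X. score n X / real n)"
    using weak_law[of g] int_P0 by (simp add: mean_g score_def)
  moreover have "vanishes (\<lambda>n X. (\<Sum>i<n. (g (X i))\<^sup>2) / real n - s2)"
    unfolding s2_def by (rule weak_law) (use int_P0 in auto)
  ultimately have "(\<lambda>n. measure \<Omega> (?A n)) \<longlonglongrightarrow> 0" "(\<lambda>n. measure \<Omega> (?B n)) \<longlonglongrightarrow> 0"
    "(\<lambda>n. measure \<Omega> (?C n)) \<longlonglongrightarrow> 0" "(\<lambda>n. measure \<Omega> (?D n)) \<longlonglongrightarrow> 0"
    using \<kappa> unfolding vanishes_def by blast+
  then show "(\<lambda>n. measure \<Omega> (?A n) + measure \<Omega> (?B n) + measure \<Omega> (?C n) + measure \<Omega> (?D n)) \<longlonglongrightarrow> 0"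
    by (intro tendsto_add_zero)
  show "\<forall>\<^sub>F n in sequentially. norm (measure \<Omega> (atypical \<kappa> n))
    \<le> measure \<Omega> (?A n) + measure \<Omega> (?B n) + measure \<Omega> (?C n) + measure \<Omega> (?D n)"
  proof (rule always_eventually, rule allI)
    fix n
    have "measure \<Omega> (atypical \<kappa> n) \<le> measure \<Omega> (?A n \<union> ?B n \<union> ?C n) + measure \<Omega> (?D n)"
      unfolding atypical_def by (intro measure_Un_le) measurable
    also have "measure \<Omega> (?A n \<union> ?B n \<union> ?C n) \<le> measure \<Omega> (?A n \<union> ?B n) + measure \<Omega> (?C n)"
      by (intro measure_Un_le) measurable
    also have "measure \<Omega> (?A n \<union> ?B n) \<le> measure \<Omega> (?A n) + measure \<Omega> (?B n)"
      by (intro measure_Un_le) measurable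
    finally show "norm (measure \<Omega> (atypical \<kappa> n))
      \<le> measure \<Omega> (?A n) + measure \<Omega> (?B n) + measure \<Omega> (?C n) + measure \<Omega> (?D n)" by simp
  qed
qed

text \<open>If every tolerance failed, tolerances tending to 0 would supply counterexamples at
  arbitrarily large sizes. Together these samples form an array satisfying the hypotheses of
  \<open>cdf_limit\<close>, whose conclusion contradicts the gap \<eta>.\<close>

lemma cdf_typical:
  assumes \<eta>: "0 < \<eta>"
  obtains \<kappa> where "0 < \<kappa>"
    "\<forall>\<^sub>F n in sequentially. \<forall>X\<in>space \<Omega> - atypical \<kappa> n. \<bar>cdf (mean_law n X f) (cut n X t) - std_normal_cdf t\<bar> < \<eta>"
proof -
  have "\<exists>\<kappa>>0. \<forall>\<^sub>F n in sequentially. \<forall>X\<in>space \<Omega> - atypical \<kappa> n. \<bar>cdf (mean_law n X f) (cut n X t) - std_normal_cdf t\<bar> < \<eta>"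
  proof (rule ccontr)
    assume none: "\<not> ?thesis"
    define \<kappa> where "\<kappa> m = 1 / real (Suc m)" for m
    have \<kappa>: "0 < \<kappa> m" for m by (simp add: \<kappa>_def)
    have \<kappa>0: "\<kappa> \<longlonglongrightarrow> 0" unfolding \<kappa>_def[abs_def] by (rule lim_1_over_n[THEN LIMSEQ_Suc])
    \<comment> \<open>The lower bound \<open>m + 3\<close> both drives the sizes to infinity and
      meets the minimal size 3 of the moment bounds.\<close>
    have "\<exists>n X. m + 3 \<le> n \<and> X \<in> space \<Omega> - atypical (\<kappa> m) n \<and> \<eta> \<le> \<bar>cdf (mean_law n X f) (cut n X t) - std_normal_cdf t\<bar>" for m
      using none \<kappa>[of m] unfolding eventually_sequentially by (metis not_le)
    then obtain n X where nX: "\<And>m. m + 3 \<le> n m" "\<And>m. X m \<in> space \<Omega> - atypical (\<kappa> m) (n m)"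
      "\<And>m. \<eta> \<le> \<bar>cdf (mean_law (n m) (X m) f) (cut (n m) (X m) t) - std_normal_cdf t\<bar>" by metis
    have small: "\<bar>real (card (distinct_values (n m) (X m))) / real (n m)\<bar> \<le> \<kappa> m"
      "\<bar>(\<Sum>y\<in>distinct_values (n m) (X m). (g y)\<^sup>2) / real (n m)\<bar> \<le> \<kappa> m"
      "\<bar>score (n m) (X m) / real (n m)\<bar> \<le> \<kappa> m"
      "\<bar>(\<Sum>i<n m. (g (X m i))\<^sup>2) / real (n m) - s2\<bar> \<le> \<kappa> m" for m
      using nX(2)[of m] unfolding atypical_def by (auto simp only: Diff_iff Un_iff mem_Collect_eq not_le intro: less_imp_le)
    have "(\<lambda>m. cdf (mean_law (n m) (X m) f) (cut (n m) (X m) t)) \<longlonglongrightarrow> std_normal_cdf t"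
    proof (rule cdf_limit)
      show "filterlim n at_top sequentially"
        using nX(1) by (intro filterlim_at_top_mono[OF filterlim_ident] always_eventually allI) (rule add_leD1)
      show "3 \<le> n m" for m using nX(1)[of m] by simp
      show "(\<lambda>m. real (card (distinct_values (n m) (X m))) / real (n m)) \<longlonglongrightarrow> 0"
        by (rule Lim_null_comparison[OF _ \<kappa>0]) (use small(1) in simp)
      show "(\<lambda>m. (\<Sum>y\<in>distinct_values (n m) (X m). (g y)\<^sup>2) / real (n m)) \<longlonglongrightarrow> 0"
        by (rule Lim_null_comparison[OF _ \<kappa>0]) (intro always_eventually allI, unfold real_norm_def, rule small(2))
      show "(\<lambda>m. score (n m) (X m) / real (n m)) \<longlonglongrightarrow> 0"
        by (rule Lim_null_comparison[OF _ \<kappa>0]) (intro always_eventually allI, unfold real_norm_def, rule small(3))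
      have "(\<lambda>m. (\<Sum>i<n m. (g (X m i))\<^sup>2) / real (n m) - s2) \<longlonglongrightarrow> 0"
        by (rule Lim_null_comparison[OF _ \<kappa>0]) (intro always_eventually allI, unfold real_norm_def, rule small(4))
      then show "(\<lambda>m. (\<Sum>i<n m. (g (X m i))\<^sup>2) / real (n m)) \<longlonglongrightarrow> s2" by (simp only: LIM_zero_iff)
    qed
    from tendstoD[OF this \<eta>] obtain m where "\<bar>cdf (mean_law (n m) (X m) f) (cut (n m) (X m) t) - std_normal_cdf t\<bar> < \<eta>"
      unfolding dist_real_def eventually_sequentially by blast
    then show False using nX(3)[of m] by simp
  qed
  then show thesis using that by blast
qed

section \<open>Location of the quantiles and coverage\<close>

definition L :: "real \<Rightarrow> nat \<Rightarrow> (nat \<Rightarrow> 'a) \<Rightarrow> real" where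
  "L p n X = quantile (mean_law n X f) p"

lemma L_le_iff:
  assumes "0 < p" "p < 1"
  shows "L p n X \<le> x \<longleftrightarrow> p \<le> cdf (mean_law n X f) x"
  unfolding L_def by (rule real_distribution.quantile_le_iff[OF real_distribution_mean_law[OF f] assms])

lemma L_mono:
  assumes "0 < p" "p \<le> r" "r < 1"
  shows "L p n X \<le> L r n X"
  using assms L_le_iff[of p n X "L r n X"] L_le_iff[of r n X "L r n X"] by simp

lemma L_measurable [measurable]:
  assumes p: "0 < p" "p < 1" and n: "0 < n"
  shows "L p n \<in> borel_measurable \<Omega>"
proof (rule borel_measurableI_le)
  fix x
  have [measurable]: "(\<lambda>X. cdf (mean_law n X f) x) \<in> borel_measurable \<Omega>"
    using cdf_mean_law_measurable[OF n f int_H(1)] by (simp add: measurable_cong_sets[OF sets_\<Omega> refl])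
  show "{X \<in> space \<Omega>. L p n X \<le> x} \<in> sets \<Omega>" unfolding L_le_iff[OF p] by measurable
qed

text \<open>Typical samples have posterior distribution function close to \<Phi> t at the threshold,
  so comparing \<Phi> t with \<open>p\<close> decides on which side of it the quantile lies. Letting
  t approach \<Phi>^(-1)(p) from both sides locates the quantile up to o(1 / \<surd>n) in
  probability.\<close>

lemma L_location:
  assumes p: "0 < p" "p < 1"
  shows L_gt_cut: "std_normal_cdf t < p \<Longrightarrow> (\<lambda>n. measure \<Omega> {X \<in> space \<Omega>. L p n X \<le> cut n X t}) \<longlonglongrightarrow> 0"
    and L_le_cut: "p < std_normal_cdf t \<Longrightarrow> (\<lambda>n. measure \<Omega> {X \<in> space \<Omega>. cut n X t < L p n X}) \<longlonglongrightarrow> 0"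
proof -
  assume t: "std_normal_cdf t < p"
  from cdf_typical[of "p - std_normal_cdf t" t] t obtain \<kappa> where \<kappa>: "0 < \<kappa>"
    "\<forall>\<^sub>F n in sequentially. \<forall>X\<in>space \<Omega> - atypical \<kappa> n. \<bar>cdf (mean_law n X f) (cut n X t) - std_normal_cdf t\<bar> < p - std_normal_cdf t"
    by (auto simp only: diff_gt_0_iff_gt)
  show "(\<lambda>n. measure \<Omega> {X \<in> space \<Omega>. L p n X \<le> cut n X t}) \<longlonglongrightarrow> 0"
  proof (rule Lim_null_comparison[OF _ atypical_vanishes[OF \<kappa>(1)]])
    show "\<forall>\<^sub>F n in sequentially. norm (measure \<Omega> {X \<in> space \<Omega>. L p n X \<le> cut n X t}) \<le> measure \<Omega> (atypical \<kappa> n)"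
      using \<kappa>(2)
    proof eventually_elim
      case (elim n)
      then have "{X \<in> space \<Omega>. L p n X \<le> cut n X t} \<subseteq> atypical \<kappa> n"
        unfolding L_le_iff[OF p] by force
      then show ?case using S.finite_measure_mono[OF _ atypical_measurable] by simp
    qed
  qed
next
  assume t: "p < std_normal_cdf t"
  from cdf_typical[of "std_normal_cdf t - p" t] t obtain \<kappa> where \<kappa>: "0 < \<kappa>"
    "\<forall>\<^sub>F n in sequentially. \<forall>X\<in>space \<Omega> - atypical \<kappa> n. \<bar>cdf (mean_law n X f) (cut n X t) - std_normal_cdf t\<bar> < std_normal_cdf t - p"
    by (auto simp only: diff_gt_0_iff_gt)
  show "(\<lambda>n. measure \<Omega> {X \<in> space \<Omega>. cut n X t < L p n X}) \<longlonglongrightarrow> 0"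
  proof (rule Lim_null_comparison[OF _ atypical_vanishes[OF \<kappa>(1)]])
    show "\<forall>\<^sub>F n in sequentially. norm (measure \<Omega> {X \<in> space \<Omega>. cut n X t < L p n X}) \<le> measure \<Omega> (atypical \<kappa> n)"
      using \<kappa>(2)
    proof eventually_elim
      case (elim n)
      then have "{X \<in> space \<Omega>. cut n X t < L p n X} \<subseteq> atypical \<kappa> n"
        unfolding not_le[symmetric] L_le_iff[OF p] by force
      then show ?case using S.finite_measure_mono[OF _ atypical_measurable] by simp
    qed
  qed
qed

text \<open>Stated for minus the score, since \<open>c + corr n X \<le> cut n X t\<close> amounts to
  an upper bound on it; the limit is then \<Phi> t directly, without an appeal to symmetry.\<close>

lemma score_central_limit:
  "(\<lambda>n. measure \<Omega> {X \<in> space \<Omega>. - score n X / (s * sqrt (real n)) \<le> t}) \<longlonglongrightarrow> std_normal_cdf t"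
proof -
  have c: "integrable \<Omega> (\<lambda>X. (g (X i))\<^sup>2)" "(\<integral>X. (g (X i))\<^sup>2 \<partial>\<Omega>) = s\<^sup>2" "(\<integral>X. g (X i) \<partial>\<Omega>) = 0" for i
    using integral_coordinate[of "\<lambda>x. (g x)\<^sup>2" i] integral_coordinate[of g i] int_P0
    by (simp_all add: s2_def s_sq mean_g)
  have "weak_conv_m (\<lambda>n. distr \<Omega> borel (\<lambda>X. (\<Sum>i<n. - g (X i)) / sqrt (real n * s\<^sup>2))) std_normal_distribution"
  proof (rule S.central_limit_theorem_zero_mean[where \<mu> = "distr P0 borel (\<lambda>x. - g x)"])
    show "S.indep_vars (\<lambda>_. borel) (\<lambda>i X. - g (X i)) UNIV"
      by (rule indep_coordinates[of "\<lambda>x. - g x"]) measurable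
    show "(\<integral>X. - g (X i) \<partial>\<Omega>) = 0" "0 < s" "integrable \<Omega> (\<lambda>X. (- g (X i))\<^sup>2)"
      "S.variance (\<lambda>X. - g (X i)) = s\<^sup>2" for i
      using c s_pos by simp_all
    show "distr \<Omega> borel (\<lambda>X. - g (X i)) = distr P0 borel (\<lambda>x. - g x)" for i
    proof -
      have "distr \<Omega> borel (\<lambda>X. - g (X i)) = distr (distr \<Omega> P0 (\<lambda>X. X i)) borel (\<lambda>x. - g x)"
        by (subst distr_distr) (auto simp: comp_def)
      then show ?thesis by (simp add: distr_coordinate)
    qed
  qed
  then have "(\<lambda>n. cdf (distr \<Omega> borel (\<lambda>X. (\<Sum>i<n. - g (X i)) / sqrt (real n * s\<^sup>2))) t) \<longlonglongrightarrow> std_normal_cdf t"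
    using isCont_std_normal_cdf by (simp add: weak_conv_m_def weak_conv_def)
  moreover have "cdf (distr \<Omega> borel (\<lambda>X. (\<Sum>i<n. - g (X i)) / sqrt (real n * s\<^sup>2))) t
    = measure \<Omega> {X \<in> space \<Omega>. - score n X / (s * sqrt (real n)) \<le> t}" for n
  proof -
    have "(\<Sum>i<n. - g (X i)) / sqrt (real n * s\<^sup>2) = - score n X / (s * sqrt (real n))" for X
      using s_pos by (simp add: score_def sum_negf real_sqrt_mult mult.commute)
    then show ?thesis
      unfolding cdf_def by (simp add: measure_distr vimage_def Int_def conj_commute)
  qed
  ultimately show ?thesis by simp
qed

lemma score_le_iff:
  assumes "0 < n"
  shows "- score n X / (s * sqrt (real n)) \<le> t \<longleftrightarrow> c + corr n X \<le> cut n X t"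
proof -
  have "cut n X t - (c + corr n X) = s / sqrt (real n) * (t - - score n X / (s * sqrt (real n)))"
    using s_pos assms by (simp add: cut_def field_simps)
  moreover have "0 < s / sqrt (real n)" using s_pos assms by simp
  ultimately have "0 \<le> cut n X t - (c + corr n X) \<longleftrightarrow> 0 \<le> t - - score n X / (s * sqrt (real n))"
    by (simp only: zero_le_mult_iff) auto
  then show ?thesis by linarith
qed

text \<open>The unknown quantile is replaced by the explicit threshold \<open>cut\<close>, taken at
  a level slightly below \<open>p\<close> for the lower bound and slightly above for the upper one.
  Both the strict and the weak inequality are treated, because an open interval excludes the weak
  event at its lower end and uses the strict one at its upper end; the event of equality needs no
  separate estimate.\<close>

lemma one_sided_coverage:
  assumes p: "0 < p" "p < 1"
  shows "(\<lambda>n. measure \<Omega> {X \<in> space \<Omega>. c + corr n X < L p n X}) \<longlonglongrightarrow> p" (is "?A \<longlonglongrightarrow> p")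
    and "(\<lambda>n. measure \<Omega> {X \<in> space \<Omega>. c + corr n X \<le> L p n X}) \<longlonglongrightarrow> p" (is "?B \<longlonglongrightarrow> p")
proof -
  have AB: "\<forall>\<^sub>F n in sequentially. ?A n \<le> ?B n"
    using eventually_gt_at_top[of 0]
  proof eventually_elim
    case (elim n)
    note [measurable] = L_measurable[OF p elim]
    show ?case by (intro S.finite_measure_mono) auto
  qed
  have low: "\<forall>\<^sub>F n in sequentially. p - \<delta> < ?A n" if \<delta>: "0 < \<delta>" for \<delta>
  proof -
    \<comment> \<open>Half of the minimum keeps the level \<open>r\<close> positive and strictly
      between p - \<delta> and p.\<close>
    define r where "r = p - min \<delta> p / 2"
    have r: "0 < r" "r < p" "r < 1" "p - \<delta> < r" using p \<delta> by (auto simp: r_def min_def)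
    obtain t where t: "std_normal_cdf t = r" using std_normal_cdf_surj[OF r(1,3)] .
    have "(\<lambda>n. measure \<Omega> {X \<in> space \<Omega>. - score n X / (s * sqrt (real n)) \<le> t} - measure \<Omega> {X \<in> space \<Omega>. L p n X \<le> cut n X t}) \<longlonglongrightarrow> r - 0"
      using r(2) unfolding t[symmetric] by (intro tendsto_diff score_central_limit L_gt_cut p)
    then have "\<forall>\<^sub>F n in sequentially. p - \<delta> < measure \<Omega> {X \<in> space \<Omega>. - score n X / (s * sqrt (real n)) \<le> t} - measure \<Omega> {X \<in> space \<Omega>. L p n X \<le> cut n X t}"
      using r(4) by (intro order_tendstoD) auto
    then show ?thesis using eventually_gt_at_top[of 0]
    proof eventually_elim
      case (elim n)
      note [measurable] = L_measurable[OF p elim(2)]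
      \<comment> \<open>When the shifted true mean is at most the threshold and the quantile is
        above the threshold, the former lies below the latter.\<close>
      have "measure \<Omega> {X \<in> space \<Omega>. - score n X / (s * sqrt (real n)) \<le> t}
        \<le> measure \<Omega> ({X \<in> space \<Omega>. c + corr n X < L p n X} \<union> {X \<in> space \<Omega>. L p n X \<le> cut n X t})"
        unfolding score_le_iff[OF elim(2)] by (intro S.finite_measure_mono) auto
      also have "\<dots> \<le> ?A n + measure \<Omega> {X \<in> space \<Omega>. L p n X \<le> cut n X t}"
        by (intro measure_Un_le) measurable
      finally show ?case using elim(1) by simp
    qed
  qed
  have up: "\<forall>\<^sub>F n in sequentially. ?B n < p + \<delta>" if \<delta>: "0 < \<delta>" for \<delta>
  proof -
    define r where "r = p + min \<delta> (1 - p) / 2"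
    have r: "0 < r" "p < r" "r < 1" "r < p + \<delta>" using p \<delta> by (auto simp: r_def min_def field_simps)
    obtain t where t: "std_normal_cdf t = r" using std_normal_cdf_surj[OF r(1,3)] .
    have "(\<lambda>n. measure \<Omega> {X \<in> space \<Omega>. - score n X / (s * sqrt (real n)) \<le> t} + measure \<Omega> {X \<in> space \<Omega>. cut n X t < L p n X}) \<longlonglongrightarrow> r + 0"
      using r(2) unfolding t[symmetric] by (intro tendsto_add score_central_limit L_le_cut p)
    then have "\<forall>\<^sub>F n in sequentially. measure \<Omega> {X \<in> space \<Omega>. - score n X / (s * sqrt (real n)) \<le> t} + measure \<Omega> {X \<in> space \<Omega>. cut n X t < L p n X} < p + \<delta>"
      using r(4) by (intro order_tendstoD) auto
    then show ?thesis using eventually_gt_at_top[of 0]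
    proof eventually_elim
      case (elim n)
      note [measurable] = L_measurable[OF p elim(2)]
      have "?B n \<le> measure \<Omega> ({X \<in> space \<Omega>. - score n X / (s * sqrt (real n)) \<le> t} \<union> {X \<in> space \<Omega>. cut n X t < L p n X})"
        unfolding score_le_iff[OF elim(2)] by (intro S.finite_measure_mono) auto
      also have "\<dots> \<le> measure \<Omega> {X \<in> space \<Omega>. - score n X / (s * sqrt (real n)) \<le> t} + measure \<Omega> {X \<in> space \<Omega>. cut n X t < L p n X}"
        by (intro measure_Un_le) measurable
      finally show ?case using elim(1) by simp
    qed
  qed
  have low': "\<forall>\<^sub>F n in sequentially. p - \<delta> < ?B n" if "0 < \<delta>" for \<delta>
    using low[OF that] AB by eventually_elim simp
  have up': "\<forall>\<^sub>F n in sequentially. ?A n < p + \<delta>" if "0 < \<delta>" for \<delta>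
    using up[OF that] AB by eventually_elim simp
  show "?A \<longlonglongrightarrow> p"
  proof (rule order_tendstoI)
    show "\<forall>\<^sub>F n in sequentially. r < ?A n" if "r < p" for r using low[of "p - r"] that by simp
    show "\<forall>\<^sub>F n in sequentially. ?A n < r" if "p < r" for r using up'[of "r - p"] that by simp
  qed
  show "?B \<longlonglongrightarrow> p"
  proof (rule order_tendstoI)
    show "\<forall>\<^sub>F n in sequentially. r < ?B n" if "r < p" for r using low'[of "p - r"] that by simp
    show "\<forall>\<^sub>F n in sequentially. ?B n < r" if "p < r" for r using up[of "r - p"] that by simp
  qed
qed

text \<open>The covering event is squeezed between two differences of one-sided probabilities with
  the same limit. Below, the event for \<beta> is covered by \<open>?E\<close> and the weak event
  for \<alpha>; above, \<open>?E\<close> and the strict event for \<alpha> are disjoint and both lie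
  in the event for \<beta>, by monotonicity of quantiles.\<close>

lemma coverage:
  assumes \<alpha>\<beta>: "0 < \<alpha>" "\<alpha> < \<beta>" "\<beta> < 1"
  shows "(\<lambda>n. measure \<Omega> {X \<in> space \<Omega>. L \<alpha> n X < c + corr n X \<and> c + corr n X < L \<beta> n X}) \<longlonglongrightarrow> \<beta> - \<alpha>"
proof (rule tendsto_sandwich)
  let ?A = "\<lambda>p n. {X \<in> space \<Omega>. c + corr n X < L p n X}"
  let ?B = "\<lambda>n. {X \<in> space \<Omega>. c + corr n X \<le> L \<alpha> n X}"
  let ?E = "\<lambda>n. {X \<in> space \<Omega>. L \<alpha> n X < c + corr n X \<and> c + corr n X < L \<beta> n X}"
  have \<alpha>: "\<alpha> < 1" and \<beta>: "0 < \<beta>" using \<alpha>\<beta> by auto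
  note cov = one_sided_coverage[OF \<alpha>\<beta>(1) \<alpha>] one_sided_coverage[OF \<beta> \<alpha>\<beta>(3)]
  show "(\<lambda>n. measure \<Omega> (?A \<beta> n) - measure \<Omega> (?B n)) \<longlonglongrightarrow> \<beta> - \<alpha>"
    "(\<lambda>n. measure \<Omega> (?A \<beta> n) - measure \<Omega> (?A \<alpha> n)) \<longlonglongrightarrow> \<beta> - \<alpha>"
    by (intro tendsto_diff cov)+
  show "\<forall>\<^sub>F n in sequentially. measure \<Omega> (?A \<beta> n) - measure \<Omega> (?B n) \<le> measure \<Omega> (?E n)"
    using eventually_gt_at_top[of 0]
  proof eventually_elim
    case (elim n)
    note [measurable] = L_measurable[OF \<alpha>\<beta>(1) \<alpha> elim] L_measurable[OF \<beta> \<alpha>\<beta>(3) elim]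
    have "measure \<Omega> (?A \<beta> n) \<le> measure \<Omega> (?E n \<union> ?B n)"
      by (intro S.finite_measure_mono) auto
    also have "\<dots> \<le> measure \<Omega> (?E n) + measure \<Omega> (?B n)" by (intro measure_Un_le) measurable
    finally show ?case by simp
  qed
  show "\<forall>\<^sub>F n in sequentially. measure \<Omega> (?E n) \<le> measure \<Omega> (?A \<beta> n) - measure \<Omega> (?A \<alpha> n)"
    using eventually_gt_at_top[of 0]
  proof eventually_elim
    case (elim n)
    note [measurable] = L_measurable[OF \<alpha>\<beta>(1) \<alpha> elim] L_measurable[OF \<beta> \<alpha>\<beta>(3) elim]
    have "measure \<Omega> (?E n) + measure \<Omega> (?A \<alpha> n) = measure \<Omega> (?E n \<union> ?A \<alpha> n)"
      by (intro S.finite_measure_Union[symmetric]) auto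
    also have "\<dots> \<le> measure \<Omega> (?A \<beta> n)"
      using L_mono[OF \<alpha>\<beta>(1) _ \<alpha>\<beta>(3), of n] \<alpha>\<beta>(2) by (intro S.finite_measure_mono) (auto intro: less_le_trans)
    finally show ?case by simp
  qed
qed

end

theorem corollary15:
  fixes a \<sigma> \<theta> \<alpha> \<beta> :: real
    and H P0 :: "'a::polish_space measure"
    and f :: "'a \<Rightarrow> real"
    and M :: "'w measure"
    and N :: "real \<Rightarrow> 'w \<Rightarrow> (real \<times> 'a) measure"
  assumes "0 < a" and "0 < \<sigma>" and "\<sigma> < 1" and "0 < \<theta>"
    and H: "prob_space H" "sets H = sets borel" "\<And>x. measure H {x} = 0"
    and N: "\<And>u. 0 < u \<Longrightarrow> poisson_random_measure M (N u) (nggp_intensity a \<sigma> (\<theta> + u) H)"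
    and P0: "prob_space P0" "sets P0 = sets borel" "\<exists>S. countable S \<and> (AE x in P0. x \<in> S)"
    and f: "f \<in> borel_measurable borel"
      "integrable P0 (\<lambda>x. (f x)\<^sup>2)" "integrable H (\<lambda>x. (f x)\<^sup>2)"
    and nondegenerate: "0 < (\<integral>x. (f x - (\<integral>y. f y \<partial>P0))\<^sup>2 \<partial>P0)"
    and "0 < \<alpha>" and "\<alpha> < \<beta>" and "\<beta> < 1"
  shows
    "(\<lambda>n. measure (\<Pi>\<^sub>M i\<in>(UNIV::nat set). P0)
        {X \<in> space (\<Pi>\<^sub>M i\<in>(UNIV::nat set). P0).
          (let post = nggp_posterior M N a \<sigma> \<theta> n X;
               corr = \<sigma> * real (card (distinct_values n X)) / real n
                        * ((\<integral>y. f y \<partial>H) - distinct_mean n X f)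
           in (\<integral>y. f y \<partial>P0) \<in>
                {mean_quantile post f \<alpha> - corr <..< mean_quantile post f \<beta> - corr})})
      \<longlonglongrightarrow> \<beta> - \<alpha>"
proof -
  have "latent a \<sigma> \<theta>" by (rule latent.intro) fact+
  moreover have "nggp_axioms a \<sigma> \<theta> H M N" by (rule nggp_axioms.intro) (use H N in auto)
  moreover have "discrete_sample P0"
    by (intro discrete_sample.intro discrete_sample_axioms.intro) (use P0 in auto)
  moreover have "nggp_sample_axioms H P0 f"
    by (rule nggp_sample_axioms.intro) (use f nondegenerate in auto)
  ultimately have "nggp_sample a \<sigma> \<theta> H M N P0 f"
    by (simp only: nggp_sample_def nggp_def)
  then interpret nggp_sample a \<sigma> \<theta> H M N P0 f .
  have "(let post = nggp_posterior M N a \<sigma> \<theta> n X;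
               corr = \<sigma> * real (card (distinct_values n X)) / real n
                        * ((\<integral>y. f y \<partial>H) - distinct_mean n X f)
           in (\<integral>y. f y \<partial>P0) \<in>
                {mean_quantile post f \<alpha> - corr <..< mean_quantile post f \<beta> - corr})
    \<longleftrightarrow> L \<alpha> n X < c + corr n X \<and> c + corr n X < L \<beta> n X" for n X
    unfolding Let_def mean_quantile_def mean_law_def[symmetric] L_def[symmetric] c_def[symmetric] corr_def[symmetric]
    by (simp only: greaterThanLessThan_iff diff_less_eq less_diff_eq)
  then show ?thesis using coverage[OF \<open>0 < \<alpha>\<close> \<open>\<alpha> < \<beta>\<close> \<open>\<beta> < 1\<close>] by (simp only:)
qed

end
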